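(* (1) Let $1<p<\infty$. Then $\operatorname{dist}_{W^{1/p,p}}(\mathcal{E}_{d_1},\mathcal{E}_{d_2})=0$ for all $d_1,d_2\in\mathbb{Z}$. (2) Let $s>0$ and $1\le p<\infty$ with $sp>1$. Then there exist constants $C_{s,p},C'_{s,p}>0$ such that for all $d_1,d_2\in\mathbb{Z}$, $$C'_{s,p}|d_1-d_2|^s\le \operatorname{dist}_{W^{s,p}}(\mathcal{E}_{d_1},\mathcal{E}_{d_2})\le C_{s,p}|d_1-d_2|^s.$$
   Context: Let $s>0$, $1\le p<\infty$ with $sp\ge 1$. $W^{s,p}(\mathbb{S}^1;\mathbb{S}^1)$ is the set of $f\in W^{s,p}(\mathbb{S}^1;\mathbb{R}^2)$ with $|f|=1$ a.e. Such maps have a well-defined integer degree (the Brezis–Nirenberg degree): the unique extension of the topological degree of smooth maps that is continuous with respect to $W^{s,p}$ convergence (smooth maps are dense). For $d\in\mathbb{Z}$, $\mathcal{E}_d=\{f\in W^{s,p}(\mathbb{S}^1;\mathbb{S}^1):\deg f=d\}$. For $h\in W^{s,p}(\mathbb{S}^1;\mathbb{R}^2)$, $|h|_{W^{s,p}}=\|h-\fint_{\mathbb{S}^1}h\|_{W^{s,p}}$ for a fixed standard $W^{s,p}$ norm; when $0<s<1$ one may use the Gagliardo semi-norm $\left(\int_{\mathbb{S}^1}\int_{\mathbb{S}^1}\frac{|h(x)-h(y)|^p}{|x-y|^{1+sp}}dx\,dy\right)^{1/p}$. Then $d_{W^{s,p}}(f,g)=|f-g|_{W^{s,p}}$ and $\operatorname{dist}_{W^{s,p}}(\mathcal{E}_{d_1},\mathcal{E}_{d_2})=\inf_{f\in\mathcal{E}_{d_1}}\inf_{g\in\mathcal{E}_{d_2}}d_{W^{s,p}}(f,g)$.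 *)

theory Defs
  imports "HOL-Complex_Analysis.Complex_Analysis"
begin

text \<open>The circle S^1 is parametrised by the angle x in [0, 2 pi] (arc-length measure dx);
  maps S^1 -> R^2 are 2 pi-periodic functions real => complex (R^2 = C).
  Distance between points of S^1 is the chordal distance |e^(ix) - e^(iy)|.\<close>

definition periodic2pi :: "(real \<Rightarrow> complex) \<Rightarrow> bool" where
  "periodic2pi f \<longleftrightarrow> (\<forall>x. f (x + 2*pi) = f x)"

definition smooth_periodic :: "(real \<Rightarrow> complex) \<Rightarrow> bool" where
  "smooth_periodic g \<longleftrightarrow> periodic2pi g \<and>
     (\<exists>D :: nat \<Rightarrow> real \<Rightarrow> complex. D 0 = g \<and>
        (\<forall>k t. (D k has_vector_derivative D (Suc k) t) (at t)))"

definition weak_deriv :: "(real \<Rightarrow> complex) \<Rightarrow> (real \<Rightarrow> complex) \<Rightarrow> bool" where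
  "weak_deriv f g \<longleftrightarrow> set_integrable lebesgue {0..2*pi} f \<and> set_integrable lebesgue {0..2*pi} g \<and>
     (\<forall>\<phi>. smooth_periodic \<phi> \<longrightarrow>
        (LINT x:{0..2*pi}|lebesgue. f x * vector_derivative \<phi> (at x))
          = - (LINT x:{0..2*pi}|lebesgue. g x * \<phi> x))"

definition weak_derivs :: "nat \<Rightarrow> (real \<Rightarrow> complex) \<Rightarrow> (nat \<Rightarrow> real \<Rightarrow> complex) \<Rightarrow> bool" where
  "weak_derivs k f D \<longleftrightarrow> D 0 = f \<and> (\<forall>j\<le>k. D j \<in> borel_measurable lebesgue) \<and>
     (\<forall>j<k. weak_deriv (D j) (D (Suc j)))"

definition Lp_pow :: "real \<Rightarrow> (real \<Rightarrow> complex) \<Rightarrow> ennreal" where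
  "Lp_pow p h = (\<integral>\<^sup>+ x\<in>{0..2*pi}. ennreal (cmod (h x) powr p) \<partial>lebesgue)"

definition Gag_pow :: "real \<Rightarrow> real \<Rightarrow> (real \<Rightarrow> complex) \<Rightarrow> ennreal" where
  "Gag_pow \<sigma> p h = (\<integral>\<^sup>+ x\<in>{0..2*pi}. (\<integral>\<^sup>+ y\<in>{0..2*pi}.
      ennreal (cmod (h x - h y) powr p / cmod (cis x - cis y) powr (1 + \<sigma> * p)) \<partial>lebesgue) \<partial>lebesgue)"

definition Wsp_pow :: "real \<Rightarrow> real \<Rightarrow> (nat \<Rightarrow> real \<Rightarrow> complex) \<Rightarrow> ennreal" where
  "Wsp_pow s p D = (\<Sum>j\<le>nat \<lfloor>s\<rfloor>. Lp_pow p (D j)) +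
      (if s - of_int \<lfloor>s\<rfloor> > 0 then Gag_pow (s - of_int \<lfloor>s\<rfloor>) p (D (nat \<lfloor>s\<rfloor>)) else 0)"

definition Wsp :: "real \<Rightarrow> real \<Rightarrow> (real \<Rightarrow> complex) set" where
  "Wsp s p = {f. periodic2pi f \<and> (\<exists>D. weak_derivs (nat \<lfloor>s\<rfloor>) f D \<and> Wsp_pow s p D < \<infinity>)}"

definition Wsp_norm :: "real \<Rightarrow> real \<Rightarrow> (real \<Rightarrow> complex) \<Rightarrow> real" where
  "Wsp_norm s p h = enn2real (Wsp_pow s p
      (SOME D. weak_derivs (nat \<lfloor>s\<rfloor>) h D \<and> Wsp_pow s p D < \<infinity>)) powr (1/p)"

definition S1_mean :: "(real \<Rightarrow> complex) \<Rightarrow> complex" where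
  "S1_mean h = (LINT x:{0..2*pi}|lebesgue. h x) / complex_of_real (2*pi)"

definition Wsp_seminorm :: "real \<Rightarrow> real \<Rightarrow> (real \<Rightarrow> complex) \<Rightarrow> real" where
  "Wsp_seminorm s p h = Wsp_norm s p (\<lambda>x. h x - S1_mean h)"

definition WspS1 :: "real \<Rightarrow> real \<Rightarrow> (real \<Rightarrow> complex) set" where
  "WspS1 s p = {f \<in> Wsp s p. AE x in lebesgue. cmod (f x) = 1}"

definition top_deg :: "(real \<Rightarrow> complex) \<Rightarrow> complex" where
  "top_deg g = winding_number (\<lambda>t. g (2*pi*t)) 0"

text \<open>Brezis--Nirenberg degree class E_d: the degree is the unique W^{s,p}-continuous
  extension of the topological degree from smooth maps (which are dense), so
  deg f = d iff f is the W^{s,p}-limit of smooth S^1-valued maps of degree d.\<close>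
definition Edeg :: "real \<Rightarrow> real \<Rightarrow> int \<Rightarrow> (real \<Rightarrow> complex) set" where
  "Edeg s p d = {f \<in> WspS1 s p. \<exists>g :: nat \<Rightarrow> real \<Rightarrow> complex.
      (\<forall>n. smooth_periodic (g n) \<and> (\<forall>x. cmod (g n x) = 1) \<and> top_deg (g n) = of_int d) \<and>
      (\<lambda>n. Wsp_norm s p (\<lambda>x. g n x - f x)) \<longlonglongrightarrow> 0}"

definition dist_E :: "real \<Rightarrow> real \<Rightarrow> int \<Rightarrow> int \<Rightarrow> real" where
  "dist_E s p d1 d2 = (INF f\<in>Edeg s p d1. INF g\<in>Edeg s p d2. Wsp_seminorm s p (\<lambda>x. f x - g x))"

end

theory Submission
  imports Defs
begin

text \<open>If f and g have degrees \<open>d1\<close> and \<open>d2\<close>, then \<open>|f - g| = 2 |sin (\<theta> / 2)|\<close> for a phase \<open>\<theta>\<close> of \<open>f / g\<close>, which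
  increases by \<open>2 pi (d1 - d2)\<close>. Hence \<open>|f - g|\<close> alternates between 0 and 2, and on an interval J with more
  than \<open>2 s\<close> alternations no polynomial of degree \<open>\<lfloor>s\<rfloor>\<close> is close to \<open>f - g\<close>. Taylor's formula (or Morrey's
  estimate if s < 1) bounds the top order energy on J from below by a multiple of \<open>|J|^(1 - s p)\<close>; summing over
  about \<open>|d1 - d2|\<close> such intervals gives the lower bound, first for smooth maps and then by approximation.

  For the upper bounds start from smooth maps \<open>f0\<close>, \<open>g0\<close> of degrees 1 and 0 which coincide on a half circle. With
  \<open>n = |d1 - d2|\<close>, the maps \<open>f0 (n x)\<close> and \<open>g0 (n x)\<close> can be multiplied by the same map of arbitrary degree, equal to 1
  wherever they differ, so \<open>f - g = (f0 - g0) (n x)\<close>. If \<open>s p = 1\<close>, then \<open>f0\<close> and \<open>g0\<close> travel along opposite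
  half circles with logarithmic speed, so that \<open>f0 - g0\<close> is symmetric about the midpoint and small.\<close>

subsection \<open>Smooth functions on the line\<close>

text \<open>Two points shape the lower bound. With N = |d1 - d2| there are about 2 N alternations,
  while one interval consumes 2 k + 1 of them, k the integer part of s; if k >= 1 and N is small,
  not one interval fits. So f and g are first composed with x -> (k + 1) x, at the price of a factor
  depending on s and p only, and N intervals are found for every N >= 1. Their lengths are not
  controlled, but t^(1 - s p) is convex and decreasing in t, so equal lengths are the worst case.
  For fractional s the upper bound cannot rest on a change of variables in the double integral: for
  h (n x) that yields n^(1 + s p), a factor n too much. Sup and Lipschitz bounds are interpolated
  instead. When s p = 1, n stays fixed while the energy of the initial pair tends to 0, so crude
  scaling is harmless; smallness comes from a factor \<open>\<kappa> powr (p - 1)\<close>, which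
  explains the condition 1 < p. Weak derivatives are determined up to null sets only and enter the
  norm through a choice operator; their uniqueness makes the norm computable from any family of
  them.\<close>

primrec Ck :: "nat \<Rightarrow> (real \<Rightarrow> 'a::real_normed_vector) \<Rightarrow> bool" where
  "Ck 0 f \<longleftrightarrow> True"
| "Ck (Suc n) f \<longleftrightarrow> (\<exists>f'. (\<forall>t. (f has_vector_derivative f' t) (at t)) \<and> Ck n f')"

text \<open>\<open>Ck n\<close> asks for n successive derivatives, without continuity of the last
  one. The intersection over all n is still ordinary smoothness, because every derivative is itself
  differentiable.\<close>

definition smooth :: "(real \<Rightarrow> 'a::real_normed_vector) \<Rightarrow> bool" where
  "smooth f \<longleftrightarrow> (\<forall>n. Ck n f)"

lemma Ck_SucD: "Ck (Suc n) f \<Longrightarrow> Ck n f"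
proof (induction n arbitrary: f)
  case (Suc n)
  then obtain f' where "\<forall>t. (f has_vector_derivative f' t) (at t)" "Ck (Suc n) f'"
    by (auto simp del: Ck.simps(2) simp: Ck.simps(2)[of "Suc n"])
  then show ?case using Suc.IH by auto
qed simp

lemma Ck_SucI: "(\<And>t. (f has_vector_derivative f' t) (at t)) \<Longrightarrow> Ck n f' \<Longrightarrow> Ck (Suc n) f"
  by auto

lemma smooth_derivative:
  assumes "smooth f" "\<And>t. (f has_vector_derivative f' t) (at t)"
  shows "smooth f'"
proof -
  have "Ck n f'" for n
  proof -
    obtain f'' where f'': "\<forall>t. (f has_vector_derivative f'' t) (at t)" "Ck n f''"
      using assms(1) by (metis Ck.simps(2) smooth_def)
    have "f'' = f'" using f''(1) assms(2) vector_derivative_unique_at by blast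
    then show ?thesis using f'' by simp
  qed
  then show ?thesis by (simp add: smooth_def)
qed

lemma smooth_has_derivative:
  assumes "smooth f"
  obtains f' where "\<And>t. (f has_vector_derivative f' t) (at t)" "smooth f'"
proof -
  have "Ck (Suc 0) f" using assms by (simp only: smooth_def)
  then obtain f' where "\<And>t. (f has_vector_derivative f' t) (at t)" by auto
  then show ?thesis using smooth_derivative[OF assms] that by blast
qed

lemma smooth_derivs:
  assumes "smooth f"
  obtains D where "D 0 = f" "\<And>k t. (D k has_vector_derivative D (Suc k) t) (at t)" "\<And>k. smooth (D k)"
proof -
  define D where "D = (\<lambda>k. ((\<lambda>g t. vector_derivative g (at t)) ^^ k) f)"
  have 1: "smooth (D k)" for k
  proof (induction k)
    case (Suc k)
    then obtain g' where g': "\<And>t. (D k has_vector_derivative g' t) (at t)" "smooth g'"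
      using smooth_has_derivative by blast
    then have "D (Suc k) = g'" by (auto simp: D_def vector_derivative_at fun_eq_iff)
    then show ?case using g' by simp
  qed (simp add: D_def assms)
  have 2: "(D k has_vector_derivative D (Suc k) t) (at t)" for k t
  proof -
    obtain g' where g': "\<And>t. (D k has_vector_derivative g' t) (at t)" "smooth g'"
      using smooth_has_derivative 1 by blast
    then have "D (Suc k) = g'" by (auto simp: D_def vector_derivative_at fun_eq_iff)
    then show ?thesis using g' by simp
  qed
  show ?thesis using that[of D] 1 2 by (simp add: D_def)
qed

lemma derivs_imp_smooth:
  assumes "\<And>k t. (D k has_vector_derivative D (Suc k) t) (at t)"
  shows "smooth (D k)"
proof -
  have "Ck n (D k)" for n
    by (induction n arbitrary: k) (use assms in auto)
  then show ?thesis by (simp add: smooth_def)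
qed

text \<open>Trades the explicit sequence of derivatives in \<open>smooth_periodic\<close> for a
  predicate that is proved by closure rules.\<close>

lemma smooth_periodic_iff: "smooth_periodic g \<longleftrightarrow> periodic2pi g \<and> smooth g"
  unfolding smooth_periodic_def using smooth_derivs derivs_imp_smooth by metis

lemma smooth_continuous_on: "smooth f \<Longrightarrow> continuous_on S f"
  by (meson continuous_at_imp_continuous_on has_vector_derivative_continuous smooth_has_derivative)

section \<open>Closure properties of n-fold differentiability\<close>

lemma Ck_const: "Ck n (\<lambda>x. c)"
proof (induction n arbitrary: c)
  case (Suc n) then show ?case by (intro Ck_SucI[where f'="\<lambda>x. 0"]) auto
qed simp

lemma Ck_id: "Ck n (\<lambda>x. x)"
proof (cases n)
  case (Suc m)
  have "((\<lambda>x::real. x) has_vector_derivative 1) (at t)" for t by (auto intro!: derivative_eq_intros)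
  then show ?thesis unfolding Suc by (intro Ck_SucI[where f'="\<lambda>x. 1"] Ck_const) auto
qed simp

lemma Ck_linear:
  assumes L: "bounded_linear L" shows "Ck n f \<Longrightarrow> Ck n (\<lambda>x. L (f x))"
proof (induction n arbitrary: f)
  case (Suc n)
  then obtain f' where f': "\<And>t. (f has_vector_derivative f' t) (at t)" "Ck n f'" by auto
  then show ?case
    using Suc.IH bounded_linear.has_vector_derivative[OF L]
    by (intro Ck_SucI[where f'="\<lambda>x. L (f' x)"]) auto
qed simp

lemma Ck_add: "Ck n f \<Longrightarrow> Ck n g \<Longrightarrow> Ck n (\<lambda>x. f x + g x)"
proof (induction n arbitrary: f g)
  case (Suc n)
  then obtain f' g' where "\<And>t. (f has_vector_derivative f' t) (at t)" "Ck n f'"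
     "\<And>t. (g has_vector_derivative g' t) (at t)" "Ck n g'" by auto
  then show ?case
    using Suc.IH by (intro Ck_SucI[where f'="\<lambda>x. f' x + g' x"]) (auto intro!: has_vector_derivative_add)
qed simp

lemma Ck_bilinear:
  assumes B: "bounded_bilinear B" shows "Ck n f \<Longrightarrow> Ck n g \<Longrightarrow> Ck n (\<lambda>x. B (f x) (g x))"
proof (induction n arbitrary: f g)
  case (Suc n)
  have f: "Ck n f" and g: "Ck n g" using Suc.prems Ck_SucD by blast+
  obtain f' g' where *: "\<And>t. (f has_vector_derivative f' t) (at t)" "Ck n f'"
     "\<And>t. (g has_vector_derivative g' t) (at t)" "Ck n g'" using Suc.prems by auto
  show ?case
    using * f g Suc.IH bounded_bilinear.has_vector_derivative[OF B]
    by (intro Ck_SucI[where f'="\<lambda>x. B (f x) (g' x) + B (f' x) (g x)"] Ck_add) auto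
qed simp

lemma Ck_affine: "Ck n f \<Longrightarrow> Ck n (\<lambda>x. f (a * x + b))"
proof (induction n arbitrary: f)
  case (Suc n)
  then obtain f' where f': "\<And>t. (f has_vector_derivative f' t) (at t)" "Ck n f'" by auto
  have "((\<lambda>x. f (a * x + b)) has_vector_derivative a *\<^sub>R f' (a * t + b)) (at t)" for t
  proof -
    have "((\<lambda>x. a * x + b) has_vector_derivative a) (at t)"
      by (auto intro!: derivative_eq_intros simp: has_real_derivative_iff_has_vector_derivative[symmetric])
    from vector_diff_chain_at[OF this f'(1)] show ?thesis by (simp add: o_def)
  qed
  then show ?case
    using Suc.IH f' by (intro Ck_SucI[where f'="\<lambda>x. a *\<^sub>R f' (a * x + b)"]
        Ck_linear[OF bounded_linear_scaleR_right]) auto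
qed simp

lemma cis_has_vector_derivative:
  assumes "(\<phi> has_vector_derivative \<phi>') (at t)"
  shows "((\<lambda>x. cis (\<phi> x)) has_vector_derivative \<phi>' *\<^sub>R (\<i> * cis (\<phi> t))) (at t)"
proof -
  have "(cis has_vector_derivative \<i> * cis (\<phi> t)) (at (\<phi> t))"
    unfolding has_vector_derivative_def
    by (rule has_derivative_eq_rhs[OF has_derivative_cis[OF has_derivative_ident]])
      (auto simp: scaleR_conv_of_real mult_ac)
  from vector_diff_chain_at[OF assms this] show ?thesis by (simp add: o_def)
qed

lemma Ck_cis: "Ck n \<phi> \<Longrightarrow> Ck n (\<lambda>x. cis (\<phi> x))"
proof (induction n)
  case (Suc n)
  have IH: "Ck n (\<lambda>x. cis (\<phi> x))" using Suc Ck_SucD by blast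
  obtain \<phi>' where *: "\<And>t. (\<phi> has_vector_derivative \<phi>' t) (at t)" "Ck n \<phi>'" using Suc.prems by auto
  have "((\<lambda>x. cis (\<phi> x)) has_vector_derivative \<phi>' t *\<^sub>R (\<i> * cis (\<phi> t))) (at t)" for t
    by (rule cis_has_vector_derivative[OF *(1)])
  then show ?case
    by (intro Ck_SucI[where f'="\<lambda>x. \<phi>' x *\<^sub>R (\<i> * cis (\<phi> x))"] Ck_bilinear[OF bounded_bilinear_scaleR]
        Ck_linear[OF bounded_linear_mult_right] IH *)
qed simp

text \<open>Differentiation lowers the exponent, so the induction runs over all exponents at once.
  The exponent -1/2 later gives the logarithmic density of the critical case.\<close>

lemma Ck_powr:
  fixes g :: "real \<Rightarrow> real"
  assumes pos: "\<And>x. g x > 0" shows "Ck n g \<Longrightarrow> Ck n (\<lambda>x. g x powr a)"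
proof (induction n arbitrary: a)
  case (Suc n)
  have g: "Ck n g" using Suc.prems Ck_SucD by blast
  obtain g' where *: "\<And>t. (g has_vector_derivative g' t) (at t)" "Ck n g'" using Suc.prems by auto
  have "((\<lambda>x. g x powr a) has_vector_derivative a * (g t powr (a - 1) * g' t)) (at t)" for t
    using *(1)[of t] pos[of t] unfolding has_real_derivative_iff_has_vector_derivative[symmetric]
    by (auto intro!: derivative_eq_intros simp: powr_diff divide_simps)
  then show ?case using Suc.IH[OF g] *
    by (intro Ck_SucI[where f'="\<lambda>x. a * (g x powr (a - 1) * g' x)"] Ck_bilinear[OF bounded_bilinear_mult]
        Ck_linear[OF bounded_linear_mult_right]) auto
qed simp

section \<open>The function exp (-1/t), flat at the origin\<close>

definition flat_exp :: "nat \<Rightarrow> real \<Rightarrow> real" where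
  "flat_exp n t = (if t \<le> 0 then 0 else exp (- 1 / t) / t ^ n)"

lemma flat_exp_tendsto_0: "(flat_exp n \<longlongrightarrow> 0) (at 0)"
proof -
  have "((\<lambda>t. inverse t ^ n / exp (inverse t)) \<longlongrightarrow> (0::real)) (at_right 0)"
    by (rule filterlim_compose[OF tendsto_power_div_exp_0 filterlim_inverse_at_top_right])
  then have R: "(flat_exp n \<longlongrightarrow> 0) (at_right 0)"
    by (rule tendsto_cong[THEN iffD1, rotated])
      (auto simp: eventually_at_filter flat_exp_def exp_minus field_simps)
  have "(flat_exp n \<longlongrightarrow> 0) (at_left 0)"
    by (rule tendsto_cong[THEN iffD1, rotated, OF tendsto_const])
      (auto simp: eventually_at_filter flat_exp_def)
  with R show ?thesis using filterlim_split_at by blast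
qed

text \<open>The powers of t in the denominator close the family under differentiation; smoothness of
  exp (-1/t), extended by 0, is then one induction with n arbitrary.\<close>

lemma flat_exp_deriv:
  "(flat_exp n has_vector_derivative (flat_exp (n+2) t - real n * flat_exp (n+1) t)) (at t)"
proof -
  consider "t < 0" | "t = 0" | "t > 0" by linarith
  then have "(flat_exp n has_real_derivative (flat_exp (n+2) t - real n * flat_exp (n+1) t)) (at t)"
  proof cases
    case 1
    have "((\<lambda>x. 0) has_real_derivative 0) (at t)" by simp
    then show ?thesis
      by (rule DERIV_cong_ev[THEN iffD1, rotated -1])
        (use 1 in \<open>auto simp: flat_exp_def eventually_nhds intro!: exI[of _ "{..<0}"]\<close>)
  next
    case 2
    \<comment> \<open>The difference quotient of \<open>flat_exp n\<close> at 0 is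
      \<open>flat_exp (Suc n)\<close>, whose limit is known.\<close>
    have "((\<lambda>h. (flat_exp n (0 + h) - flat_exp n 0) / h) \<longlongrightarrow> 0) (at 0)"
      by (rule tendsto_cong[THEN iffD1, rotated, OF flat_exp_tendsto_0[of "Suc n"]])
        (auto simp: flat_exp_def eventually_at_filter)
    then have "(flat_exp n has_real_derivative 0) (at 0)" by (simp add: DERIV_def)
    then show ?thesis using 2 by (simp add: flat_exp_def)
  next
    case 3
    have "((\<lambda>x. exp (- 1 / x) / x ^ n) has_real_derivative
        (flat_exp (n+2) t - real n * flat_exp (n+1) t)) (at t)"
    proof -
      have 1: "((\<lambda>x. exp (- 1 / x)) has_real_derivative exp (- 1 / t) / (t * t)) (at t)"
        using 3 by (auto intro!: derivative_eq_intros simp: field_simps)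
      have 2: "((\<lambda>x. x ^ n) has_real_derivative real n * t ^ n / t) (at t)"
        using 3 DERIV_pow[of n t] by (cases n) auto
      show ?thesis
        by (rule DERIV_cong[OF DERIV_divide[OF 1 2]]) (use 3 in \<open>auto simp: flat_exp_def field_simps\<close>)
    qed
    then show ?thesis
      by (rule DERIV_cong_ev[THEN iffD1, rotated -1])
        (use 3 in \<open>auto simp: flat_exp_def eventually_nhds intro!: exI[of _ "{0<..}"]\<close>)
  qed
  then show ?thesis by (simp add: has_real_derivative_iff_has_vector_derivative)
qed

lemma Ck_flat_exp:
  shows "Ck n g \<Longrightarrow> Ck n (\<lambda>x. flat_exp m (g x))"
proof (induction n arbitrary: m)
  case (Suc n)
  have g: "Ck n g" using Suc.prems Ck_SucD by blast
  obtain g' where *: "\<And>t. (g has_vector_derivative g' t) (at t)" "Ck n g'" using Suc.prems by auto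
  have "((\<lambda>x. flat_exp m (g x)) has_vector_derivative
      g' t * (flat_exp (m+2) (g t) + (- real m) * flat_exp (m+1) (g t))) (at t)" for t
    using vector_diff_chain_at[OF *(1)[of t] flat_exp_deriv[of m "g t"]] by (simp add: o_def)
  then show ?case using Suc.IH[OF g] *
    by (intro Ck_SucI[where f'="\<lambda>x. g' x * (flat_exp (m+2) (g x) + (- real m) * flat_exp (m+1) (g x))"]
        Ck_bilinear[OF bounded_bilinear_mult] Ck_add Ck_linear[OF bounded_linear_mult_right]) auto
qed simp

lemma flat_exp_nonneg: "0 \<le> flat_exp n t" by (simp add: flat_exp_def)
lemma flat_exp_0_le_1: "flat_exp 0 t \<le> 1" by (simp add: flat_exp_def)
lemma flat_exp_pos_iff: "0 < flat_exp n t \<longleftrightarrow> 0 < t" by (auto simp: flat_exp_def)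
lemma flat_exp_eq_0: "t \<le> 0 \<Longrightarrow> flat_exp n t = 0" by (auto simp: flat_exp_def)

lemma smooth_const: "smooth (\<lambda>x. c)" by (simp add: smooth_def Ck_const)
lemma smooth_id: "smooth (\<lambda>x. x)" by (simp add: smooth_def Ck_id)
lemma smooth_linear: "bounded_linear L \<Longrightarrow> smooth f \<Longrightarrow> smooth (\<lambda>x. L (f x))"
  by (simp add: smooth_def Ck_linear)
lemma smooth_add: "smooth f \<Longrightarrow> smooth g \<Longrightarrow> smooth (\<lambda>x. f x + g x)"
  by (simp add: smooth_def Ck_add)
lemma smooth_bilinear: "bounded_bilinear B \<Longrightarrow> smooth f \<Longrightarrow> smooth g \<Longrightarrow> smooth (\<lambda>x. B (f x) (g x))"
  by (simp add: smooth_def Ck_bilinear)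
lemma smooth_mult: "smooth f \<Longrightarrow> smooth g \<Longrightarrow> smooth (\<lambda>x. f x * (g x :: 'a::real_normed_algebra))"
  by (rule smooth_bilinear[OF bounded_bilinear_mult])
lemma smooth_cmult: "smooth f \<Longrightarrow> smooth (\<lambda>x. c * (f x :: 'a::real_normed_algebra))"
  by (rule smooth_linear[OF bounded_linear_mult_right])
lemma smooth_minus: "smooth f \<Longrightarrow> smooth (\<lambda>x. - f x)"
  by (rule smooth_linear[OF bounded_linear_minus[OF bounded_linear_ident]])
lemma smooth_diff: "smooth f \<Longrightarrow> smooth g \<Longrightarrow> smooth (\<lambda>x. f x - g x)"
  using smooth_add[OF _ smooth_minus] by fastforce
lemma smooth_affine: "smooth f \<Longrightarrow> smooth (\<lambda>x. f (a * x + b))"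
  by (simp add: smooth_def Ck_affine)
lemma smooth_scale: "smooth f \<Longrightarrow> smooth (\<lambda>x. f (a * x))"
  using smooth_affine[where b=0] by simp
lemma smooth_cis: "smooth \<phi> \<Longrightarrow> smooth (\<lambda>x. cis (\<phi> x))"
  by (simp add: smooth_def Ck_cis)
lemma smooth_powr: "(\<And>x. g x > 0) \<Longrightarrow> smooth g \<Longrightarrow> smooth (\<lambda>x. g x powr a :: real)"
  by (simp add: smooth_def Ck_powr)
lemma smooth_flat_exp: "smooth g \<Longrightarrow> smooth (\<lambda>x. flat_exp m (g x))"
  by (simp add: smooth_def Ck_flat_exp)
lemma smooth_of_real: "smooth g \<Longrightarrow> smooth (\<lambda>x. of_real (g x) :: 'a::real_normed_algebra_1)"
  by (rule smooth_linear[OF bounded_linear_of_real])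
lemma smooth_cos: "smooth \<phi> \<Longrightarrow> smooth (\<lambda>x. cos (\<phi> x) :: real)"
  using smooth_linear[OF bounded_linear_Re smooth_cis] by simp

lemmas smooth_intros = smooth_const smooth_id smooth_add smooth_mult smooth_cmult smooth_minus smooth_diff
  smooth_cis smooth_flat_exp smooth_of_real smooth_cos

lemma smooth_antiderivative:
  fixes \<rho> :: "real \<Rightarrow> real"
  assumes "smooth \<rho>"
  obtains F where "smooth F" "\<And>t. (F has_real_derivative \<rho> t) (at t)"
proof -
  obtain F where F: "\<And>x. - \<infinity> < ereal x \<Longrightarrow> ereal x < \<infinity> \<Longrightarrow> (F has_vector_derivative \<rho> x) (at x)"
    using einterval_antiderivative[of "-\<infinity>" \<infinity> \<rho>] smooth_continuous_on[OF assms, of UNIV]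
    by (auto simp: continuous_on_eq_continuous_at)
  then have F': "\<And>t. (F has_vector_derivative \<rho> t) (at t)" by auto
  have "Ck n F" for n
    using assms F' by (cases n) (auto simp: smooth_def)
  then show ?thesis using that F' by (auto simp: smooth_def has_real_derivative_iff_has_vector_derivative)
qed

subsection \<open>Degree and phases\<close>

text \<open>Along t -> cis (\<phi> (2 pi t)) the form dz / z pulls back to i times the differential
  of the phase, so the winding number is the phase increase divided by 2 pi. The path may be open,
  since for every valid path avoiding 0 the winding number is this normalised integral.\<close>

lemma top_deg_cis:
  assumes "smooth \<phi>"
  shows "top_deg (\<lambda>x. cis (\<phi> x)) = of_real ((\<phi> (2*pi) - \<phi> 0) / (2*pi))"
proof -
  obtain \<phi>' where \<phi>': "\<And>t. (\<phi> has_vector_derivative \<phi>' t) (at t)" "smooth \<phi>'"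
    using smooth_has_derivative[OF assms] by blast
  define \<gamma> where "\<gamma> = (\<lambda>t. cis (\<phi> (2*pi*t)))"
  define \<gamma>' where "\<gamma>' = (\<lambda>t. (2*pi*\<phi>' (2*pi*t)) *\<^sub>R (\<i> * \<gamma> t))"
  have d\<phi>: "((\<lambda>t. \<phi> (2*pi*t)) has_vector_derivative 2*pi*\<phi>' (2*pi*t)) (at t)" for t
  proof -
    have "((\<lambda>x. 2*pi * x) has_vector_derivative 2*pi) (at t)"
      by (auto intro!: derivative_eq_intros simp: has_real_derivative_iff_has_vector_derivative[symmetric])
    from vector_diff_chain_at[OF this \<phi>'(1)] show ?thesis by (simp add: o_def)
  qed
  have d\<gamma>: "(\<gamma> has_vector_derivative \<gamma>' t) (at t)" for t
    using cis_has_vector_derivative[OF d\<phi>] by (simp add: \<gamma>'_def \<gamma>_def)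
  have c\<gamma>': "continuous_on {0..1} \<gamma>'"
    unfolding \<gamma>'_def \<gamma>_def
    by (intro smooth_continuous_on smooth_bilinear[OF bounded_bilinear_scaleR] smooth_intros
         smooth_scale[OF \<phi>'(2)] smooth_scale[OF assms])
  have vp: "valid_path \<gamma>"
    unfolding valid_path_def
    by (rule C1_differentiable_imp_piecewise)
      (use d\<gamma> c\<gamma>' in \<open>auto simp: C1_differentiable_on_def\<close>)
  have vd: "vector_derivative \<gamma> (at t within {0..1}) = \<gamma>' t" if "0 \<le> t" "t \<le> 1" for t
    using that by (intro vector_derivative_at_within_ivl[OF d\<gamma>]) auto
  have \<gamma>nz: "\<gamma> t \<noteq> 0" for t by (simp add: \<gamma>_def)
  have nz: "0 \<notin> path_image \<gamma>" by (auto simp: path_image_def \<gamma>_def)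
  have "((\<lambda>t. \<i> * of_real (2*pi*\<phi>' (2*pi*t))) has_integral \<i> * of_real (\<phi> (2*pi*1)) - \<i> * of_real (\<phi> (2*pi*0))) {0..1}"
    by (intro fundamental_theorem_of_calculus has_vector_derivative_mult_right has_vector_derivative_of_real
        d\<phi>[unfolded has_real_derivative_iff_has_vector_derivative[symmetric],
          THEN has_field_derivative_at_within]) auto
  then have "((\<lambda>t. 1 / (\<gamma> t - 0) * vector_derivative \<gamma> (at t within {0..1})) has_integral \<i> * of_real (\<phi> (2*pi) - \<phi> 0)) {0..1}"
    by (subst has_integral_cong[where g="\<lambda>t. \<i> * of_real (2*pi*\<phi>' (2*pi*t))"])
      (auto simp: right_diff_distrib vd \<gamma>'_def scaleR_conv_of_real \<gamma>nz)
  then have "((\<lambda>w. 1 / (w - 0)) has_contour_integral \<i> * of_real (\<phi> (2*pi) - \<phi> 0)) \<gamma>"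
    by (simp add: has_contour_integral_def)
  then have "winding_number \<gamma> 0 = 1 / (2*pi*\<i>) * (\<i> * of_real (\<phi> (2*pi) - \<phi> 0))"
    using winding_number_valid_path[OF vp nz] contour_integral_unique by metis
  then show ?thesis by (simp add: top_deg_def \<gamma>_def)
qed

text \<open>Because |f| = 1, cnj f * f' is purely imaginary; an antiderivative F of its imaginary
  part makes f * cis (- F) constant, and the argument of that constant is the initial phase.\<close>

lemma smooth_unit_lift:
  assumes f: "smooth f" and u: "\<And>x. cmod (f x) = 1"
  obtains \<phi> where "smooth \<phi>" "\<And>x. f x = cis (\<phi> x)"
proof -
  obtain f' where f': "\<And>t. (f has_vector_derivative f' t) (at t)" "smooth f'"
    using smooth_has_derivative[OF f] by blast
  define \<rho> where "\<rho> = (\<lambda>t. Im (cnj (f t) * f' t))"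
  have "smooth \<rho>" unfolding \<rho>_def
    by (intro smooth_linear[OF bounded_linear_Im] smooth_mult smooth_linear[OF bounded_linear_cnj] f f')
  then obtain F where F: "smooth F" "\<And>t. (F has_real_derivative \<rho> t) (at t)"
    using smooth_antiderivative by blast
  have ff: "f t * cnj (f t) = 1" for t
    using u[of t] by (simp add: complex_norm_square[symmetric])
  have re: "Re (cnj (f t) * f' t) = 0" for t
  proof -
    have "((\<lambda>t. f t * cnj (f t)) has_vector_derivative (f t * cnj (f' t) + f' t * cnj (f t))) (at t)"
      by (intro has_vector_derivative_mult f' bounded_linear.has_vector_derivative[OF bounded_linear_cnj])
    moreover have "((\<lambda>t. f t * cnj (f t)) has_vector_derivative 0) (at t)"
      by (simp add: ff)
    ultimately have "f t * cnj (f' t) + f' t * cnj (f t) = 0"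
      using vector_derivative_unique_at by blast
    then have "Re (f t * cnj (f' t) + f' t * cnj (f t)) = 0" by simp
    then show ?thesis by simp
  qed
  have f'eq: "f' t = \<i> * of_real (\<rho> t) * f t" for t
  proof -
    have "cnj (f t) * f' t = \<i> * of_real (\<rho> t)" by (simp add: complex_eq_iff \<rho>_def re[simplified])
    moreover have "f' t = f t * cnj (f t) * f' t" by (simp add: ff)
    ultimately show ?thesis by (simp add: mult_ac)
  qed
  define e where "e = (\<lambda>t. f t * cis (- F t))"
  have de: "(e has_vector_derivative 0) (at t)" for t
  proof -
    have "((\<lambda>t. cis (- F t)) has_vector_derivative (- \<rho> t) *\<^sub>R (\<i> * cis (- F t))) (at t)"
      using F(2) by (intro cis_has_vector_derivative)
        (auto intro!: derivative_eq_intros simp: has_real_derivative_iff_has_vector_derivative[symmetric])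
    from has_vector_derivative_mult[OF f'(1) this] show ?thesis
      unfolding e_def by (simp add: f'eq scaleR_conv_of_real algebra_simps)
  qed
  obtain c where c: "\<And>t. e t = c"
    using has_vector_derivative_zero_constant[of UNIV e] de by auto
  have "cmod (e 0) = 1" by (simp add: e_def norm_mult u)
  then have "cmod c = 1" by (simp add: c)
  define a where "a = Arg c"
  have a: "c = cis a" using \<open>cmod c = 1\<close> cis_Arg[of c] by (cases "c = 0") (simp_all add: sgn_eq a_def)
  have "f t = cis (a + F t)" for t
  proof -
    have "f t = e t * cis (F t)" by (simp add: e_def mult.assoc cis_mult)
    then show ?thesis by (simp add: c a cis_mult)
  qed
  moreover have "smooth (\<lambda>t. a + F t)" by (intro smooth_intros F)
  ultimately show ?thesis using that by blast
qed

text \<open>The source of all degree one maps below: cis P winds once, at a speed proportional to a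
  prescribed density. By periodicity an antiderivative F of the density gains the same amount I in
  every period, and P is F rescaled by 2 pi / I.\<close>

lemma phase_exists:
  fixes \<rho> :: "real \<Rightarrow> real"
  assumes \<rho>: "smooth \<rho>" and per: "\<And>x. \<rho> (x + 2*pi) = \<rho> x" and nn: "\<And>x. 0 \<le> \<rho> x" and pos: "0 < \<rho> x0"
  obtains P c where "smooth P" "c > 0" "\<And>t. (P has_real_derivative c * \<rho> t) (at t)"
    "\<And>x. P (x + 2*pi) = P x + 2*pi" "P a = 0"
proof -
  obtain F where F: "smooth F" "\<And>t. (F has_real_derivative \<rho> t) (at t)"
    using smooth_antiderivative[OF \<rho>] by blast
  have "((\<lambda>t. F (t + 2*pi) - F t) has_real_derivative 0) (at t)" for t
    using DERIV_diff[OF DERIV_shift[THEN iffD1, OF F(2)[of "t + 2*pi"]] F(2)[of t]] by (simp add: per)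
  then obtain I where I: "\<And>t. F (t + 2*pi) - F t = I"
    using DERIV_isconst_all[of "\<lambda>t. F (t + 2*pi) - F t"] by blast
  have mono: "x \<le> y \<Longrightarrow> F x \<le> F y" for x y
    using F(2) nn by (intro DERIV_nonneg_imp_nondecreasing[of x y F]) auto
  have "I > 0"
  proof (rule ccontr)
    assume "\<not> I > 0"
    then have "F (x0 + 2*pi) - F x0 \<le> 0" "F (x0 - 2*pi + 2*pi) - F (x0 - 2*pi) \<le> 0" using I[of x0] I[of "x0 - 2*pi"] by auto
    then have "F (x0 + 2*pi) \<le> F x0" "F x0 \<le> F (x0 - 2*pi)" by simp_all
    \<comment> \<open>If I were not positive, the nondecreasing F would gain nothing over the
      periods on either side of x0, hence be constant there, against \<rho> x0 > 0.\<close>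
    then have c: "F x = F x0" if "\<bar>x - x0\<bar> < 2*pi" for x
      using mono[of x "x0+2*pi"] mono[of x0 x] mono[of x x0] mono[of "x0-2*pi" x] that by (cases "x \<ge> x0") linarith+
    then have ev: "\<forall>\<^sub>F x in nhds x0. F x0 = F x"
      unfolding eventually_nhds_metric dist_real_def by (metis pi_gt_zero zero_less_mult_iff zero_less_numeral)
    have "(F has_real_derivative 0) (at x0)"
      using DERIV_cong_ev[OF refl ev refl, of 0] by simp
    then show False using DERIV_unique[OF F(2)[of x0]] pos by force
  qed
  define P where "P = (\<lambda>x. 2*pi/I * (F x - F a))"
  show ?thesis
  proof (rule that[of P "2*pi/I"])
    show "smooth P" unfolding P_def by (intro smooth_intros F)
    show "2*pi/I > 0" using \<open>I > 0\<close> by simp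
    show "(P has_real_derivative 2*pi/I * \<rho> t) (at t)" for t
      unfolding P_def using F(2)[of t] \<open>I > 0\<close> by (auto intro!: derivative_eq_intros)
    show "P (x + 2*pi) = P x + 2*pi" for x
      using I[of x] \<open>I > 0\<close> by (simp add: P_def field_simps)
    show "P a = 0" by (simp add: P_def)
  qed
qed

subsection \<open>Weak derivatives\<close>

lemma periodic_derivative:
  assumes per: "periodic2pi f" and d: "\<And>t. (f has_vector_derivative f' t) (at t)"
  shows "periodic2pi f'"
  unfolding periodic2pi_def
proof
  fix x
  have "((\<lambda>t. f (t + 2*pi)) has_vector_derivative f' (x + 2*pi)) (at x)"
  proof -
    have "((\<lambda>t. t + 2*pi) has_vector_derivative 1) (at x)"
      by (auto intro!: derivative_eq_intros simp: has_real_derivative_iff_has_vector_derivative[symmetric])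
    from vector_diff_chain_at[OF this d] show ?thesis by (simp add: o_def)
  qed
  moreover have "(\<lambda>t. f (t + 2*pi)) = f" using per by (simp add: periodic2pi_def)
  ultimately have "(f has_vector_derivative f' (x + 2*pi)) (at x)" by simp
  then show "f' (x + 2*pi) = f' x" using vector_derivative_unique_at d[of x] by blast
qed

lemma set_integrable_continuous:
  fixes f :: "real \<Rightarrow> complex"
  shows "continuous_on UNIV f \<Longrightarrow> set_integrable lebesgue {a..b} f"
  by (meson absolutely_integrable_continuous_real continuous_on_subset subset_UNIV)

lemma set_integrable_mult_continuous:
  fixes f :: "real \<Rightarrow> complex"
  assumes f: "set_integrable lebesgue {a..b} f" and g: "continuous_on UNIV g"
  shows "set_integrable lebesgue {a..b} (\<lambda>x. f x * g x)"
proof -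
  have "continuous_on {a..b} g" using g continuous_on_subset by blast
  then have "bounded (g ` {a..b})" by (simp add: compact_continuous_image compact_imp_bounded)
  moreover have "g \<in> borel_measurable (lebesgue_on {a..b})"
    using \<open>continuous_on {a..b} g\<close> by (simp add: continuous_imp_measurable_on_sets_lebesgue)
  moreover have "bilinear ((*) :: complex \<Rightarrow> complex \<Rightarrow> complex)"
    unfolding bilinear_conv_bounded_bilinear by (rule bounded_bilinear_mult)
  ultimately have "(\<lambda>x. g x * f x) absolutely_integrable_on {a..b}"
    using f absolutely_integrable_bounded_measurable_product[of "(*)" g "{a..b}" f] by simp
  then show ?thesis by (simp add: mult.commute)
qed

text \<open>Integration by parts over a full period; the boundary terms cancel because both
  functions are periodic.\<close>

lemma weak_deriv_classical:
  assumes f: "smooth f" "periodic2pi f" and d: "\<And>t. (f has_vector_derivative f' t) (at t)"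
  shows "weak_deriv f f'"
proof -
  have f': "smooth f'" using smooth_derivative f d by blast
  have "(LINT x:{0..2*pi}|lebesgue. f x * vector_derivative \<phi> (at x))
          = - (LINT x:{0..2*pi}|lebesgue. f' x * \<phi> x)" if \<phi>: "smooth_periodic \<phi>" for \<phi>
  proof -
    have \<phi>s: "smooth \<phi>" "periodic2pi \<phi>" using \<phi> by (auto simp: smooth_periodic_iff)
    then obtain \<phi>' where \<phi>': "\<And>t. (\<phi> has_vector_derivative \<phi>' t) (at t)" "smooth \<phi>'"
      using smooth_has_derivative by blast
    have eq: "vector_derivative \<phi> (at x) = \<phi>' x" for x using \<phi>'(1) by (simp add: vector_derivative_at)
    have i1: "set_integrable lebesgue {0..2*pi} (\<lambda>x. f x * \<phi>' x)"
      and i2: "set_integrable lebesgue {0..2*pi} (\<lambda>x. f' x * \<phi> x)"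
      by (intro set_integrable_continuous smooth_continuous_on smooth_mult f f' \<phi>' \<phi>s)+
    have "((\<lambda>x. f x * \<phi>' x + f' x * \<phi> x) has_integral f (2*pi) * \<phi> (2*pi) - f 0 * \<phi> 0) {0..2*pi}"
      by (rule fundamental_theorem_of_calculus)
        (auto intro!: has_vector_derivative_at_within[OF has_vector_derivative_mult] d \<phi>')
    moreover have "f (2*pi) = f 0" "\<phi> (2*pi) = \<phi> 0"
      using f(2)[unfolded periodic2pi_def, rule_format, of 0] \<phi>s(2)[unfolded periodic2pi_def, rule_format, of 0] by simp_all
    ultimately have "integral {0..2*pi} (\<lambda>x. f x * \<phi>' x + f' x * \<phi> x) = 0"
      by (simp add: integral_unique)
    then have "integral {0..2*pi} (\<lambda>x. f x * \<phi>' x) = - integral {0..2*pi} (\<lambda>x. f' x * \<phi> x)"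
      using Henstock_Kurzweil_Integration.integral_add[OF set_lebesgue_integral_eq_integral(1)[OF i1] set_lebesgue_integral_eq_integral(1)[OF i2]]
      by (simp add: add_eq_0_iff2)
    then show ?thesis by (simp add: eq set_lebesgue_integral_eq_integral[OF i1] set_lebesgue_integral_eq_integral[OF i2])
  qed
  then show ?thesis unfolding weak_deriv_def
    by (auto intro!: set_integrable_continuous smooth_continuous_on f f')
qed

lemma smooth_measurable: "smooth f \<Longrightarrow> f \<in> borel_measurable borel" for f :: "real \<Rightarrow> complex"
  by (intro borel_measurable_continuous_onI smooth_continuous_on)

lemma smooth_measurable_lebesgue: "smooth f \<Longrightarrow> f \<in> borel_measurable lebesgue" for f :: "real \<Rightarrow> complex"
  using measurable_completion[of f lborel borel] smooth_measurable by simp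

lemma weak_derivs_classical:
  assumes "periodic2pi (D 0)" "\<And>k t. (D k has_vector_derivative D (Suc k) t) (at t)"
  shows "weak_derivs k (D 0) D"
proof -
  have s: "smooth (D j)" for j using derivs_imp_smooth[of D] assms by blast
  have p: "periodic2pi (D j)" for j
  proof (induction j)
    case (Suc j) then show ?case using periodic_derivative assms(2) by blast
  qed (rule assms(1))
  show ?thesis unfolding weak_derivs_def
    by (intro conjI allI impI refl weak_deriv_classical[OF s p assms(2)] smooth_measurable_lebesgue[OF s])
qed

text \<open>The test functions \<open>exp (-1 / (N (cos (x - c) - cos r)))\<close>, extended by 0, increase to the
  indicator of an arc, so the integral of u over every interval vanishes.\<close>
lemma AE_zero_of_test:
  fixes u :: "real \<Rightarrow> complex"
  assumes u: "set_integrable lebesgue {0..2*pi} u"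
    and test: "\<And>\<phi>. smooth_periodic \<phi> \<Longrightarrow> (LINT x:{0..2*pi}|lebesgue. u x * \<phi> x) = 0"
  shows "AE x in lebesgue. x \<in> {0..2*pi} \<longrightarrow> u x = 0"
proof -
  define U where "U = (\<lambda>x. indicator {0..2*pi} x *\<^sub>R u x)"
  have Ui: "integrable lebesgue U" using u by (simp add: set_integrable_def U_def)
  have zero: "(LINT x|lebesgue. indicator {a<..<b} x *\<^sub>R U x) = 0" if ab: "0 \<le> a" "a < b" "b \<le> 2*pi" for a b
  proof -
    define c r where "c = (a + b) / 2" and "r = (b - a) / 2"
    have r: "0 < r" "r \<le> c" "c + r \<le> 2*pi" "r \<le> pi" using ab by (auto simp: c_def r_def field_simps)
    define \<phi> where "\<phi> = (\<lambda>N x. flat_exp 0 (real N * (cos (x - c) - cos r)))"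
    have sp: "smooth_periodic (\<lambda>x. complex_of_real (\<phi> N x))" for N
    proof -
      have "cos (x + 2*pi - c) = cos (x - c)" for x
        using cos_periodic[of "x - c"] by (simp add: algebra_simps)
      then show ?thesis unfolding smooth_periodic_iff periodic2pi_def \<phi>_def
        by (auto intro!: smooth_intros)
    qed
    have lim: "(\<lambda>N. \<phi> N x) \<longlonglongrightarrow> indicator {a<..<b} x" if x: "x \<in> {0..2*pi}" for x
    proof (cases "x \<in> {a<..<b}")
      case True
      then have "\<bar>x - c\<bar> < r" by (auto simp: c_def r_def field_simps)
      then have "cos r < cos \<bar>x - c\<bar>" using r by (intro cos_monotone_0_pi) auto
      then have pos: "0 < cos (x - c) - cos r" by simp
      have "(\<lambda>N. exp (- ((1 / (cos (x - c) - cos r)) / real N))) \<longlonglongrightarrow> exp (- 0)"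
        by (intro tendsto_intros lim_const_over_n)
      then have "(\<lambda>N. exp (- ((1 / (cos (x - c) - cos r)) / real N))) \<longlonglongrightarrow> 1" by simp
      then have "(\<lambda>N. \<phi> N x) \<longlonglongrightarrow> 1"
        by (rule Lim_transform_eventually)
          (use pos in \<open>auto intro!: eventually_mono[OF eventually_gt_at_top[of 0]] simp: \<phi>_def flat_exp_def mult_le_0_iff\<close>)
      then show ?thesis using True by simp
    next
      case False
      then have rx: "r \<le> \<bar>x - c\<bar>" by (auto simp: c_def r_def field_simps abs_if)
      \<comment> \<open>The upper bound keeps x out of the translates of the arc by 2 pi, where cos
        (x - c) would exceed cos r again.\<close>
      have rx2: "\<bar>x - c\<bar> \<le> 2*pi - r" using x r by auto
      have "cos \<bar>x - c\<bar> \<le> cos r"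
      proof (cases "\<bar>x - c\<bar> \<le> pi")
        case True then show ?thesis using rx r by (intro cos_monotone_0_pi_le) auto
      next
        case False
        have "cos (2*pi - \<bar>x - c\<bar>) \<le> cos r" using False rx2 r by (intro cos_monotone_0_pi_le) auto
        then show ?thesis by (simp only: cos_2pi_minus)
      qed
      then have "\<phi> N x = 0" for N by (simp add: \<phi>_def flat_exp_def mult_le_0_iff)
      then show ?thesis using False by simp
    qed
    have "(\<lambda>N. LINT x|lebesgue. \<phi> N x *\<^sub>R U x) \<longlonglongrightarrow> (LINT x|lebesgue. indicator {a<..<b} x *\<^sub>R U x)"
    proof (rule integral_dominated_convergence[where w="\<lambda>x. norm (U x)"])
      have "{a<..<b} \<in> sets lebesgue" by simp
      then show "(\<lambda>x. indicator {a<..<b} x *\<^sub>R U x) \<in> borel_measurable lebesgue"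
        using Ui by (intro borel_measurable_scaleR borel_measurable_indicator) auto
      show "(\<lambda>x. \<phi> N x *\<^sub>R U x) \<in> borel_measurable lebesgue" for N
      proof -
        have "(\<lambda>x. complex_of_real (\<phi> N x)) \<in> borel_measurable lebesgue"
          using sp smooth_measurable_lebesgue by (simp add: smooth_periodic_iff)
        then show ?thesis using Ui unfolding scaleR_conv_of_real by (intro borel_measurable_times) auto
      qed
      show "integrable lebesgue (\<lambda>x. norm (U x))" using Ui by simp
      show "AE x in lebesgue. (\<lambda>i. \<phi> i x *\<^sub>R U x) \<longlonglongrightarrow> indicator {a<..<b} x *\<^sub>R U x"
      proof (rule AE_I2)
        fix x show "(\<lambda>i. \<phi> i x *\<^sub>R U x) \<longlonglongrightarrow> indicator {a<..<b} x *\<^sub>R U x"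
          using lim[of x] by (cases "x \<in> {0..2*pi}") (auto intro!: tendsto_scaleR simp: U_def)
      qed
      show "AE x in lebesgue. norm (\<phi> i x *\<^sub>R U x) \<le> norm (U x)" for i
        by (rule AE_I2) (use flat_exp_nonneg flat_exp_0_le_1 in \<open>auto simp: \<phi>_def intro!: mult_left_le_one_le\<close>)
    qed
    moreover have "(LINT x|lebesgue. \<phi> N x *\<^sub>R U x) = 0" for N
    proof -
      have "(\<lambda>x. \<phi> N x *\<^sub>R U x) = (\<lambda>x. indicator {0..2*pi} x *\<^sub>R (u x * complex_of_real (\<phi> N x)))"
        by (auto simp: U_def scaleR_conv_of_real mult_ac)
      then show ?thesis using test[OF sp[of N]] by (simp only: set_lebesgue_integral_def)
    qed
    ultimately show ?thesis using LIMSEQ_unique[OF _ tendsto_const[of 0]] by simp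
  qed
  have Uab: "set_integrable lebesgue {a..b} U" for a b
    using integrable_mult_indicator[OF _ Ui, of "{a..b}"] by (simp add: set_integrable_def)
  have zero2: "integral {a..b} U = 0" for a b
  proof -
    have "(LINT x:{a..b}|lebesgue. U x) = 0"
    proof (cases "max a 0 < min b (2*pi)")
      case True
      have N: "{max a 0, min b (2*pi)} \<in> null_sets lebesgue"
        by (intro null_sets_completionI) (auto intro: finite_imp_null_set_lborel)
      have "(LINT x:{a..b}|lebesgue. U x) = (LINT x|lebesgue. indicator {max a 0<..<min b (2*pi)} x *\<^sub>R U x)"
        unfolding set_lebesgue_integral_def
      proof (rule integral_cong_AE)
        show "(\<lambda>x. indicat_real {a..b} x *\<^sub>R U x) \<in> borel_measurable lebesgue"
          "(\<lambda>x. indicat_real {max a 0<..<min b (2*pi)} x *\<^sub>R U x) \<in> borel_measurable lebesgue"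
          using Ui by (intro borel_measurable_scaleR borel_measurable_indicator; auto)+
        show "AE x in lebesgue. indicat_real {a..b} x *\<^sub>R U x = indicat_real {max a 0<..<min b (2*pi)} x *\<^sub>R U x"
          using AE_not_in[OF N] by eventually_elim (auto simp: U_def indicator_def)
      qed
      then show ?thesis using zero[of "max a 0" "min b (2*pi)"] True by simp
    next
      case False
      have N: "{max a 0} \<in> null_sets lebesgue"
        by (intro null_sets_completionI) (auto intro: finite_imp_null_set_lborel)
      show ?thesis
        unfolding set_lebesgue_integral_def
      proof (rule integral_eq_zero_AE)
        show "AE x in lebesgue. indicat_real {a..b} x *\<^sub>R U x = 0"
          using AE_not_in[OF N] by eventually_elim (use False in \<open>auto simp: U_def indicator_def\<close>)
      qed
    qed
    then show ?thesis using set_lebesgue_integral_eq_integral(2)[OF Uab] by simp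
  qed
  \<comment> \<open>Lebesgue differentiation: off a null set U x is the limit of its averages over
    intervals, and these vanish by \<open>zero2\<close>.\<close>
  obtain N where N: "negligible N" "\<And>x e. \<lbrakk>x \<notin> N; 0 < e\<rbrakk> \<Longrightarrow> \<exists>d>0. \<forall>h. 0 < h \<and> h < d \<longrightarrow>
      norm(integral (cbox x (x + h *\<^sub>R One)) U /\<^sub>R h ^ DIM(real) - U x) < e"
    using integrable_ccontinuous_explicit[of U] set_lebesgue_integral_eq_integral(1)[OF Uab] by (auto simp: cbox_interval)
  have "U x = 0" if xN: "x \<notin> N" for x
  proof (rule ccontr)
    assume "U x \<noteq> 0"
    then obtain d where d: "d > 0" "\<And>h. 0 < h \<and> h < d \<Longrightarrow>
      norm(integral (cbox x (x + h *\<^sub>R One)) U /\<^sub>R h ^ DIM(real) - U x) < norm (U x)"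
      using N(2)[OF xN, of "norm (U x)"] by auto
    from d(2)[of "d/2"] d(1) show False by (simp add: cbox_interval zero2)
  qed
  moreover have "AE x in lebesgue. x \<notin> N"
    using N(1) by (simp add: negligible_iff_null_sets AE_not_in)
  ultimately show ?thesis by (auto elim!: eventually_mono simp: U_def indicator_def split: if_splits)
qed

section \<open>Uniqueness of weak derivatives and independence of the norm from their choice\<close>

lemma weak_deriv_unique:
  assumes w: "weak_deriv f g" "weak_deriv f' g'" and ae: "AE x in lebesgue. x \<in> {0..2*pi} \<longrightarrow> f x = f' x"
  shows "AE x in lebesgue. x \<in> {0..2*pi} \<longrightarrow> g x = g' x"
proof -
  have "AE x in lebesgue. x \<in> {0..2*pi} \<longrightarrow> g x - g' x = 0"
  proof (rule AE_zero_of_test)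
    show "set_integrable lebesgue {0..2*pi} (\<lambda>x. g x - g' x)"
      using w by (auto simp: weak_deriv_def)
    fix \<phi> assume \<phi>: "smooth_periodic \<phi>"
    then have c: "continuous_on UNIV \<phi>" by (simp add: smooth_periodic_iff smooth_continuous_on)
    obtain \<phi>' where \<phi>': "\<And>t. (\<phi> has_vector_derivative \<phi>' t) (at t)" "smooth \<phi>'"
      using smooth_has_derivative \<phi> by (auto simp: smooth_periodic_iff)
    have eq: "vector_derivative \<phi> (at x) = \<phi>' x" for x using \<phi>'(1) by (simp add: vector_derivative_at)
    have c': "continuous_on UNIV \<phi>'" using \<phi>' by (simp add: smooth_continuous_on)
    have si: "set_integrable lebesgue {0..2*pi} (\<lambda>x. g x * \<phi> x)" "set_integrable lebesgue {0..2*pi} (\<lambda>x. g' x * \<phi> x)"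
      "set_integrable lebesgue {0..2*pi} (\<lambda>x. f x * \<phi>' x)" "set_integrable lebesgue {0..2*pi} (\<lambda>x. f' x * \<phi>' x)"
      using w c c' by (auto simp: weak_deriv_def intro!: set_integrable_mult_continuous)
    have "(LINT x:{0..2*pi}|lebesgue. (g x - g' x) * \<phi> x)
       = (LINT x:{0..2*pi}|lebesgue. g x * \<phi> x) - (LINT x:{0..2*pi}|lebesgue. g' x * \<phi> x)"
      using set_integral_diff(2)[OF si(1,2)] by (simp add: left_diff_distrib)
    also have "\<dots> = - (LINT x:{0..2*pi}|lebesgue. f x * \<phi>' x) + (LINT x:{0..2*pi}|lebesgue. f' x * \<phi>' x)"
      using w \<phi> unfolding weak_deriv_def eq[symmetric] by simp
    also have "(LINT x:{0..2*pi}|lebesgue. f x * \<phi>' x) = (LINT x:{0..2*pi}|lebesgue. f' x * \<phi>' x)"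
      unfolding set_lebesgue_integral_def
      by (rule integral_cong_AE) (use si ae in \<open>auto simp: set_integrable_def indicator_def elim!: eventually_mono\<close>)
    finally show "(LINT x:{0..2*pi}|lebesgue. (g x - g' x) * \<phi> x) = 0" by simp
  qed
  then show ?thesis by simp
qed

lemma weak_derivs_unique:
  assumes w: "weak_derivs k f D" "weak_derivs k f D'" and "j \<le> k"
  shows "AE x in lebesgue. x \<in> {0..2*pi} \<longrightarrow> D j x = D' j x"
  using \<open>j \<le> k\<close>
proof (induction j)
  case 0 then show ?case using w by (simp add: weak_derivs_def)
next
  case (Suc j)
  then show ?case using w weak_deriv_unique[of "D j" "D (Suc j)" "D' j" "D' (Suc j)"]
    by (auto simp: weak_derivs_def)
qed

lemma Lp_pow_cong_AE:
  assumes "AE x in lebesgue. x \<in> {0..2*pi} \<longrightarrow> f x = g x" shows "Lp_pow p f = Lp_pow p g"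
  unfolding Lp_pow_def
  by (rule nn_integral_cong_AE) (use assms in \<open>auto elim!: eventually_mono simp: indicator_def\<close>)

lemma Gag_pow_cong_AE:
  assumes ae: "AE x in lebesgue. x \<in> {0..2*pi} \<longrightarrow> f x = g x" shows "Gag_pow \<sigma> p f = Gag_pow \<sigma> p g"
  unfolding Gag_pow_def
proof (rule nn_integral_cong_AE)
  have 1: "(\<integral>\<^sup>+ y\<in>{0..2*pi}. ennreal (cmod (z - f y) powr p / cmod (cis x - cis y) powr (1 + \<sigma> * p)) \<partial>lebesgue)
     = (\<integral>\<^sup>+ y\<in>{0..2*pi}. ennreal (cmod (z - g y) powr p / cmod (cis x - cis y) powr (1 + \<sigma> * p)) \<partial>lebesgue)" for x z
    by (rule nn_integral_cong_AE) (use ae in \<open>auto elim!: eventually_mono simp: indicator_def\<close>)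
  show "AE x in lebesgue. (\<integral>\<^sup>+ y\<in>{0..2*pi}. ennreal (cmod (f x - f y) powr p / cmod (cis x - cis y) powr (1 + \<sigma> * p)) \<partial>lebesgue) * indicator {0..2*pi} x
     = (\<integral>\<^sup>+ y\<in>{0..2*pi}. ennreal (cmod (g x - g y) powr p / cmod (cis x - cis y) powr (1 + \<sigma> * p)) \<partial>lebesgue) * indicator {0..2*pi} x"
    unfolding 1 using ae by (auto elim!: eventually_mono simp: indicator_def)
qed

lemma Wsp_pow_unique:
  assumes "weak_derivs (nat \<lfloor>s\<rfloor>) f D" "weak_derivs (nat \<lfloor>s\<rfloor>) f D'"
  shows "Wsp_pow s p D = Wsp_pow s p D'"
proof -
  note u = weak_derivs_unique[OF assms]
  have "(\<Sum>j\<le>nat \<lfloor>s\<rfloor>. Lp_pow p (D j)) = (\<Sum>j\<le>nat \<lfloor>s\<rfloor>. Lp_pow p (D' j))"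
    by (intro sum.cong refl Lp_pow_cong_AE u) auto
  moreover have "Gag_pow (s - of_int \<lfloor>s\<rfloor>) p (D (nat \<lfloor>s\<rfloor>)) = Gag_pow (s - of_int \<lfloor>s\<rfloor>) p (D' (nat \<lfloor>s\<rfloor>))"
    by (intro Gag_pow_cong_AE u) auto
  ultimately show ?thesis by (simp add: Wsp_pow_def)
qed

text \<open>Removes the choice operator: two families of weak derivatives of f agree almost
  everywhere on [0, 2 pi], hence have the same energy, and any convenient family may be
  used.\<close>

lemma Wsp_norm_eq:
  assumes "weak_derivs (nat \<lfloor>s\<rfloor>) f D" "Wsp_pow s p D < \<infinity>"
  shows "Wsp_norm s p f = enn2real (Wsp_pow s p D) powr (1/p)"
proof -
  have "weak_derivs (nat \<lfloor>s\<rfloor>) f (SOME D. weak_derivs (nat \<lfloor>s\<rfloor>) f D \<and> Wsp_pow s p D < \<infinity>)"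
    using someI[of "\<lambda>D. weak_derivs (nat \<lfloor>s\<rfloor>) f D \<and> Wsp_pow s p D < \<infinity>" D] assms by blast
  then show ?thesis unfolding Wsp_norm_def using Wsp_pow_unique[OF _ assms(1)] by metis
qed

lemma weak_deriv_diff:
  assumes "weak_deriv f g" "weak_deriv f' g'"
  shows "weak_deriv (\<lambda>x. f x - f' x) (\<lambda>x. g x - g' x)"
proof -
  have "(LINT x:{0..2*pi}|lebesgue. (f x - f' x) * vector_derivative \<phi> (at x))
          = - (LINT x:{0..2*pi}|lebesgue. (g x - g' x) * \<phi> x)" if \<phi>: "smooth_periodic \<phi>" for \<phi>
  proof -
    have c: "continuous_on UNIV \<phi>" using \<phi> by (simp add: smooth_periodic_iff smooth_continuous_on)
    obtain \<phi>' where \<phi>': "\<And>t. (\<phi> has_vector_derivative \<phi>' t) (at t)" "smooth \<phi>'"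
      using smooth_has_derivative \<phi> by (auto simp: smooth_periodic_iff)
    have eq: "vector_derivative \<phi> (at x) = \<phi>' x" for x using \<phi>'(1) by (simp add: vector_derivative_at)
    have c': "continuous_on UNIV \<phi>'" using \<phi>' by (simp add: smooth_continuous_on)
    have si: "set_integrable lebesgue {0..2*pi} (\<lambda>x. g x * \<phi> x)" "set_integrable lebesgue {0..2*pi} (\<lambda>x. g' x * \<phi> x)"
      "set_integrable lebesgue {0..2*pi} (\<lambda>x. f x * \<phi>' x)" "set_integrable lebesgue {0..2*pi} (\<lambda>x. f' x * \<phi>' x)"
      using assms c c' by (auto simp: weak_deriv_def intro!: set_integrable_mult_continuous)
    have "(LINT x:{0..2*pi}|lebesgue. f x * \<phi>' x) = - (LINT x:{0..2*pi}|lebesgue. g x * \<phi> x)"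
      "(LINT x:{0..2*pi}|lebesgue. f' x * \<phi>' x) = - (LINT x:{0..2*pi}|lebesgue. g' x * \<phi> x)"
      using assms \<phi> unfolding weak_deriv_def eq[symmetric] by auto
    then show ?thesis using set_integral_diff(2)[OF si(1,2)] set_integral_diff(2)[OF si(3,4)]
      by (simp add: left_diff_distrib eq)
  qed
  then show ?thesis using assms by (auto simp: weak_deriv_def)
qed

lemma weak_derivs_diff:
  assumes "weak_derivs k f D" "weak_derivs k f' D'"
  shows "weak_derivs k (\<lambda>x. f x - f' x) (\<lambda>j x. D j x - D' j x)"
  using assms by (auto simp: weak_derivs_def intro!: weak_deriv_diff borel_measurable_diff)

lemma weak_derivs_const: "weak_derivs k (\<lambda>x. c) (\<lambda>j x. if j = 0 then c else 0)"
  using weak_derivs_classical[of "\<lambda>j x. if j = 0 then c else 0" k] by (auto simp: periodic2pi_def)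

subsection \<open>Quasi-triangle inequalities\<close>

text \<open>Both terms are bounded by the larger one. Since the theorem leaves its constants free,
  this factor \<open>2 powr p\<close> serves as triangle inequality for p-th powers, and no roots
  are taken in \<open>ennreal\<close>.\<close>

lemma powr_diff_le:
  fixes a b :: complex
  assumes "0 \<le> p" shows "cmod (a - b) powr p \<le> 2 powr p * (cmod a powr p + cmod b powr p)"
proof -
  have "cmod (a - b) powr p \<le> (2 * max (cmod a) (cmod b)) powr p"
    using norm_triangle_ineq4[of a b] assms by (intro powr_mono2) (auto simp: max_def)
  also have "\<dots> = 2 powr p * max (cmod a) (cmod b) powr p"
    by (simp add: powr_mult max_def)
  also have "max (cmod a) (cmod b) powr p \<le> cmod a powr p + cmod b powr p"
    by (simp add: max_def)
  finally show ?thesis by simp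
qed

lemma sigma_finite_lebesgue: "sigma_finite_measure (lebesgue :: real measure)"
proof
  obtain A :: "real set set" where "countable A" "A \<subseteq> sets lborel" "\<Union>A = space lborel" "\<forall>a\<in>A. emeasure lborel a \<noteq> \<infinity>"
    using lborel.sigma_finite_countable by blast
  then show "\<exists>A::real set set. countable A \<and> A \<subseteq> sets lebesgue \<and> \<Union> A = space lebesgue \<and> (\<forall>a\<in>A. emeasure lebesgue a \<noteq> \<infinity>)"
    by (intro exI[of _ A]) (auto simp: sets_completionI_sets emeasure_completion)
qed

lemma nn_integral_cmult_add:
  assumes "f \<in> borel_measurable M" "g \<in> borel_measurable M"
  shows "(\<integral>\<^sup>+x. c * (f x + g x) \<partial>M) = c * ((\<integral>\<^sup>+x. f x \<partial>M) + (\<integral>\<^sup>+x. g x \<partial>M))"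
  using assms by (simp add: nn_integral_cmult nn_integral_add)

lemma Icc_lebesgue [measurable]: "{a..b::real} \<in> sets lebesgue"
  by simp

lemma cis_measurable: "cis \<in> borel_measurable borel"
  using smooth_measurable[OF smooth_cis[OF smooth_id]] by simp

lemma cis_measurable_lebesgue [measurable]: "cis \<in> borel_measurable lebesgue"
  using smooth_measurable_lebesgue[OF smooth_cis[OF smooth_id]] by simp

lemma Lp_pow_diff_le:
  assumes [measurable]: "f \<in> borel_measurable lebesgue" "g \<in> borel_measurable lebesgue" and p: "0 \<le> p"
  shows "Lp_pow p (\<lambda>x. f x - g x) \<le> ennreal (2 powr p) * (Lp_pow p f + Lp_pow p g)"
proof -
  have "Lp_pow p (\<lambda>x. f x - g x) \<le> (\<integral>\<^sup>+ x. ennreal (2 powr p) * (ennreal (cmod (f x) powr p) * indicator {0..2*pi} x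
        + ennreal (cmod (g x) powr p) * indicator {0..2*pi} x) \<partial>lebesgue)"
    unfolding Lp_pow_def
    by (intro nn_integral_mono)
      (use powr_diff_le[OF p] in \<open>auto simp: indicator_def ennreal_plus[symmetric] ennreal_mult'[symmetric] simp del: ennreal_plus\<close>)
  also have "\<dots> = ennreal (2 powr p) * (Lp_pow p f + Lp_pow p g)"
    unfolding Lp_pow_def by (rule nn_integral_cmult_add) measurable
  finally show ?thesis .
qed

text \<open>Representatives of weak derivatives are merely Lebesgue measurable, so joint
  measurability is taken over the product of \<open>lebesgue\<close> with itself, which rests on
  sigma-finiteness.\<close>

lemma Gag_inner_measurable:
  assumes [measurable]: "f \<in> borel_measurable lebesgue"
  shows "(\<lambda>x. \<integral>\<^sup>+ y\<in>{0..2*pi}. ennreal (cmod (f x - f y) powr p / cmod (cis x - cis y) powr (1 + \<sigma> * p)) \<partial>lebesgue)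
     \<in> borel_measurable lebesgue"
proof -
  interpret sigma_finite_measure "lebesgue :: real measure" by (rule sigma_finite_lebesgue)
  have [measurable]: "(\<lambda>z. h (fst z)) \<in> borel_measurable (lebesgue \<Otimes>\<^sub>M lebesgue)"
      "(\<lambda>z. h (snd z)) \<in> borel_measurable (lebesgue \<Otimes>\<^sub>M lebesgue)"
    if "h \<in> borel_measurable (lebesgue :: real measure)" for h :: "real \<Rightarrow> complex"
    using measurable_compose[OF measurable_fst that] measurable_compose[OF measurable_snd that] by auto
  have [measurable]: "(\<lambda>z. indicator {0..2*pi} (snd z) :: ennreal) \<in> borel_measurable (lebesgue \<Otimes>\<^sub>M lebesgue)"
    using measurable_compose[OF measurable_snd borel_measurable_indicator[OF Icc_lebesgue]] .
  note [measurable] = \<open>f \<in> borel_measurable lebesgue\<close>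
  show ?thesis by (rule borel_measurable_nn_integral) (unfold split_beta, measurable)
qed

lemma Gag_pow_diff_le:
  assumes f[measurable]: "f \<in> borel_measurable lebesgue" and g[measurable]: "g \<in> borel_measurable lebesgue" and p: "0 \<le> p"
  shows "Gag_pow \<sigma> p (\<lambda>x. f x - g x) \<le> ennreal (2 powr p) * (Gag_pow \<sigma> p f + Gag_pow \<sigma> p g)"
proof -
  let ?k = "\<lambda>h x y. ennreal (cmod (h x - h y) powr p / cmod (cis x - cis y) powr (1 + \<sigma> * p))"
  have m: "(\<lambda>y. ?k f x y * indicator {0..2*pi} y) \<in> borel_measurable lebesgue"
     "(\<lambda>y. ?k g x y * indicator {0..2*pi} y) \<in> borel_measurable lebesgue" for x
    by measurable
  have k: "?k (\<lambda>x. f x - g x) x y \<le> ennreal (2 powr p) * (?k f x y + ?k g x y)" for x y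
  proof -
    have "cmod ((f x - f y) - (g x - g y)) powr p / cmod (cis x - cis y) powr (1 + \<sigma> * p)
      \<le> 2 powr p * (cmod (f x - f y) powr p + cmod (g x - g y) powr p) / cmod (cis x - cis y) powr (1 + \<sigma> * p)"
      by (intro divide_right_mono powr_diff_le p) auto
    also have "\<dots> = 2 powr p * (cmod (f x - f y) powr p / cmod (cis x - cis y) powr (1 + \<sigma> * p)
        + cmod (g x - g y) powr p / cmod (cis x - cis y) powr (1 + \<sigma> * p))"
      by (simp add: add_divide_distrib distrib_left)
    finally show ?thesis
      by (auto simp: ennreal_plus[symmetric] ennreal_mult'[symmetric] algebra_simps simp del: ennreal_plus intro!: ennreal_leI)
  qed
  have inner: "(\<integral>\<^sup>+ y\<in>{0..2*pi}. ?k (\<lambda>x. f x - g x) x y \<partial>lebesgue)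
     \<le> ennreal (2 powr p) * ((\<integral>\<^sup>+ y\<in>{0..2*pi}. ?k f x y \<partial>lebesgue) + (\<integral>\<^sup>+ y\<in>{0..2*pi}. ?k g x y \<partial>lebesgue))" for x
  proof -
    have "(\<integral>\<^sup>+ y\<in>{0..2*pi}. ?k (\<lambda>x. f x - g x) x y \<partial>lebesgue)
      \<le> (\<integral>\<^sup>+ y. ennreal (2 powr p) * (?k f x y * indicator {0..2*pi} y + ?k g x y * indicator {0..2*pi} y) \<partial>lebesgue)"
      by (intro nn_integral_mono) (use k in \<open>auto simp: indicator_def\<close>)
    also have "\<dots> = ennreal (2 powr p) * ((\<integral>\<^sup>+ y\<in>{0..2*pi}. ?k f x y \<partial>lebesgue) + (\<integral>\<^sup>+ y\<in>{0..2*pi}. ?k g x y \<partial>lebesgue))"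
      by (rule nn_integral_cmult_add) (rule m)+
    finally show ?thesis .
  qed
  have "Gag_pow \<sigma> p (\<lambda>x. f x - g x)
    \<le> (\<integral>\<^sup>+ x. ennreal (2 powr p) * ((\<integral>\<^sup>+ y\<in>{0..2*pi}. ?k f x y \<partial>lebesgue) * indicator {0..2*pi} x
        + (\<integral>\<^sup>+ y\<in>{0..2*pi}. ?k g x y \<partial>lebesgue) * indicator {0..2*pi} x) \<partial>lebesgue)"
    unfolding Gag_pow_def by (intro nn_integral_mono) (use inner in \<open>auto simp: indicator_def\<close>)
  also have "\<dots> = ennreal (2 powr p) * (Gag_pow \<sigma> p f + Gag_pow \<sigma> p g)"
    unfolding Gag_pow_def by (rule nn_integral_cmult_add) (intro borel_measurable_times_ennreal borel_measurable_indicator Gag_inner_measurable f g; simp)+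
  finally show ?thesis .
qed

subsection \<open>Gagliardo energies of bounded Lipschitz functions\<close>

lemma periodic2pi_int:
  assumes "periodic2pi H" shows "H (x + 2*pi * of_int j) = H x"
proof -
  have nat: "H (x + 2*pi * real n) = H x" for n x
  proof (induction n)
    case (Suc n)
    have "H (x + 2*pi * real (Suc n)) = H ((x + 2*pi * real n) + 2*pi)" by (simp add: algebra_simps)
    then show ?case using assms Suc by (simp add: periodic2pi_def)
  qed simp
  show ?thesis
  proof (cases "j \<ge> 0")
    case True then show ?thesis using nat[of x "nat j"] by simp
  next
    case False
    then show ?thesis using nat[of "x + 2*pi * of_int j" "nat (- j)"] by simp
  qed
qed

lemma cis_eq_periodic:
  assumes "periodic2pi H" "cis a = cis b" shows "H a = H b"
proof -
  have "sin a = sin b \<and> cos a = cos b" using assms(2) by (simp add: cis.ctr)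
  then obtain n::int where "a = b + 2*pi*n" using sin_cos_eq_iff by blast
  then show ?thesis using periodic2pi_int[OF assms(1)] by simp
qed

text \<open>The chord formula has two roles: it compares chord and arc in the Gagliardo kernel, and
  with phases in place of angles it gives |f - g| = 2 |sin (\<theta> / 2)|.\<close>

lemma norm_cis_diff: "cmod (cis x - cis y) = 2 * \<bar>sin ((x - y) / 2)\<bar>"
proof -
  have "(cmod (cis x - cis y))\<^sup>2 = (2 * \<bar>sin ((x - y) / 2)\<bar>)\<^sup>2"
  proof -
    have "(cmod (cis x - cis y))\<^sup>2 = 2 - 2 * cos (x - y)"
      using sin_cos_squared_add[of x] sin_cos_squared_add[of y]
      by (simp add: cmod_power2 cos_diff power2_diff algebra_simps)
    also have "cos (x - y) = 1 - 2 * (sin ((x - y) / 2))\<^sup>2"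
      using cos_double_sin[of "(x - y) / 2"] by (simp only: times_divide_eq_right nonzero_mult_div_cancel_left[of 2] zero_neq_numeral not_False_eq_True)
    finally show ?thesis by (simp add: power_mult_distrib)
  qed
  then show ?thesis by (subst (asm) power2_eq_iff_nonneg) auto
qed

lemma norm_cis_diff_le: "cmod (cis x - cis y) \<le> \<bar>x - y\<bar>"
  using abs_sin_x_le_abs_x[of "(x - y) / 2"] by (simp add: norm_cis_diff)

text \<open>The Taylor bound u - u^3 / 6 is at least u / 2 as long as u^2 <= 3, and pi / 2 <= 8 / 5
  leaves room for that.\<close>

lemma sin_ge_half:
  fixes u :: real assumes "0 \<le> u" "u \<le> pi/2" shows "u / 2 \<le> sin u"
proof -
  have "\<bar>sin u - (\<Sum>m<3. sin_coeff m * u ^ m)\<bar> \<le> inverse (fact 3) * \<bar>u\<bar> ^ 3"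
    by (rule Maclaurin_sin_bound)
  moreover have "(\<Sum>m<3. sin_coeff m * u ^ m) = u"
    by (simp add: sin_coeff_def eval_nat_numeral)
  ultimately have "\<bar>sin u - u\<bar> \<le> u^3/6" using assms by (simp add: fact_numeral)
  then have 1: "sin u \<ge> u - u^3/6" by linarith
  have "u \<le> 8/5" using assms pi_approx by simp
  then have "u^2 \<le> (8/5)^2" using assms by (intro power_mono) auto
  then have "u * u^2 \<le> u * 3" using assms by (intro mult_left_mono) (auto simp: power2_eq_square)
  then have "u^3 \<le> 3 * u" by (simp add: eval_nat_numeral)
  then show ?thesis using 1 by simp
qed

lemma norm_cis_diff_ge:
  assumes "\<bar>x - y\<bar> \<le> pi" shows "\<bar>x - y\<bar> / 2 \<le> cmod (cis x - cis y)"
proof -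
  have "\<bar>x - y\<bar> / 2 / 2 \<le> sin (\<bar>x - y\<bar> / 2)" using assms by (intro sin_ge_half) auto
  also have "\<dots> \<le> \<bar>sin ((x - y) / 2)\<bar>" 
  proof (cases "y \<le> x")
    case False
    have "(x - y) / 2 = - ((y - x) / 2)" by (simp add: field_simps)
    then have "sin ((x - y) / 2) = - sin ((y - x) / 2)" by (simp only: sin_minus)
    then show ?thesis using False by simp
  qed simp
  finally show ?thesis by (simp add: norm_cis_diff)
qed

section \<open>Power integrals and the truncated kernel\<close>

lemma nn_integral_powr_0:
  assumes "0 < \<beta>" "0 \<le> l"
  shows "(\<integral>\<^sup>+t. ennreal (t powr (\<beta> - 1)) * indicator {0..l} t \<partial>lborel) = ennreal (l powr \<beta> / \<beta>)"
  using nn_integral_has_integral_lebesgue[of "{0..l}" "\<lambda>t. t powr (\<beta> - 1)" "l powr \<beta> / \<beta>"]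
    has_integral_powr_from_0[of "\<beta> - 1" l] assms
  by (simp add: ennreal_indicator[symmetric] ennreal_mult'[symmetric] mult.commute)

lemma nn_integral_powr_inf:
  assumes "0 < \<beta>" "0 < l"
  shows "(\<integral>\<^sup>+t. ennreal (t powr (- \<beta> - 1)) * indicator {l..} t \<partial>lborel) = ennreal (l powr (- \<beta>) / \<beta>)"
  using nn_integral_has_integral_lebesgue[of "{l..}" "\<lambda>t. t powr (- \<beta> - 1)" "l powr (- \<beta>) / \<beta>"]
    has_integral_powr_to_inf[of "- \<beta> - 1" l] assms
  by (simp add: ennreal_indicator[symmetric] ennreal_mult'[symmetric] mult.commute)

lemma nn_integral_reflect:
  assumes "F \<in> borel_measurable borel"
  shows "(\<integral>\<^sup>+y. F (c - y) \<partial>lborel) = (\<integral>\<^sup>+y. F (y::real) \<partial>lborel)"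
  using nn_integral_real_affine[of F "-1" c] assms by simp

text \<open>The bounds a and b |t| cross at |t| = a / b. Below this point the integrand is a
  multiple of t^(p (1 - \<sigma>) - 1), integrable at 0; above it a multiple of t^(-\<sigma> p - 1),
  integrable at infinity. Both pieces scale like a^(p (1 - \<sigma>)) b^(p \<sigma>), which is the
  interpolation between sup and Lipschitz bounds.\<close>

lemma nn_integral_truncated_kernel:
  assumes \<sigma>: "0 < \<sigma>" "\<sigma> < 1" and p: "0 < p" and ab: "0 < a" "0 < b"
  shows "(\<integral>\<^sup>+t. ennreal ((min a (b * \<bar>t\<bar>)) powr p / \<bar>t\<bar> powr (1 + \<sigma> * p)) \<partial>lborel)
    \<le> ennreal (2 * (1 / (p * (1 - \<sigma>)) + 1 / (\<sigma> * p)) * (a powr (p * (1 - \<sigma>)) * b powr (p * \<sigma>)))"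
proof -
  define l where "l = a / b"
  have l: "l > 0" using ab by (simp add: l_def)
  define \<beta> where "\<beta> = p * (1 - \<sigma>)"
  have \<beta>: "\<beta> > 0" using \<sigma> p by (simp add: \<beta>_def)
  have \<sigma>p: "\<sigma> * p > 0" using \<sigma> p by simp
  define G where "G = (\<lambda>t. ennreal (b powr p) * (ennreal (t powr (\<beta> - 1)) * indicator {0..l} t)
     + ennreal (a powr p) * (ennreal (t powr (- (\<sigma> * p) - 1)) * indicator {l..} t))"
  have [measurable]: "G \<in> borel_measurable borel" unfolding G_def by measurable
  have IG: "(\<integral>\<^sup>+t. G t \<partial>lborel) = ennreal ((1 / (p * (1 - \<sigma>)) + 1 / (\<sigma> * p)) * (a powr (p * (1 - \<sigma>)) * b powr (p * \<sigma>)))"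
  proof -
    have 1: "b powr p * (l powr \<beta> / \<beta>) = 1 / \<beta> * (a powr \<beta> * b powr (p * \<sigma>))"
    proof -
      have "b powr p = b powr \<beta> * b powr (p * \<sigma>)" by (simp add: powr_add[symmetric] \<beta>_def algebra_simps)
      then show ?thesis using ab by (simp add: l_def powr_divide)
    qed
    have 2: "a powr p * (l powr (- (\<sigma> * p)) / (\<sigma> * p)) = 1 / (\<sigma> * p) * (a powr \<beta> * b powr (p * \<sigma>))"
    proof -
      have "a powr p = a powr \<beta> * a powr (p * \<sigma>)" by (simp add: powr_add[symmetric] \<beta>_def algebra_simps)
      then show ?thesis using ab by (simp add: l_def powr_divide powr_minus field_simps mult.commute[of p \<sigma>])
    qed
    have "(\<integral>\<^sup>+t. G t \<partial>lborel) = ennreal (b powr p) * ennreal (l powr \<beta> / \<beta>) + ennreal (a powr p) * ennreal (l powr (- (\<sigma> * p)) / (\<sigma> * p))"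
      unfolding G_def
      by (simp add: nn_integral_add nn_integral_cmult nn_integral_powr_0[OF \<beta> less_imp_le[OF l]] nn_integral_powr_inf[OF \<sigma>p l])
    also have "\<dots> = ennreal (b powr p * (l powr \<beta> / \<beta>) + a powr p * (l powr (- (\<sigma> * p)) / (\<sigma> * p)))"
      using \<beta> \<sigma>p by (simp add: ennreal_mult'[symmetric] ennreal_plus[symmetric] del: ennreal_plus)
    also have "b powr p * (l powr \<beta> / \<beta>) + a powr p * (l powr (- (\<sigma> * p)) / (\<sigma> * p))
       = (1 / (p * (1 - \<sigma>)) + 1 / (\<sigma> * p)) * (a powr (p * (1 - \<sigma>)) * b powr (p * \<sigma>))"
      unfolding 1 2 by (simp add: \<beta>_def distrib_right)
    finally show ?thesis .
  qed
  have pw: "ennreal ((min a (b * \<bar>t\<bar>)) powr p / \<bar>t\<bar> powr (1 + \<sigma> * p)) \<le> G t + G (0 - t)" for t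
  proof -
    have *: "ennreal ((min a (b * t)) powr p / t powr (1 + \<sigma> * p)) \<le> G t" if "t > 0" for t
    proof (cases "t \<le> l")
      case True
      have "(min a (b * t)) powr p / t powr (1 + \<sigma> * p) \<le> (b * t) powr p / t powr (1 + \<sigma> * p)"
        using that ab p by (intro divide_right_mono powr_mono2) auto
      also have "\<dots> = b powr p * t powr (\<beta> - 1)"
      proof -
        have "t powr p = t powr (\<beta> - 1) * t powr (1 + \<sigma> * p)" by (simp add: powr_add[symmetric] \<beta>_def algebra_simps)
        then show ?thesis using that ab by (simp add: powr_mult)
      qed
      finally have "ennreal ((min a (b * t)) powr p / t powr (1 + \<sigma> * p)) \<le> ennreal (b powr p) * ennreal (t powr (\<beta> - 1))"
        by (simp add: ennreal_mult'[symmetric] ennreal_leI)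
      then show ?thesis using True that by (simp add: G_def add_increasing2)
    next
      case False
      have "(min a (b * t)) powr p / t powr (1 + \<sigma> * p) \<le> a powr p / t powr (1 + \<sigma> * p)"
        using that ab p by (intro divide_right_mono powr_mono2) auto
      also have "\<dots> = a powr p * t powr (- (\<sigma> * p) - 1)"
        using that by (simp add: powr_minus powr_diff powr_add field_simps)
      finally have "ennreal ((min a (b * t)) powr p / t powr (1 + \<sigma> * p)) \<le> ennreal (a powr p) * ennreal (t powr (- (\<sigma> * p) - 1))"
        by (simp add: ennreal_mult'[symmetric] ennreal_leI)
      then show ?thesis using False that by (simp add: G_def add_increasing)
    qed
    consider "t > 0" | "t < 0" | "t = 0" by linarith
    then show ?thesis
    proof cases
      case 1 then show ?thesis using *[of t] by (simp add: add_increasing2)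
    next
      case 2 then show ?thesis using *[of "- t"] by (simp add: add_increasing)
    qed simp
  qed
  have "(\<integral>\<^sup>+t. ennreal ((min a (b * \<bar>t\<bar>)) powr p / \<bar>t\<bar> powr (1 + \<sigma> * p)) \<partial>lborel) \<le> (\<integral>\<^sup>+t. G t + G (0 - t) \<partial>lborel)"
    by (intro nn_integral_mono pw)
  also have "\<dots> = (\<integral>\<^sup>+t. G t \<partial>lborel) + (\<integral>\<^sup>+t. G t \<partial>lborel)"
    by (subst nn_integral_add) (auto simp: nn_integral_reflect[where c=0, simplified])
  also have "\<dots> = ennreal (2 * (1 / (p * (1 - \<sigma>)) + 1 / (\<sigma> * p)) * (a powr (p * (1 - \<sigma>)) * b powr (p * \<sigma>)))"
    unfolding IG using \<sigma> p by (subst ennreal_plus[symmetric]) (auto intro!: mult_nonneg_nonneg add_nonneg_nonneg divide_nonneg_nonneg simp: algebra_simps)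
  finally show ?thesis .
qed

text \<open>The factors are the length 2 pi of the outer integral, three translates of the kernel,
  the loss in replacing chord by half the arc, and the constant of the truncated kernel.\<close>

definition Gag_const :: "real \<Rightarrow> real \<Rightarrow> real" where
  "Gag_const \<sigma> p = 2*pi * (3 * (2 powr (1 + \<sigma> * p) * (2 * (1 / (p * (1 - \<sigma>)) + 1 / (\<sigma> * p)))))"

text \<open>Passing to the nearest translate of y turns the chord into an ordinary distance up to a
  factor 2. The kernel is then dominated by translates of the truncated one, whose integral does not
  depend on x.\<close>

lemma Gag_pow_le:
  assumes \<sigma>: "0 < \<sigma>" "\<sigma> < 1" and p: "0 < p" and ab: "0 < a" "0 < b" and per: "periodic2pi H"
    and osc: "\<And>x y. cmod (H x - H y) \<le> a" and lip: "\<And>x y. cmod (H x - H y) \<le> b * \<bar>x - y\<bar>"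
  shows "Gag_pow \<sigma> p H \<le> ennreal (Gag_const \<sigma> p * (a powr (p * (1 - \<sigma>)) * b powr (p * \<sigma>)))"
proof -
  define q where "q = (\<lambda>t. ennreal ((min a (b * \<bar>t\<bar>)) powr p / \<bar>t\<bar> powr (1 + \<sigma> * p)))"
  have [measurable]: "q \<in> borel_measurable borel" unfolding q_def by measurable
  define B where "B = 2 * (1 / (p * (1 - \<sigma>)) + 1 / (\<sigma> * p)) * (a powr (p * (1 - \<sigma>)) * b powr (p * \<sigma>))"
  have B: "0 \<le> B" unfolding B_def using \<sigma> p by (intro mult_nonneg_nonneg add_nonneg_nonneg divide_nonneg_nonneg) auto
  have q: "(\<integral>\<^sup>+t. q t \<partial>lborel) \<le> ennreal B"
    unfolding q_def B_def by (rule nn_integral_truncated_kernel[OF \<sigma> p ab])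
  have e: "1 + \<sigma> * p > 0" using \<sigma> p by (simp add: add_pos_pos)
  have one: "ennreal (cmod (H x - H y) powr p / cmod (cis x - cis y) powr (1 + \<sigma> * p))
     \<le> ennreal (2 powr (1 + \<sigma> * p)) * q (x - y - 2*pi * of_int j)" if "\<bar>x - y - 2*pi * of_int j\<bar> \<le> pi" for x y and j :: int
  proof (cases "cis x = cis y")
    case False
    define t where "t = \<bar>x - (y + 2*pi * of_int j)\<bar>"
    have c: "cis (y + 2*pi * of_int j) = cis y"
      using periodic2pi_int[of cis] by (auto simp: periodic2pi_def cis.ctr)
    have t: "t / 2 \<le> cmod (cis x - cis y)"
      using norm_cis_diff_ge[of x "y + 2*pi * of_int j"] that unfolding c t_def by (simp add: algebra_simps)
    have t0: "t > 0" using False c by (auto simp: t_def)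
    have "cmod (H x - H y) = cmod (H x - H (y + 2*pi * of_int j))" using periodic2pi_int[OF per] by simp
    then have h: "cmod (H x - H y) \<le> min a (b * t)" using osc lip t_def by simp
    have "cmod (H x - H y) powr p / cmod (cis x - cis y) powr (1 + \<sigma> * p) \<le> (min a (b*t)) powr p / (t/2) powr (1 + \<sigma> * p)"
      using h t t0 p e by (intro frac_le powr_mono2) auto
    also have "\<dots> = 2 powr (1 + \<sigma> * p) * ((min a (b*t)) powr p / t powr (1 + \<sigma> * p))"
      using t0 by (simp add: powr_divide)
    finally have "ennreal (cmod (H x - H y) powr p / cmod (cis x - cis y) powr (1 + \<sigma> * p))
      \<le> ennreal (2 powr (1 + \<sigma> * p)) * ennreal ((min a (b*t)) powr p / t powr (1 + \<sigma> * p))"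
      by (simp add: ennreal_mult'[symmetric] ennreal_leI)
    moreover have "t = \<bar>x - y - 2*pi * of_int j\<bar>" by (simp add: t_def algebra_simps)
    ultimately show ?thesis by (simp add: q_def)
  qed simp
  have pw: "ennreal (cmod (H x - H y) powr p / cmod (cis x - cis y) powr (1 + \<sigma> * p)) * indicator {0..2*pi} y
     \<le> ennreal (2 powr (1 + \<sigma> * p)) * (q (x - y) + q (x - 2*pi - y) + q (x + 2*pi - y))" if x: "x \<in> {0..2*pi}" for x y
  proof (cases "y \<in> {0..2*pi}")
    case True
    \<comment> \<open>For two points of [0, 2 pi] the nearest translate is y itself or y shifted by
      one period to either side; all three are summed.\<close>
    consider "\<bar>x - y\<bar> \<le> pi" | "\<bar>x - y - 2*pi\<bar> \<le> pi" | "\<bar>x - y + 2*pi\<bar> \<le> pi" using x True by force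
    then show ?thesis
    proof cases
      case 1
      then show ?thesis using one[of x y 0] True
        by (auto intro!: order_trans[OF one[of x y 0, simplified]] mult_left_mono simp: add_increasing2)
    next
      case 2
      have "x - y - 2*pi = x - 2*pi - y" by simp
      then have "ennreal (cmod (H x - H y) powr p / cmod (cis x - cis y) powr (1 + \<sigma> * p)) \<le> ennreal (2 powr (1 + \<sigma> * p)) * q (x - 2*pi - y)"
        using one[of x y 1] 2 by (metis mult.right_neutral of_int_1)
      also have "\<dots> \<le> ennreal (2 powr (1 + \<sigma> * p)) * (q (x - y) + q (x - 2*pi - y) + q (x + 2*pi - y))"
        by (intro mult_left_mono) (auto simp: add_increasing add_increasing2)
      finally show ?thesis using True by simp
    next
      case 3
      have e: "x - y - 2*pi * of_int (-1) = x + 2*pi - y" by simp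
      have "\<bar>x + 2*pi - y\<bar> \<le> pi" using 3 by (simp add: algebra_simps)
      then have "ennreal (cmod (H x - H y) powr p / cmod (cis x - cis y) powr (1 + \<sigma> * p)) \<le> ennreal (2 powr (1 + \<sigma> * p)) * q (x + 2*pi - y)"
        using one[of x y "-1", unfolded e] by blast
      also have "\<dots> \<le> ennreal (2 powr (1 + \<sigma> * p)) * (q (x - y) + q (x - 2*pi - y) + q (x + 2*pi - y))"
        by (intro mult_left_mono) (auto simp: add_increasing)
      finally show ?thesis using True by simp
    qed
  qed simp
  have inner: "(\<integral>\<^sup>+ y\<in>{0..2*pi}. ennreal (cmod (H x - H y) powr p / cmod (cis x - cis y) powr (1 + \<sigma> * p)) \<partial>lebesgue)
     \<le> ennreal (3 * (2 powr (1 + \<sigma> * p) * B))" if x: "x \<in> {0..2*pi}" for x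
  proof -
    have "(\<integral>\<^sup>+ y\<in>{0..2*pi}. ennreal (cmod (H x - H y) powr p / cmod (cis x - cis y) powr (1 + \<sigma> * p)) \<partial>lebesgue)
       \<le> (\<integral>\<^sup>+y. ennreal (2 powr (1 + \<sigma> * p)) * (q (x - y) + q (x - 2*pi - y) + q (x + 2*pi - y)) \<partial>lborel)"
      unfolding nn_integral_completion by (intro nn_integral_mono pw[OF x])
    also have "\<dots> = ennreal (2 powr (1 + \<sigma> * p)) * ((\<integral>\<^sup>+t. q t \<partial>lborel) + (\<integral>\<^sup>+t. q t \<partial>lborel) + (\<integral>\<^sup>+t. q t \<partial>lborel))"
      by (simp add: nn_integral_cmult nn_integral_add nn_integral_reflect)
    also have "\<dots> \<le> ennreal (2 powr (1 + \<sigma> * p)) * (ennreal B + ennreal B + ennreal B)"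
      by (intro mult_left_mono add_mono q) auto
    also have "\<dots> = ennreal (3 * (2 powr (1 + \<sigma> * p) * B))"
      using B by (simp add: ennreal_plus[symmetric] ennreal_mult'[symmetric] algebra_simps del: ennreal_plus)
    finally show ?thesis .
  qed
  have "Gag_pow \<sigma> p H \<le> (\<integral>\<^sup>+x. ennreal (3 * (2 powr (1 + \<sigma> * p) * B)) * indicator {0..2*pi} x \<partial>lebesgue)"
    unfolding Gag_pow_def by (intro nn_integral_mono) (use inner in \<open>auto simp: indicator_def\<close>)
  also have "\<dots> = ennreal (3 * (2 powr (1 + \<sigma> * p) * B)) * ennreal (2*pi)"
    unfolding nn_integral_completion by (subst nn_integral_cmult_indicator) auto
  also have "\<dots> = ennreal (Gag_const \<sigma> p * (a powr (p * (1 - \<sigma>)) * b powr (p * \<sigma>)))"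
    using B by (simp add: ennreal_mult'[symmetric] Gag_const_def B_def algebra_simps)
  finally show ?thesis .
qed

lemma Lp_pow_le:
  assumes p: "0 \<le> p" and M: "\<And>x. cmod (H x) \<le> M"
  shows "Lp_pow p H \<le> ennreal (2*pi * M powr p)"
proof -
  have "Lp_pow p H \<le> (\<integral>\<^sup>+x. ennreal (M powr p) * indicator {0..2*pi} x \<partial>lebesgue)"
    unfolding Lp_pow_def
    by (intro nn_integral_mono) (use M p in \<open>auto simp: indicator_def intro!: ennreal_leI powr_mono2\<close>)
  also have "\<dots> = ennreal (M powr p) * ennreal (2*pi)"
    unfolding nn_integral_completion by (subst nn_integral_cmult_indicator) auto
  finally show ?thesis by (simp add: ennreal_mult'[symmetric] mult.commute)
qed

lemma smooth_periodic_bounded: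
  assumes "smooth H" "periodic2pi H"
  obtains M where "M > 0" "\<And>x. cmod (H x) \<le> M"
proof -
  have "bounded (H ` {0..2*pi})"
    by (intro compact_imp_bounded compact_continuous_image smooth_continuous_on assms) simp
  then obtain M where M: "M > 0" "\<And>x. x \<in> {0..2*pi} \<Longrightarrow> cmod (H x) \<le> M" by (auto simp: bounded_pos)
  have "cmod (H x) \<le> M" for x
  proof -
    define j where "j = \<lfloor>x / (2*pi)\<rfloor>"
    have "of_int j \<le> x / (2*pi)" "x / (2*pi) < of_int j + 1" unfolding j_def by linarith+
    then have "x + 2*pi * of_int (- j) \<in> {0..2*pi}" by (auto simp: field_simps)
    then show ?thesis using M(2) periodic2pi_int[OF assms(2), of x "- j"] by metis
  qed
  then show ?thesis using that M by blast
qed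

lemma smooth_periodic_lipschitz:
  assumes "smooth H" "periodic2pi H"
  obtains L where "L > 0" "\<And>x y. cmod (H x - H y) \<le> L * \<bar>x - y\<bar>"
proof -
  obtain H' where H': "\<And>t. (H has_vector_derivative H' t) (at t)" "smooth H'"
    using smooth_has_derivative assms by blast
  obtain L where L: "L > 0" "\<And>x. cmod (H' x) \<le> L"
    using smooth_periodic_bounded[OF H'(2) periodic_derivative[OF assms(2) H'(1)]] by blast
  have "cmod (H x - H y) \<le> L * \<bar>x - y\<bar>" for x y
    using differentiable_bound[of UNIV H "\<lambda>x h. h *\<^sub>R H' x" L x y] H'(1) L(2)
    by (auto simp: has_vector_derivative_def onorm_scaleR_left_lemma onorm_scaleR_left bounded_linear_ident onorm_id)
  then show ?thesis using that L by blast
qed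

subsection \<open>Scaling\<close>

lemma nn_integral_periods:
  fixes F :: "real \<Rightarrow> ennreal"
  assumes [measurable]: "F \<in> borel_measurable borel" and per: "\<And>x. F (x + 2*pi) = F x"
  shows "(\<integral>\<^sup>+x. F x * indicator {0..<2*pi*real n} x \<partial>lborel) = of_nat n * (\<integral>\<^sup>+x. F x * indicator {0..<2*pi} x \<partial>lborel)"
proof (induction n)
  case (Suc n)
  have perj: "F (x + 2*pi*real n) = F x" for x
  proof (induction n)
    case (Suc n)
    have "x + 2*pi*real (Suc n) = (x + 2*pi*real n) + 2*pi" by (simp add: algebra_simps)
    then show ?case using per Suc by metis
  qed simp
  have "(\<integral>\<^sup>+x. F x * indicator {0..<2*pi*real (Suc n)} x \<partial>lborel)
     = (\<integral>\<^sup>+x. F x * indicator {0..<2*pi*real n} x + F x * indicator {2*pi*real n..<2*pi*real n + 2*pi} x \<partial>lborel)"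
  proof (intro nn_integral_cong)
    fix x :: real
    define z where "z = 2*pi*real n"
    have z: "0 \<le> z" "2*pi*real (Suc n) = z + 2*pi" by (auto simp: z_def algebra_simps)
    show "F x * indicator {0..<2*pi*real (Suc n)} x
        = F x * indicator {0..<2*pi*real n} x + F x * indicator {2*pi*real n..<2*pi*real n + 2*pi} x"
    proof (cases "x < z")
      case True
      then have "x < z + 2*pi" using pi_gt_zero by linarith
      then show ?thesis unfolding z(2) z_def[symmetric] using True by (auto simp: indicator_def)
    next
      case False
      then show ?thesis unfolding z(2) z_def[symmetric] using z(1) by (auto simp: indicator_def)
    qed
  qed
  also have "\<dots> = (\<integral>\<^sup>+x. F x * indicator {0..<2*pi*real n} x \<partial>lborel) + (\<integral>\<^sup>+x. F x * indicator {2*pi*real n..<2*pi*real n + 2*pi} x \<partial>lborel)"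
    by (subst nn_integral_add) auto
  also have "(\<integral>\<^sup>+x. F x * indicator {2*pi*real n..<2*pi*real n + 2*pi} x \<partial>lborel)
     = (\<integral>\<^sup>+x. F (2*pi*real n + x) * indicator {2*pi*real n..<2*pi*real n + 2*pi} (2*pi*real n + x) \<partial>lborel)"
    using nn_integral_real_affine[of "\<lambda>x. F x * indicator {2*pi*real n..<2*pi*real n + 2*pi} x" 1 "2*pi*real n"] by simp
  also have "\<dots> = (\<integral>\<^sup>+x. F x * indicator {0..<2*pi} x \<partial>lborel)"
    using perj by (intro nn_integral_cong) (auto simp: indicator_def add.commute)
  finally show ?case using Suc by (simp add: distrib_right add.commute)
qed simp

lemma nn_integral_Icc_Ico:
  "(\<integral>\<^sup>+x. F x * indicator {c..a::real} x \<partial>lborel) = (\<integral>\<^sup>+x. F x * indicator {c..<a} x \<partial>lborel)"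
proof (rule nn_integral_cong_AE)
  have "AE x in lborel. x \<noteq> a" by (rule AE_lborel_singleton)
  then show "AE x in lborel. F x * indicator {c..a} x = F x * indicator {c..<a} x"
    by eventually_elim (auto simp: indicator_def)
qed

text \<open>The substitution covers n periods, and the Jacobian n cancels their number.\<close>

lemma nn_integral_scale_period:
  fixes F :: "real \<Rightarrow> ennreal"
  assumes [measurable]: "F \<in> borel_measurable borel" and per: "\<And>x. F (x + 2*pi) = F x" and n: "0 < n"
  shows "(\<integral>\<^sup>+x. F (real n * x) * indicator {0..2*pi} x \<partial>lborel) = (\<integral>\<^sup>+x. F x * indicator {0..2*pi} x \<partial>lborel)"
proof -
  have "of_nat n * (\<integral>\<^sup>+x. F x * indicator {0..<2*pi} x \<partial>lborel) = (\<integral>\<^sup>+x. F x * indicator {0..<2*pi*real n} x \<partial>lborel)"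
    by (simp add: nn_integral_periods per)
  also have "\<dots> = ennreal (real n) * (\<integral>\<^sup>+x. F (real n * x) * indicator {0..<2*pi*real n} (real n * x) \<partial>lborel)"
    using nn_integral_real_affine[of "\<lambda>x. F x * indicator {0..<2*pi*real n} x" "real n" 0] n by simp
  also have "(\<integral>\<^sup>+x. F (real n * x) * indicator {0..<2*pi*real n} (real n * x) \<partial>lborel)
     = (\<integral>\<^sup>+x. F (real n * x) * indicator {0..<2*pi} x \<partial>lborel)"
    using n by (intro nn_integral_cong) (auto simp: indicator_def zero_le_mult_iff mult.commute)
  finally have "of_nat n * (\<integral>\<^sup>+x. F x * indicator {0..<2*pi} x \<partial>lborel)
     = of_nat n * (\<integral>\<^sup>+x. F (real n * x) * indicator {0..<2*pi} x \<partial>lborel)"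
    by (simp add: ennreal_of_nat_eq_real_of_nat)
  then show ?thesis using n unfolding nn_integral_Icc_Ico
    by (simp add: ennreal_mult_cancel_left)
qed

lemma Lp_pow_scale:
  assumes [measurable]: "H \<in> borel_measurable borel" and per: "periodic2pi H" and n: "0 < n"
  shows "Lp_pow p (\<lambda>x. H (real n * x)) = Lp_pow p H"
  unfolding Lp_pow_def nn_integral_completion
  using nn_integral_scale_period[of "\<lambda>x. ennreal (cmod (H x) powr p)" n] per n by (simp add: periodic2pi_def)

text \<open>Multiplying angles by n lengthens chords at most n times, so the kernel may be evaluated
  at the multiplied angles at the cost n^(1 + \<sigma> p); periodicity then undoes the substitution
  in each variable separately.\<close>

lemma Gag_pow_scale_le:
  assumes H[measurable]: "H \<in> borel_measurable borel" and per: "periodic2pi H" and n: "0 < n" and e: "0 < 1 + \<sigma> * p"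
  shows "Gag_pow \<sigma> p (\<lambda>x. H (real n * x)) \<le> ennreal (real n powr (1 + \<sigma> * p)) * Gag_pow \<sigma> p H"
proof -
  let ?k = "\<lambda>x y. ennreal (cmod (H x - H y) powr p / cmod (cis x - cis y) powr (1 + \<sigma> * p))"
  note [measurable] = cis_measurable
  have perH: "H (x + 2*pi) = H x" for x using per by (simp add: periodic2pi_def)
  have perc: "cis (x + 2*pi) = cis x" for x by (simp add: cis.ctr)
  have pw: "ennreal (cmod (H (real n * x) - H (real n * y)) powr p / cmod (cis x - cis y) powr (1 + \<sigma> * p))
     \<le> ennreal (real n powr (1 + \<sigma> * p)) * ?k (real n * x) (real n * y)" for x y
  \<comment> \<open>If the multiplied angles coincide on the circle, the chord in the right hand
    kernel is 0, but by periodicity the numerator on the left vanishes too.\<close>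
  proof (cases "cis (real n * x) = cis (real n * y)")
    case True
    then have "H (real n * x) = H (real n * y)" by (rule cis_eq_periodic[OF per])
    then show ?thesis by simp
  next
    case False
    then have "cis x \<noteq> cis y" using Complex.DeMoivre[of x n] Complex.DeMoivre[of y n] by auto
    then have c: "cmod (cis x - cis y) > 0" by simp
    have "cmod (cis (real n * x) - cis (real n * y)) \<le> real n * cmod (cis x - cis y)"
      using norm_power_diff[of "cis x" "cis y" n] by (simp add: Complex.DeMoivre)
    then have "cmod (cis (real n * x) - cis (real n * y)) powr (1 + \<sigma> * p) \<le> real n powr (1 + \<sigma> * p) * cmod (cis x - cis y) powr (1 + \<sigma> * p)"
      using e by (subst powr_mult[symmetric]) (auto intro!: powr_mono2)
    then have "1 / cmod (cis x - cis y) powr (1 + \<sigma> * p) \<le> real n powr (1 + \<sigma> * p) / cmod (cis (real n * x) - cis (real n * y)) powr (1 + \<sigma> * p)"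
      using False c by (simp add: field_simps)
    from mult_left_mono[OF this, of "cmod (H (real n * x) - H (real n * y)) powr p"]
    show ?thesis by (simp add: ennreal_mult'[symmetric] ennreal_leI mult_ac)
  qed
  define J where "J = (\<lambda>x. \<integral>\<^sup>+y. ?k x y * indicator {0..2*pi} y \<partial>lborel)"
  have Jm [measurable]: "J \<in> borel_measurable borel" unfolding J_def by measurable
  have Jp: "J (x + 2*pi) = J x" for x unfolding J_def perH perc ..
  have inner: "(\<integral>\<^sup>+y. ?k (real n * x) (real n * y) * indicator {0..2*pi} y \<partial>lborel) = J (real n * x)" for x
    unfolding J_def by (rule nn_integral_scale_period[of "\<lambda>y. ?k (real n * x) y" n]) (simp_all add: perH perc n)
  have "Gag_pow \<sigma> p (\<lambda>x. H (real n * x))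
    \<le> (\<integral>\<^sup>+x. (\<integral>\<^sup>+y. ennreal (real n powr (1 + \<sigma> * p)) * (?k (real n * x) (real n * y) * indicator {0..2*pi} y) \<partial>lborel) * indicator {0..2*pi} x \<partial>lborel)"
    unfolding Gag_pow_def nn_integral_completion
    by (intro nn_integral_mono mult_right_mono) (use pw in \<open>auto simp: indicator_def\<close>)
  also have "\<dots> = (\<integral>\<^sup>+x. ennreal (real n powr (1 + \<sigma> * p)) * (J (real n * x) * indicator {0..2*pi} x) \<partial>lborel)"
    by (subst nn_integral_cmult, measurable) (simp add: inner mult.assoc)
  also have "\<dots> = ennreal (real n powr (1 + \<sigma> * p)) * (\<integral>\<^sup>+x. J x * indicator {0..2*pi} x \<partial>lborel)"
    using nn_integral_scale_period[OF Jm Jp n] by (subst nn_integral_cmult) auto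
  also have "(\<integral>\<^sup>+x. J x * indicator {0..2*pi} x \<partial>lborel) = Gag_pow \<sigma> p H"
    unfolding Gag_pow_def nn_integral_completion J_def ..
  finally show ?thesis .
qed

subsection \<open>Lower bounds on one interval\<close>

text \<open>Otherwise \<open>|P|\<^sup>2 - 1\<close>, of degree at most 2k, would change sign 2k + 1 times.\<close>
lemma alternation_far_from_poly:
  fixes c v :: "nat \<Rightarrow> complex" and y :: "nat \<Rightarrow> real"
  assumes inc: "\<And>j. j \<le> 2*k \<Longrightarrow> y j < y (Suc j)"
    and val: "\<And>j. j \<le> 2*k+1 \<Longrightarrow> cmod (v j) = (if even (m + j) then 0 else 2)"
  shows "\<exists>j\<le>2*k+1. 1/2 \<le> cmod (v j - (\<Sum>i\<le>k. c i * of_real (y j - t) ^ i))"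
proof (rule ccontr)
  assume "\<not> ?thesis"
  then have near: "cmod (v j - (\<Sum>i\<le>k. c i * of_real (y j - t) ^ i)) < 1/2" if "j \<le> 2*k+1" for j
    using that by force
  define P where "P = (\<lambda>x::real. \<Sum>i\<le>k. c i * of_real (x - t) ^ i)"
  define A where "A = (\<Sum>i\<le>k. smult (Re (c i)) ([:-t, 1:] ^ i))"
  define B where "B = (\<Sum>i\<le>k. smult (Im (c i)) ([:-t, 1:] ^ i))"
  \<comment> \<open>P has complex coefficients, but on the real line |P|^2 is the real polynomial
    A^2 + B^2, to which root counting applies.\<close>
  define Q where "Q = A * A + B * B - 1"
  have A: "poly A x = Re (P x)" and B: "poly B x = Im (P x)" for x
    by (simp_all add: A_def B_def P_def poly_sum del: of_real_diff flip: of_real_power)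
  have Q: "poly Q x = (cmod (P x))\<^sup>2 - 1" for x
    unfolding cmod_power2 by (simp add: Q_def A B power2_eq_square)
  have dlin: "degree ([:-t, 1:] ^ i) \<le> i" for i
    using degree_power_le[of "[:-t, 1:]" i] by simp
  have dA: "degree A \<le> k" unfolding A_def
    by (intro degree_sum_le) (auto intro!: order_trans[OF degree_smult_le] order_trans[OF dlin])
  have dB: "degree B \<le> k" unfolding B_def
    by (intro degree_sum_le) (auto intro!: order_trans[OF degree_smult_le] order_trans[OF dlin])
  have "degree (A * A) \<le> 2*k" "degree (B * B) \<le> 2*k"
    using degree_mult_le[of A A] degree_mult_le[of B B] dA dB by auto
  then have dQ: "degree Q \<le> 2*k"
    unfolding Q_def by (intro degree_diff_le degree_add_le) auto
  \<comment> \<open>Closeness 1/2 to values of modulus 0 and 2 forces |P| < 1/2 and |P| > 3/2, on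
    opposite sides of 1.\<close>
  have neg: "poly Q (y j) < 0" if "j \<le> 2*k+1" "even (m + j)" for j
  proof -
    have "v j = 0" using val[OF that(1)] that(2) by simp
    then have "cmod (P (y j)) < 1/2" using near[OF that(1)] by (simp add: P_def)
    then have "(cmod (P (y j)))\<^sup>2 < (1/2)\<^sup>2" by (intro power_strict_mono) auto
    then show ?thesis by (simp add: Q power2_eq_square)
  qed
  have pos: "poly Q (y j) > 0" if "j \<le> 2*k+1" "odd (m + j)" for j
  proof -
    have "cmod (v j) = 2" using val[OF that(1)] that(2) by simp
    then have "cmod (P (y j)) > 3/2" using near[OF that(1)] norm_triangle_ineq2[of "v j" "P (y j)"] by (simp add: P_def)
    then have "(3/2)\<^sup>2 < (cmod (P (y j)))\<^sup>2" by (intro power_strict_mono) auto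
    then show ?thesis by (simp add: Q power2_eq_square)
  qed
  have "\<exists>x>y j. x < y (Suc j) \<and> poly Q x = 0" if "j \<le> 2*k" for j
  proof (rule poly_IVT[OF inc[OF that]])
    show "poly Q (y j) * poly Q (y (Suc j)) < 0"
      using neg[of j] neg[of "Suc j"] pos[of j] pos[of "Suc j"] that
      by (cases "even (m + j)") (auto simp: mult_less_0_iff)
  qed
  then obtain r where r: "\<And>j. j \<le> 2*k \<Longrightarrow> y j < r j \<and> r j < y (Suc j) \<and> poly Q (r j) = 0" by metis
  have ymono: "i \<le> j \<Longrightarrow> j \<le> 2*k+1 \<Longrightarrow> y i \<le> y j" for i j
  proof (induction j)
    case (Suc j)
    show ?case
    proof (cases "i = Suc j")
      case False
      then have "y i \<le> y j" using Suc by simp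
      also have "y j \<le> y (Suc j)" using inc[of j] Suc.prems by simp
      finally show ?thesis .
    qed simp
  qed simp
  have rmono: "r i < r j" if "i < j" "j \<le> 2*k" for i j
  proof -
    have "r i < y (Suc i)" using r[of i] that by simp
    also have "y (Suc i) \<le> y j" using ymono that by simp
    also have "y j < r j" using r that by simp
    finally show ?thesis .
  qed
  have "inj_on r {..2*k}"
    using rmono by (auto simp: inj_on_def) (metis linorder_neqE_nat less_irrefl)
  then have "card (r ` {..2*k}) = 2*k + 1" by (simp add: card_image)
  moreover have "Q \<noteq> 0" using neg[of 0] pos[of 0] by (cases "even m") auto
  then have "card {x. poly Q x = 0} \<le> degree Q" "finite {x. poly Q x = 0}"
    by (simp_all add: card_poly_roots_bound poly_roots_finite)
  moreover have "r ` {..2*k} \<subseteq> {x. poly Q x = 0}" using r by auto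
  ultimately show False using dQ card_mono[of "{x. poly Q x = 0}" "r ` {..2*k}"] by simp
qed

text \<open>For any constant e, the Taylor polynomial of degree k - 1 at a plus e (x - a)^k / k! has
  degree at most k, so it misses the alternating function by 1/2 at some y j. That error is exactly
  the Taylor remainder with \<open>D k\<close> replaced by \<open>D k - e\<close>. The freedom in e
  serves both energies: e = 0 for L^p, and e a value of \<open>D k\<close> for the double
  integral.\<close>

lemma alternation_integral_ge:
  fixes D :: "nat \<Rightarrow> real \<Rightarrow> complex"
  assumes D: "\<And>k t. (D k has_vector_derivative D (Suc k) t) (at t)" and k: "1 \<le> k"
    and inc: "\<And>j. j \<le> 2*k \<Longrightarrow> y j < y (Suc j)" and ab: "\<And>j. j \<le> 2*k+1 \<Longrightarrow> y j \<in> {a..b}"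
    and val: "\<And>j. j \<le> 2*k+1 \<Longrightarrow> cmod (D 0 (y j)) = (if even (m + j) then 0 else 2)"
  shows "1/2 \<le> (b - a) ^ (k - 1) * integral {a..b} (\<lambda>x. cmod (D k x - e))"
proof -
  define c where "c = (\<lambda>i. (if i < k then D i a else e) / fact i)"
  obtain j where j: "j \<le> 2*k+1" "1/2 \<le> cmod (D 0 (y j) - (\<Sum>i\<le>k. c i * of_real (y j - a) ^ i))"
    using alternation_far_from_poly[of k y "\<lambda>j. D 0 (y j)" m c a] inc val by blast
  define z where "z = y j"
  have z: "a \<le> z" "z \<le> b" using ab[OF j(1)] by (auto simp: z_def)
  have sm: "smooth (D k)" by (rule derivs_imp_smooth[of D]) (rule D)
  define w where "w = (\<lambda>x. (z - x) ^ (k - 1) / fact (k - 1))"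
  have 1: "((\<lambda>x. w x *\<^sub>R D k x) has_integral D 0 z - (\<Sum>i<k. ((z - a) ^ i / fact i) *\<^sub>R D i a)) {a..z}"
    unfolding w_def using k z D
    by (intro Taylor_has_integral[of k D "D 0"]) (auto intro: has_vector_derivative_at_within)
  \<comment> \<open>The Taylor weight w has antiderivative -(z - x)^k / k!, so integrating it
    against e yields the top term of the comparison polynomial.\<close>
  have 2: "((\<lambda>x. w x *\<^sub>R e) has_integral (- ((z - z) ^ k / fact k) *\<^sub>R e) - (- ((z - a) ^ k / fact k) *\<^sub>R e)) {a..z}"
  proof (rule fundamental_theorem_of_calculus[OF z(1)])
    fix x assume "x \<in> {a..z}"
    have "((\<lambda>x. - ((z - x) ^ k / fact k)) has_real_derivative w x) (at x within {a..z})"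
    proof -
      have "fact k = real k * fact (k - 1)" using k by (simp add: fact_reduce)
      then show ?thesis unfolding w_def using k
        by (auto intro!: derivative_eq_intros simp: divide_simps)
    qed
    then show "((\<lambda>x. - ((z - x) ^ k / fact k) *\<^sub>R e) has_vector_derivative w x *\<^sub>R e) (at x within {a..z})"
      by (intro has_vector_derivative_scaleR[where g'=0, simplified] ) auto
  qed
  have eqP: "(\<Sum>i\<le>k. c i * of_real (z - a) ^ i) = (\<Sum>i<k. ((z - a) ^ i / fact i) *\<^sub>R D i a) + ((z - a) ^ k / fact k) *\<^sub>R e"
  proof -
    have "(\<Sum>i\<le>k. c i * of_real (z - a) ^ i) = (\<Sum>i<k. c i * of_real (z - a) ^ i) + c k * of_real (z - a) ^ k"
      by (simp add: lessThan_Suc_atMost[symmetric])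
    also have "(\<Sum>i<k. c i * of_real (z - a) ^ i) = (\<Sum>i<k. ((z - a) ^ i / fact i) *\<^sub>R D i a)"
      by (intro sum.cong) (auto simp: c_def scaleR_conv_of_real)
    also have "c k * of_real (z - a) ^ k = ((z - a) ^ k / fact k) *\<^sub>R e"
      by (simp add: c_def scaleR_conv_of_real)
    finally show ?thesis .
  qed
  have 3: "((\<lambda>x. w x *\<^sub>R (D k x - e)) has_integral D 0 z - (\<Sum>i\<le>k. c i * of_real (z - a) ^ i)) {a..z}"
    using has_integral_diff[OF 1 2] k unfolding eqP by (simp add: scaleR_diff_right diff_diff_eq power_0_left)
  have ci: "continuous_on S (\<lambda>x. cmod (D k x - e))" for S
    by (intro continuous_intros smooth_continuous_on sm)
  have "cmod (D 0 z - (\<Sum>i\<le>k. c i * of_real (z - a) ^ i)) = cmod (integral {a..z} (\<lambda>x. w x *\<^sub>R (D k x - e)))"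
    using 3 by (simp add: integral_unique)
  also have "\<dots> \<le> integral {a..z} (\<lambda>x. (b - a) ^ (k - 1) * cmod (D k x - e))"
  proof (rule integral_norm_bound_integral)
    show "(\<lambda>x. w x *\<^sub>R (D k x - e)) integrable_on {a..z}" using 3 by blast
    show "(\<lambda>x. (b - a) ^ (k - 1) * cmod (D k x - e)) integrable_on {a..z}"
      by (intro integrable_continuous_interval continuous_on_mult_left ci)
    fix x assume x: "x \<in> {a..z}"
    have "\<bar>w x\<bar> = (z - x) ^ (k - 1) / fact (k - 1)" using x by (simp add: w_def)
    also have "\<dots> \<le> (z - x) ^ (k - 1) / 1" using x by (intro divide_left_mono) auto
    also have "\<dots> \<le> (b - a) ^ (k - 1)" using x z by (simp add: power_mono)
    finally show "cmod (w x *\<^sub>R (D k x - e)) \<le> (b - a) ^ (k - 1) * cmod (D k x - e)"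
      by (simp add: mult_right_mono)
  qed
  also have "\<dots> \<le> integral {a..b} (\<lambda>x. (b - a) ^ (k - 1) * cmod (D k x - e))"
    using z by (intro integral_subset_le integrable_continuous_interval continuous_on_mult_left ci) auto
  also have "\<dots> = (b - a) ^ (k - 1) * integral {a..b} (\<lambda>x. cmod (D k x - e))" by simp
  finally show ?thesis using j(2) by (simp add: z_def)
qed

lemma nn_integral_continuous_Icc:
  fixes g :: "real \<Rightarrow> real"
  assumes "continuous_on {a..b} g" "\<And>x. x \<in> {a..b} \<Longrightarrow> 0 \<le> g x"
  shows "(\<integral>\<^sup>+x. ennreal (g x) * indicator {a..b} x \<partial>lborel) = ennreal (integral {a..b} g)"
proof -
  have "(g has_integral integral {a..b} g) {a..b}"
    using assms(1) integrable_continuous_interval by blast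
  from nn_integral_has_integral_lebesgue[OF assms(2) this]
  have "(\<integral>\<^sup>+x. ennreal (indicator {a..b} x * g x) \<partial>lborel) = ennreal (integral {a..b} g)" by simp
  moreover have "ennreal (indicator {a..b} x * g x) = ennreal (g x) * indicator {a..b} x" for x
    by (auto simp: indicator_def)
  ultimately show ?thesis by simp
qed

text \<open>A linear quantity is traded for a p-th power at a threshold l: above l, the ratio t^(p -
  1) / l^(p - 1) is at least 1. Choosing l afterwards plays the part of Hoelder's
  inequality.\<close>

lemma le_add_powr:
  fixes t l p :: real assumes "0 \<le> t" "0 < l" "1 \<le> p"
  shows "t \<le> l + l powr (1 - p) * t powr p"
proof (cases "t \<le> l")
  case True then show ?thesis by (simp add: add_increasing2)
next
  case False
  have "l powr (p - 1) \<le> t powr (p - 1)" using False assms by (intro powr_mono2) auto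
  then have "t * l powr (p - 1) \<le> t * t powr (p - 1)" using assms by (intro mult_left_mono) auto
  also have "t * t powr (p - 1) = t powr p" using False assms by (simp add: powr_mult_base)
  finally have "t \<le> t powr p / l powr (p - 1)" using assms by (simp add: field_simps)
  also have "\<dots> = l powr (1 - p) * t powr p" using powr_minus[of l "p - 1"] by (simp add: field_simps)
  finally show ?thesis using assms by simp
qed

lemma Holder_lower:
  fixes g :: "real \<Rightarrow> real"
  assumes [measurable]: "g \<in> borel_measurable borel" and g: "\<And>x. 0 \<le> g x" and p: "1 \<le> p" and M: "0 < M" and ab: "a < b"
    and le: "ennreal M \<le> (\<integral>\<^sup>+x. ennreal (g x) * indicator {a..b} x \<partial>lborel)"
  shows "ennreal ((M/2) powr p * (b - a) powr (1 - p)) \<le> (\<integral>\<^sup>+x. ennreal (g x powr p) * indicator {a..b} x \<partial>lborel)"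
proof (cases "(\<integral>\<^sup>+x. ennreal (g x powr p) * indicator {a..b} x \<partial>lborel)" rule: ennreal_cases)
  case (real X)
  define l where "l = b - a"
  have l: "l > 0" using ab by (simp add: l_def)
  \<comment> \<open>The threshold for which the linear part integrates to M / 2, leaving the other
    half to the p-th powers.\<close>
  define \<mu> where "\<mu> = M / (2 * l)"
  have \<mu>: "\<mu> > 0" using M l by (simp add: \<mu>_def)
  have "ennreal M \<le> (\<integral>\<^sup>+x. ennreal \<mu> * indicator {a..b} x + ennreal (\<mu> powr (1 - p)) * (ennreal (g x powr p) * indicator {a..b} x) \<partial>lborel)"
    by (intro order_trans[OF le] nn_integral_mono)
      (use le_add_powr[OF g \<mu> p] \<mu> in \<open>auto simp: indicator_def ennreal_mult'[symmetric] ennreal_plus[symmetric] simp del: ennreal_plus intro!: ennreal_leI\<close>)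
  also have "\<dots> = ennreal \<mu> * ennreal l + ennreal (\<mu> powr (1 - p)) * ennreal X"
    using ab by (simp add: nn_integral_add nn_integral_cmult nn_integral_cmult_indicator real l_def)
  also have "\<dots> = ennreal (\<mu> * l + \<mu> powr (1 - p) * X)"
    using \<mu> l real by (simp add: ennreal_mult'[symmetric] ennreal_plus[symmetric] del: ennreal_plus)
  finally have "M \<le> \<mu> * l + \<mu> powr (1 - p) * X"
    using \<mu> l real by (subst (asm) ennreal_le_iff) (auto intro!: add_nonneg_nonneg mult_nonneg_nonneg)
  then have "M/2 \<le> \<mu> powr (1 - p) * X" using l by (simp add: \<mu>_def)
  then have "\<mu> powr (p - 1) * (M/2) \<le> \<mu> powr (p - 1) * (\<mu> powr (1 - p) * X)" by (intro mult_left_mono) auto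
  also have "\<dots> = X" using \<mu> by (simp add: mult.assoc[symmetric] powr_add[symmetric])
  also have "\<mu> powr (p - 1) * (M/2) = (M/2) powr p * l powr (1 - p)"
  proof -
    have "\<mu> powr (p - 1) = (M/2) powr (p - 1) * l powr (1 - p)"
    proof -
      have "\<mu> = M/2 / l" by (simp add: \<mu>_def)
      then have "\<mu> powr (p - 1) = (M/2) powr (p - 1) / l powr (p - 1)" using M l by (simp only: powr_divide)
      moreover have "l powr (1 - p) = inverse (l powr (p - 1))" by (simp add: powr_minus[symmetric])
      ultimately show ?thesis by (simp only: divide_inverse)
    qed
    moreover have "(M/2) powr (p - 1) * (M/2) = (M/2) powr p" using M powr_mult_base[of "M/2" "p - 1"] by (simp add: mult.commute)
    ultimately show ?thesis by (simp add: mult_ac)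
  qed
  finally show ?thesis using real by (simp add: l_def ennreal_leI)
qed simp

text \<open>The value \<sigma> = 0 encodes the L^p energy, so integer and fractional s share one
  argument. The distance is |x - y| instead of the chord, because the local estimates live on
  intervals.\<close>

definition loc_energy :: "real \<Rightarrow> real \<Rightarrow> real set \<Rightarrow> (real \<Rightarrow> complex) \<Rightarrow> ennreal" where
  "loc_energy \<sigma> p A v = (if \<sigma> > 0
     then \<integral>\<^sup>+x. (\<integral>\<^sup>+y. ennreal (cmod (v x - v y) powr p / \<bar>x - y\<bar> powr (1 + \<sigma> * p)) * indicator A y \<partial>lborel) * indicator A x \<partial>lborel
     else \<integral>\<^sup>+x. ennreal (cmod (v x) powr p) * indicator A x \<partial>lborel)"

lemma loc_energy_Ico: "loc_energy \<sigma> p {a..<b} v = loc_energy \<sigma> p {a..b} v"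
  unfolding loc_energy_def nn_integral_Icc_Ico ..

text \<open>The L^1 deviation of \<open>D k\<close> from every constant is at least l^(1 - k) / 2
  with l = b - a, so its L^p deviation has p-th power at least 4^(-p) l^(1 - k p). For \<sigma> > 0
  take for each x the constant \<open>D k x\<close>, bound |x - y| by l in the kernel and integrate
  over x; this contributes the remaining factor l^(-\<sigma> p).\<close>

lemma loc_energy_ge_of_alternation:
  fixes D :: "nat \<Rightarrow> real \<Rightarrow> complex"
  assumes D: "\<And>k t. (D k has_vector_derivative D (Suc k) t) (at t)" and k: "1 \<le> k" and lt: "a < b"
    and inc: "\<And>j. j \<le> 2*k \<Longrightarrow> y j < y (Suc j)" and ab: "\<And>j. j \<le> 2*k+1 \<Longrightarrow> y j \<in> {a..b}"
    and val: "\<And>j. j \<le> 2*k+1 \<Longrightarrow> cmod (D 0 (y j)) = (if even (m + j) then 0 else 2)"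
    and \<sigma>: "0 \<le> \<sigma>" and p: "1 \<le> p"
  shows "ennreal ((1/4) powr p * (b - a) powr (1 - (real k + \<sigma>) * p)) \<le> loc_energy \<sigma> p {a..b} (D k)"
proof -
  define l where "l = b - a"
  have l: "l > 0" using lt by (simp add: l_def)
  have sm: "smooth (D k)" by (rule derivs_imp_smooth[of D]) (rule D)
  have [measurable]: "D k \<in> borel_measurable borel" using smooth_measurable[OF sm] .
  define M where "M = l powr (1 - real k) / 2"
  have M: "M > 0" using l by (simp add: M_def)
  have dev: "ennreal ((1/4) powr p * l powr (1 - real k * p)) \<le> (\<integral>\<^sup>+x. ennreal (cmod (D k x - e) powr p) * indicator {a..b} x \<partial>lborel)" for e
  proof -
    have "1/2 \<le> l ^ (k - 1) * integral {a..b} (\<lambda>x. cmod (D k x - e))"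
      unfolding l_def by (rule alternation_integral_ge[OF D k inc ab val])
    moreover have "l ^ (k - 1) = l powr (real k - 1)" using l k by (simp add: powr_realpow[symmetric] of_nat_diff)
    moreover have "l powr (1 - real k) = inverse (l powr (real k - 1))" using powr_minus[of l "real k - 1"] by simp
    ultimately have *: "1/2 \<le> l powr (real k - 1) * integral {a..b} (\<lambda>x. cmod (D k x - e))"
      and **: "l powr (1 - real k) * l powr (real k - 1) = 1" using l by auto
    have "M \<le> l powr (1 - real k) * (l powr (real k - 1) * integral {a..b} (\<lambda>x. cmod (D k x - e)))"
      using mult_left_mono[OF *, of "l powr (1 - real k)"] by (simp add: M_def)
    then have "M \<le> integral {a..b} (\<lambda>x. cmod (D k x - e))" by (simp add: mult.assoc[symmetric] **)
    then have "ennreal M \<le> (\<integral>\<^sup>+x. ennreal (cmod (D k x - e)) * indicator {a..b} x \<partial>lborel)"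
      by (subst nn_integral_continuous_Icc) (auto intro!: continuous_on_norm continuous_on_diff continuous_on_const smooth_continuous_on[OF sm] ennreal_leI)
    from Holder_lower[OF _ _ p M lt this]
    have "ennreal ((M/2) powr p * l powr (1 - p)) \<le> (\<integral>\<^sup>+x. ennreal (cmod (D k x - e) powr p) * indicator {a..b} x \<partial>lborel)"
      by (simp add: l_def)
    moreover have "(M/2) powr p * l powr (1 - p) = (1/4) powr p * l powr (1 - real k * p)"
    proof -
      have "M/2 = 1/4 * l powr (1 - real k)" by (simp add: M_def)
      then have "(M/2) powr p = (1/4) powr p * l powr ((1 - real k) * p)" by (simp only: powr_mult powr_powr)
      then have "(M/2) powr p * l powr (1 - p) = (1/4) powr p * l powr ((1 - real k) * p + (1 - p))"
        by (simp add: powr_add mult.assoc)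
      also have "(1 - real k) * p + (1 - p) = 1 - real k * p" by (simp add: algebra_simps)
      finally show ?thesis .
    qed
    ultimately show ?thesis by simp
  qed
  show ?thesis
  proof (cases "\<sigma> > 0")
    case False
    then show ?thesis using dev[of 0] \<sigma> by (simp add: loc_energy_def l_def)
  next
    case True
    have e: "1 + \<sigma> * p > 0" using True p by (simp add: add_pos_pos)
    define K where "K = (1/4) powr p * l powr (1 - real k * p)"
    have K: "K \<ge> 0" by (simp add: K_def)
    have inner: "ennreal (l powr (- (1 + \<sigma> * p)) * K) \<le> (\<integral>\<^sup>+y. ennreal (cmod (D k x - D k y) powr p / \<bar>x - y\<bar> powr (1 + \<sigma> * p)) * indicator {a..b} y \<partial>lborel)"
      if x: "x \<in> {a..b}" for x
    proof -
      have "ennreal (l powr (- (1 + \<sigma> * p)) * K) = ennreal (l powr (- (1 + \<sigma> * p))) * ennreal K" by (simp add: ennreal_mult')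
      also have "\<dots> \<le> ennreal (l powr (- (1 + \<sigma> * p))) * (\<integral>\<^sup>+y. ennreal (cmod (D k y - D k x) powr p) * indicator {a..b} y \<partial>lborel)"
        unfolding K_def by (intro mult_left_mono dev) auto
      also have "\<dots> = (\<integral>\<^sup>+y. ennreal (l powr (- (1 + \<sigma> * p))) * (ennreal (cmod (D k y - D k x) powr p) * indicator {a..b} y) \<partial>lborel)"
        by (rule nn_integral_cmult[symmetric]) measurable
      also have "\<dots> \<le> (\<integral>\<^sup>+y. ennreal (cmod (D k x - D k y) powr p / \<bar>x - y\<bar> powr (1 + \<sigma> * p)) * indicator {a..b} y \<partial>lborel)"
      proof (intro nn_integral_mono)
        fix y
        have "l powr (- (1 + \<sigma> * p)) * cmod (D k x - D k y) powr p \<le> cmod (D k x - D k y) powr p / \<bar>x - y\<bar> powr (1 + \<sigma> * p)" if y: "y \<in> {a..b}"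
        proof (cases "x = y")
          case False
          have "\<bar>x - y\<bar> powr (1 + \<sigma> * p) \<le> l powr (1 + \<sigma> * p)" using x y e by (intro powr_mono2) (auto simp: l_def)
          then have "cmod (D k x - D k y) powr p / l powr (1 + \<sigma> * p) \<le> cmod (D k x - D k y) powr p / \<bar>x - y\<bar> powr (1 + \<sigma> * p)"
            using False l by (intro divide_left_mono mult_pos_pos) auto
          then show ?thesis unfolding powr_minus[of l "1 + \<sigma> * p"] by (simp only: divide_inverse mult.commute)
        qed (use p in simp)
        then show "ennreal (l powr (- (1 + \<sigma> * p))) * (ennreal (cmod (D k y - D k x) powr p) * indicator {a..b} y)
           \<le> ennreal (cmod (D k x - D k y) powr p / \<bar>x - y\<bar> powr (1 + \<sigma> * p)) * indicator {a..b} y"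
          by (auto simp: indicator_def ennreal_mult'[symmetric] norm_minus_commute intro!: ennreal_leI)
      qed
      finally show ?thesis .
    qed
    have "ennreal (l powr (- (1 + \<sigma> * p)) * K) * ennreal l = (\<integral>\<^sup>+x. ennreal (l powr (- (1 + \<sigma> * p)) * K) * indicator {a..b} x \<partial>lborel)"
      using lt by (simp add: nn_integral_cmult_indicator l_def)
    also have "\<dots> \<le> loc_energy \<sigma> p {a..b} (D k)"
      unfolding loc_energy_def using True inner by (auto intro!: nn_integral_mono simp: indicator_def)
    finally have "ennreal (l powr (- (1 + \<sigma> * p)) * K * l) \<le> loc_energy \<sigma> p {a..b} (D k)"
      using K l by (simp add: ennreal_mult'[symmetric])
    moreover have "l powr (- (1 + \<sigma> * p)) * K * l = (1/4) powr p * l powr (1 - (real k + \<sigma>) * p)"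
    proof -
      have "l powr (- (1 + \<sigma> * p)) * l powr (1 - real k * p) * l powr 1 = l powr (1 - (real k + \<sigma>) * p)"
        unfolding powr_add[symmetric] by (simp add: algebra_simps)
      then show ?thesis using l by (simp add: K_def mult_ac)
    qed
    ultimately show ?thesis by (simp add: l_def)
  qed
qed

section \<open>Means over intervals and the fractional Morrey estimate\<close>

definition mean :: "real \<Rightarrow> real \<Rightarrow> (real \<Rightarrow> complex) \<Rightarrow> complex" where
  "mean u w f = integral {u..w} f /\<^sub>R (w - u)"

lemma mean_deviation:
  assumes "u < w" and f: "continuous_on UNIV f"
  shows "ennreal (cmod (mean u w f - e)) \<le> ennreal (1 / (w - u)) * (\<integral>\<^sup>+z. ennreal (cmod (f z - e)) * indicator {u..w} z \<partial>lborel)"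
proof -
  have c: "continuous_on {u..w} f" using f continuous_on_subset by blast
  have "integral {u..w} (\<lambda>z. f z - e) = integral {u..w} f - (w - u) *\<^sub>R e"
    using assms(1) c by (subst Henstock_Kurzweil_Integration.integral_diff) (auto intro!: integrable_continuous_interval)
  then have "mean u w f - e = integral {u..w} (\<lambda>z. f z - e) /\<^sub>R (w - u)"
    using assms(1) by (simp add: mean_def scaleR_diff_right)
  then have "cmod (mean u w f - e) = cmod (integral {u..w} (\<lambda>z. f z - e)) / (w - u)"
    using assms(1) by (simp add: divide_inverse mult.commute)
  also have "\<dots> \<le> integral {u..w} (\<lambda>z. cmod (f z - e)) / (w - u)"
    using assms(1) c by (intro divide_right_mono integral_norm_bound_integral integrable_continuous_interval continuous_intros) auto
  finally have "ennreal (cmod (mean u w f - e)) \<le> ennreal (1 / (w - u) * integral {u..w} (\<lambda>z. cmod (f z - e)))"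
    by (simp add: ennreal_leI)
  also have "\<dots> = ennreal (1 / (w - u)) * ennreal (integral {u..w} (\<lambda>z. cmod (f z - e)))"
    using assms(1) by (intro ennreal_mult') auto
  also have "ennreal (integral {u..w} (\<lambda>z. cmod (f z - e))) = (\<integral>\<^sup>+z. ennreal (cmod (f z - e)) * indicator {u..w} z \<partial>lborel)"
    using c by (subst nn_integral_continuous_Icc) (auto intro!: continuous_intros)
  finally show ?thesis .
qed

lemma mean_close:
  assumes "u < w" and f: "continuous_on UNIV f" and e: "\<And>z. z \<in> {u..w} \<Longrightarrow> cmod (f z - e) \<le> \<epsilon>" and "0 \<le> \<epsilon>"
  shows "cmod (mean u w f - e) \<le> \<epsilon>"
proof -
  have "(\<integral>\<^sup>+z. ennreal (cmod (f z - e)) * indicator {u..w} z \<partial>lborel) \<le> (\<integral>\<^sup>+z. ennreal \<epsilon> * indicator {u..w} z \<partial>lborel)"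
    by (intro nn_integral_mono) (use e in \<open>auto simp: indicator_def intro!: ennreal_leI\<close>)
  also have "\<dots> = ennreal (\<epsilon> * (w - u))" using assms(1,4) by (simp add: nn_integral_cmult_indicator ennreal_mult')
  finally have "ennreal (cmod (mean u w f - e)) \<le> ennreal (1 / (w - u)) * ennreal (\<epsilon> * (w - u))"
    using mean_deviation[OF assms(1) f, of e] by (meson mult_left_mono order_trans zero_le)
  also have "\<dots> = ennreal \<epsilon>" using assms(1,4) by (subst ennreal_mult'[symmetric]) auto
  finally show ?thesis using assms(4) by simp
qed

text \<open>The difference of the two means is at most the average of |f x - f y| over x in the
  smaller and y in the larger interval, and halving the length costs the factor 2. The free
  threshold \<mu> of \<open>le_add_powr\<close> lets a telescoping sum decide how fast the steps
  decay.\<close>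

lemma mean_step:
  fixes f :: "real \<Rightarrow> complex"
  assumes \<sigma>: "0 < \<sigma>" and p: "1 \<le> p" and f: "continuous_on UNIV f" and uw: "u < w" and sub: "u \<le> u'" "u' < w'" "w' \<le> w"
    and half: "w' - u' = (w - u) / 2" and J: "a \<le> u" "w \<le> b" and E: "loc_energy \<sigma> p {a..b} f = ennreal E" "0 \<le> E" and \<mu>: "0 < \<mu>"
  shows "cmod (mean u' w' f - mean u w f) \<le> 2 * (\<mu> + \<mu> powr (1 - p) * (w - u) powr (\<sigma> * p - 1) * E)"
proof -
  define l where "l = w - u"
  have l: "l > 0" using uw by (simp add: l_def)
  have [measurable]: "f \<in> borel_measurable borel" using f by (simp add: borel_measurable_continuous_onI)
  have e: "1 + \<sigma> * p > 0" using \<sigma> p by (simp add: add_pos_pos)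
  let ?K = "\<lambda>x y. ennreal (cmod (f x - f y) powr p / \<bar>x - y\<bar> powr (1 + \<sigma> * p))"
  have pw: "ennreal (cmod (f x - f y)) \<le> ennreal \<mu> + ennreal (\<mu> powr (1 - p) * l powr (1 + \<sigma> * p)) * ?K x y"
    if xy: "x \<in> {u..w}" "y \<in> {u..w}" for x y
  proof -
    have "cmod (f x - f y) \<le> \<mu> + \<mu> powr (1 - p) * cmod (f x - f y) powr p"
      by (rule le_add_powr[OF _ \<mu> p]) simp
    also have "cmod (f x - f y) powr p \<le> l powr (1 + \<sigma> * p) * (cmod (f x - f y) powr p / \<bar>x - y\<bar> powr (1 + \<sigma> * p))"
    proof (cases "x = y")
      case False
      have "\<bar>x - y\<bar> powr (1 + \<sigma> * p) \<le> l powr (1 + \<sigma> * p)" using xy e by (intro powr_mono2) (auto simp: l_def)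
      then have "cmod (f x - f y) powr p * \<bar>x - y\<bar> powr (1 + \<sigma> * p) \<le> cmod (f x - f y) powr p * l powr (1 + \<sigma> * p)"
        by (intro mult_left_mono) auto
      then show ?thesis using False by (simp add: field_simps)
    qed (use p in simp)
    finally have "cmod (f x - f y) \<le> \<mu> + \<mu> powr (1 - p) * l powr (1 + \<sigma> * p) * (cmod (f x - f y) powr p / \<bar>x - y\<bar> powr (1 + \<sigma> * p))"
      by (simp add: mult_left_mono mult.assoc)
    then have "ennreal (cmod (f x - f y)) \<le> ennreal (\<mu> + \<mu> powr (1 - p) * l powr (1 + \<sigma> * p) * (cmod (f x - f y) powr p / \<bar>x - y\<bar> powr (1 + \<sigma> * p)))"
      by (rule ennreal_leI)
    also have "\<dots> = ennreal \<mu> + ennreal (\<mu> powr (1 - p) * l powr (1 + \<sigma> * p)) * ?K x y"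
      using \<mu> by (subst ennreal_plus) (auto simp: ennreal_mult'[symmetric])
    finally show ?thesis .
  qed
  define G where "G = (\<lambda>x. \<integral>\<^sup>+y. ?K x y * indicator {a..b} y \<partial>lborel)"
  have [measurable]: "G \<in> borel_measurable borel" unfolding G_def by measurable
  have EG: "(\<integral>\<^sup>+x. G x * indicator {a..b} x \<partial>lborel) = ennreal E"
    using E(1) \<sigma> by (simp add: loc_energy_def G_def)
  define c where "c = \<mu> powr (1 - p) * l powr (1 + \<sigma> * p)"
  have c: "0 \<le> c" by (simp add: c_def)
  have inner: "(\<integral>\<^sup>+y. ennreal (cmod (f y - f x)) * indicator {u..w} y \<partial>lborel) \<le> ennreal (\<mu> * l) + ennreal c * G x" if x: "x \<in> {u..w}" for x
  proof -
    have "(\<integral>\<^sup>+y. ennreal (cmod (f y - f x)) * indicator {u..w} y \<partial>lborel)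
      \<le> (\<integral>\<^sup>+y. ennreal \<mu> * indicator {u..w} y + ennreal c * (?K x y * indicator {a..b} y) \<partial>lborel)"
      by (intro nn_integral_mono) (use pw[OF x] J in \<open>auto simp: indicator_def c_def norm_minus_commute\<close>)
    also have "\<dots> = (\<integral>\<^sup>+y. ennreal \<mu> * indicator {u..w} y \<partial>lborel) + (\<integral>\<^sup>+y. ennreal c * (?K x y * indicator {a..b} y) \<partial>lborel)"
      by (rule nn_integral_add) measurable
    also have "(\<integral>\<^sup>+y. ennreal c * (?K x y * indicator {a..b} y) \<partial>lborel) = ennreal c * G x"
      unfolding G_def by (rule nn_integral_cmult) measurable
    also have "(\<integral>\<^sup>+y. ennreal \<mu> * indicator {u..w} y \<partial>lborel) = ennreal (\<mu> * l)"
      using uw \<mu> by (simp add: nn_integral_cmult_indicator l_def ennreal_mult')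
    finally show ?thesis .
  qed
  define m where "m = mean u w f"
  have dm: "ennreal (cmod (f x - m)) \<le> ennreal (1 / l) * (ennreal (\<mu> * l) + ennreal c * G x)" if "x \<in> {u..w}" for x
  proof -
    have "ennreal (cmod (f x - m)) \<le> ennreal (1 / l) * (\<integral>\<^sup>+y. ennreal (cmod (f y - f x)) * indicator {u..w} y \<partial>lborel)"
      using mean_deviation[OF uw f, of "f x"] by (simp add: m_def norm_minus_commute l_def)
    also have "\<dots> \<le> ennreal (1 / l) * (ennreal (\<mu> * l) + ennreal c * G x)"
      using inner[OF that] by (intro mult_left_mono) auto
    finally show ?thesis .
  qed
  have "ennreal (cmod (mean u' w' f - m)) \<le> ennreal (1 / (w' - u')) * (\<integral>\<^sup>+x. ennreal (cmod (f x - m)) * indicator {u'..w'} x \<partial>lborel)"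
    by (rule mean_deviation[OF sub(2) f])
  also have "\<dots> \<le> ennreal (1 / (w' - u')) * (\<integral>\<^sup>+x. ennreal (1 / l) * (ennreal (\<mu> * l) * indicator {u..w} x + ennreal c * (G x * indicator {a..b} x)) \<partial>lborel)"
    by (intro mult_left_mono nn_integral_mono) (use dm sub J in \<open>auto simp: indicator_def\<close>)
  also have "(\<integral>\<^sup>+x. ennreal (1 / l) * (ennreal (\<mu> * l) * indicator {u..w} x + ennreal c * (G x * indicator {a..b} x)) \<partial>lborel)
     = ennreal (1 / l) * (ennreal (\<mu> * l) * ennreal l + ennreal c * ennreal E)"
    using uw by (subst nn_integral_cmult_add) (simp_all add: nn_integral_cmult_indicator nn_integral_cmult EG l_def)
  also have "ennreal (1 / (w' - u')) * (ennreal (1 / l) * (ennreal (\<mu> * l) * ennreal l + ennreal c * ennreal E))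
     = ennreal (2 / l * (1 / l * (\<mu> * l * l + c * E)))"
  proof -
    have "1 / (w' - u') = 2 / l" unfolding half l_def by simp
    moreover have "ennreal (\<mu> * l) * ennreal l + ennreal c * ennreal E = ennreal (\<mu> * l * l + c * E)"
      using \<mu> l c E(2) by (simp add: ennreal_mult'[symmetric])
    moreover have "ennreal (1 / l) * ennreal (\<mu> * l * l + c * E) = ennreal (1 / l * (\<mu> * l * l + c * E))"
      using l by (subst ennreal_mult'[symmetric]) auto
    moreover have "ennreal (2 / l) * ennreal (1 / l * (\<mu> * l * l + c * E)) = ennreal (2 / l * (1 / l * (\<mu> * l * l + c * E)))"
      using l by (subst ennreal_mult'[symmetric]) auto
    ultimately show ?thesis by simp
  qed
  finally have "cmod (mean u' w' f - m) \<le> 2 / l * (1 / l * (\<mu> * l * l + c * E))"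
    using \<mu> l c E(2) by (subst (asm) ennreal_le_iff) auto
  also have "\<dots> = 2 * (\<mu> + c / (l * l) * E)" using l by (simp add: field_simps)
  also have "c / (l * l) = \<mu> powr (1 - p) * l powr (\<sigma> * p - 1)"
  proof -
    have "l powr (1 + \<sigma> * p) = l powr (\<sigma> * p - 1) * l powr 2" by (simp add: powr_add[symmetric] add.commute)
    also have "l powr 2 = l * l" using l by (simp add: power2_eq_square)
    finally show ?thesis using l by (simp add: c_def)
  qed
  finally show ?thesis by (simp add: m_def l_def)
qed

text \<open>Fractional Morrey estimate: telescope the means over the intervals \<open>z + 2^(-n) (J - z)\<close>.\<close>
lemma Morrey_point:
  fixes f :: "real \<Rightarrow> complex"
  assumes \<sigma>: "0 < \<sigma>" and p: "1 \<le> p" and sp: "1 < \<sigma> * p" and f: "continuous_on UNIV f" and ab: "a < b" and z: "z \<in> {a..b}"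
    and E: "loc_energy \<sigma> p {a..b} f = ennreal E" "0 \<le> E" and \<eta>: "0 < \<eta>"
    and r: "r = 2 powr (- ((\<sigma> * p - 1) / p))"
  shows "cmod (f z - mean a b f) \<le> 2 * (\<eta> + \<eta> powr (1 - p) * ((b - a) powr (\<sigma> * p - 1) * E)) / (1 - r)"
proof -
  have r01: "0 < r" "r < 1" using sp p by (auto simp: r powr_less_one intro!: powr_less_one divide_pos_pos)
  define u where "u = (\<lambda>n::nat. z - (1/2)^n * (z - a))"
  define w where "w = (\<lambda>n::nat. z + (1/2)^n * (b - z))"
  define A where "A = (\<lambda>n. mean (u n) (w n) f)"
  define X where "X = 2 * (\<eta> + \<eta> powr (1 - p) * ((b - a) powr (\<sigma> * p - 1) * E))"
  have X: "0 \<le> X" unfolding X_def using \<eta> E by (intro mult_nonneg_nonneg add_nonneg_nonneg) auto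
  have len: "w n - u n = (1/2)^n * (b - a)" for n by (simp add: u_def w_def algebra_simps)
  have lt: "u n < w n" for n
  proof -
    have "0 < (1/2::real)^n * (b - a)" using ab by simp
    then show ?thesis using len[of n] by linarith
  qed
  have au: "a \<le> u n" "w n \<le> b" for n
  proof -
    have "(1/2)^n * (z - a) \<le> 1 * (z - a)" "(1/2)^n * (b - z) \<le> 1 * (b - z)"
      using z by (intro mult_right_mono power_le_one; simp)+
    then show "a \<le> u n" "w n \<le> b" by (auto simp: u_def w_def)
  qed
  have step: "cmod (A (Suc n) - A n) \<le> X * r ^ n" for n
  proof -
    \<comment> \<open>The threshold \<mu> = \<eta> r^n balances both terms: the lengths shrink by
      1/2, r^p = 2^(-(\<sigma> p - 1)), and so the energy term also decays exactly like r^n.\<close>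
    have "cmod (A (Suc n) - A n) \<le> 2 * (\<eta> * r ^ n + (\<eta> * r ^ n) powr (1 - p) * (w n - u n) powr (\<sigma> * p - 1) * E)"
      unfolding A_def
    proof (rule mean_step[OF \<sigma> p f lt[of n] _ lt[of "Suc n"] _ _ au E])
      show "u n \<le> u (Suc n)" "w (Suc n) \<le> w n" using z by (auto simp: u_def w_def mult_left_le_one_le)
      show "w (Suc n) - u (Suc n) = (w n - u n) / 2" by (simp add: len)
      show "0 < \<eta> * r ^ n" using \<eta> r01 by simp
    qed
    also have "(\<eta> * r ^ n) powr (1 - p) * (w n - u n) powr (\<sigma> * p - 1) = \<eta> powr (1 - p) * (b - a) powr (\<sigma> * p - 1) * r ^ n"
    proof -
      have 1: "(w n - u n) powr (\<sigma> * p - 1) = (b - a) powr (\<sigma> * p - 1) * (r ^ n) powr p"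
      proof -
        have "((1/2)^n) powr (\<sigma> * p - 1) = (r ^ n) powr p"
        proof -
          have "((1/2::real)^n) = 2 powr (- real n)" by (simp only: powr_minus powr_realpow zero_less_numeral power_one_over inverse_eq_divide)
          moreover have "r ^ n = 2 powr (- ((\<sigma> * p - 1) / p) * real n)" using r01 by (simp add: powr_realpow[symmetric] r powr_powr)
          ultimately show ?thesis using p by (simp add: powr_powr mult.commute)
        qed
        then show ?thesis using ab by (simp add: len powr_mult)
      qed
      have "(r ^ n) powr (1 - p) * (r ^ n) powr p = r ^ n" using r01 by (simp add: powr_add[symmetric])
      then show ?thesis using \<eta> r01 by (simp add: 1 powr_mult mult_ac)
    qed
    finally show ?thesis by (simp add: X_def algebra_simps)
  qed
  have tel: "cmod (A n - A 0) \<le> X / (1 - r)" for n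
  proof -
    have "A n - A 0 = (\<Sum>i<n. A (Suc i) - A i)" by (simp add: sum_lessThan_telescope)
    then have "cmod (A n - A 0) \<le> (\<Sum>i<n. cmod (A (Suc i) - A i))" by (simp add: norm_sum)
    also have "\<dots> \<le> (\<Sum>i<n. X * r ^ i)" by (intro sum_mono step)
    also have "\<dots> = X * (\<Sum>i<n. r ^ i)" by (simp add: sum_distrib_left)
    also have "(\<Sum>i<n. r ^ i) \<le> 1 / (1 - r)"
      using r01 by (simp add: sum_gp_strict divide_right_mono)
    then have "X * (\<Sum>i<n. r ^ i) \<le> X * (1 / (1 - r))" using X by (intro mult_left_mono) auto
    finally show ?thesis by simp
  qed
  have "A \<longlonglongrightarrow> f z"
  proof (rule LIMSEQ_I)
    fix e :: real assume e: "0 < e"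
    have "isCont f z" using f by (simp add: continuous_on_eq_continuous_at)
    then obtain d where d: "d > 0" "\<And>y. dist y z < d \<Longrightarrow> dist (f y) (f z) < e/2"
      using e unfolding continuous_at_eps_delta by (metis half_gt_zero)
    have "(\<lambda>n. (1/2)^n * (b - a)) \<longlonglongrightarrow> 0 * (b - a)"
      by (intro tendsto_intros LIMSEQ_power_zero) auto
    then have "(\<lambda>n. (1/2)^n * (b - a)) \<longlonglongrightarrow> 0" by simp
    then obtain N where N: "\<And>n. n \<ge> N \<Longrightarrow> (1/2)^n * (b - a) < d"
      using LIMSEQ_D[of _ 0 d] d(1) ab by fastforce
    show "\<exists>no. \<forall>n\<ge>no. norm (A n - f z) < e"
    proof (intro exI allI impI)
      fix n assume n: "N \<le> n"
      have "cmod (A n - f z) \<le> e/2"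
        unfolding A_def
      proof (rule mean_close[OF lt f])
        fix y assume y: "y \<in> {u n..w n}"
        have "\<bar>y - z\<bar> \<le> w n - u n" using y z by (auto simp: u_def w_def abs_le_iff) (auto simp: field_simps)
        then have "dist y z < d" using N[OF n] len[of n] by (simp add: dist_real_def)
        then show "cmod (f y - f z) \<le> e/2" using d(2) by (simp add: dist_norm less_imp_le)
      qed (use e in simp)
      then show "norm (A n - f z) < e" using e by simp
    qed
  qed
  then have "(\<lambda>n. cmod (A n - A 0)) \<longlonglongrightarrow> cmod (f z - A 0)" by (intro tendsto_intros)
  then have "cmod (f z - A 0) \<le> X / (1 - r)" by (rule LIMSEQ_le_const2) (use tel in auto)
  moreover have "A 0 = mean a b f" by (simp add: A_def u_def w_def)
  ultimately show ?thesis by (simp add: X_def)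
qed

text \<open>One of the two values is at distance at least 1 from the mean, while the Morrey estimate
  keeps both close to it if the energy is small. The choice 4 \<eta> = 1 - r makes the threshold
  terms add up to 1, so that the energy must supply the other 1 of the oscillation 2.\<close>

lemma loc_energy_ge_of_oscillation:
  fixes f :: "real \<Rightarrow> complex"
  assumes \<sigma>: "0 < \<sigma>" and p: "1 \<le> p" and sp: "1 < \<sigma> * p" and f: "continuous_on UNIV f" and ab: "a < b"
    and xy: "x \<in> {a..b}" "y \<in> {a..b}" "2 \<le> cmod (f x - f y)"
    and \<eta>: "\<eta> = (1 - 2 powr (- ((\<sigma> * p - 1) / p))) / 4"
  shows "ennreal (\<eta> powr p * (b - a) powr (1 - \<sigma> * p)) \<le> loc_energy \<sigma> p {a..b} f"
proof (cases "loc_energy \<sigma> p {a..b} f" rule: ennreal_cases)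
  case (real E)
  define r where "r = 2 powr (- ((\<sigma> * p - 1) / p))"
  have r01: "0 < r" "r < 1" using sp p by (auto simp: r_def intro!: powr_less_one divide_pos_pos)
  have \<eta>0: "\<eta> > 0" "1 - r = 4 * \<eta>" using r01 by (auto simp: \<eta> r_def)
  define X where "X = (b - a) powr (\<sigma> * p - 1) * E"
  note M = Morrey_point[OF \<sigma> p sp f ab _ real(2,1) \<eta>0(1) r_def, folded X_def]
  have "2 \<le> cmod (f x - mean a b f) + cmod (f y - mean a b f)"
    using xy(3) norm_triangle_ineq4[of "f x - mean a b f" "f y - mean a b f"] by simp
  also have "\<dots> \<le> 2 * (\<eta> + \<eta> powr (1 - p) * X) / (1 - r) + 2 * (\<eta> + \<eta> powr (1 - p) * X) / (1 - r)"
    by (intro add_mono M xy)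
  also have "\<dots> = 1 + \<eta> powr (1 - p) * X / \<eta>" unfolding \<eta>0(2) using \<eta>0(1) by (simp add: field_simps)
  finally have "\<eta> \<le> \<eta> powr (1 - p) * X" using \<eta>0 by (simp add: field_simps)
  then have "\<eta> powr (p - 1) * \<eta> \<le> \<eta> powr (p - 1) * (\<eta> powr (1 - p) * X)" by (intro mult_left_mono) auto
  also have "\<dots> = X" using \<eta>0 by (simp add: mult.assoc[symmetric] powr_add[symmetric])
  also have "\<eta> powr (p - 1) * \<eta> = \<eta> powr p" using \<eta>0 powr_mult_base[of \<eta> "p - 1"] by (simp add: mult.commute)
  finally have "\<eta> powr p * (b - a) powr (1 - \<sigma> * p) \<le> X * (b - a) powr (1 - \<sigma> * p)" by (intro mult_right_mono) auto
  also have "\<dots> = E" using ab by (simp add: X_def mult_ac powr_add[symmetric])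
  finally show ?thesis using real by (simp add: ennreal_leI)
qed simp

subsection \<open>The lower bound for smooth maps\<close>

text \<open>The part of \<open>Wsp_pow\<close> that the lower bound sees. For integer s there is no
  Gagliardo term, and the L^p term of the highest derivative takes its place.\<close>

definition top_energy :: "real \<Rightarrow> real \<Rightarrow> (real \<Rightarrow> complex) \<Rightarrow> ennreal" where
  "top_energy \<sigma> p v = (if \<sigma> > 0 then Gag_pow \<sigma> p v else Lp_pow p v)"

lemma sum_indicator_Ico:
  fixes t :: "nat \<Rightarrow> real"
  assumes "\<And>i. i < N \<Longrightarrow> t i \<le> t (Suc i)"
  shows "t 0 \<le> t N \<and> (\<Sum>i<N. indicator {t i..<t (Suc i)} x) = (indicator {t 0..<t N} x :: ennreal)"
  using assms
proof (induction N)
  case (Suc N)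
  then have "t 0 \<le> t N" "(\<Sum>i<N. indicator {t i..<t (Suc i)} x) = (indicator {t 0..<t N} x :: ennreal)" "t N \<le> t (Suc N)"
    by auto
  then show ?case by (auto simp: indicator_def)
qed (simp add: indicator_def)

text \<open>Only the diagonal blocks of the double integral are kept. Chords are shorter than arcs,
  so the circle kernel dominates the one on the line; half-open intervals make the blocks
  disjoint.\<close>

lemma sum_loc_energy_le:
  assumes [measurable]: "v \<in> borel_measurable borel" and t: "\<And>i. i < N \<Longrightarrow> t i \<le> t (Suc i)" "0 \<le> t 0" "t N \<le> 2*pi"
    and p: "0 < p"
  shows "(\<Sum>i<N. loc_energy \<sigma> p {t i..<t (Suc i)} v) \<le> top_energy \<sigma> p v"
proof (cases "\<sigma> > 0")
  case False
  have "(\<Sum>i<N. loc_energy \<sigma> p {t i..<t (Suc i)} v)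
     = (\<Sum>i<N. \<integral>\<^sup>+x. ennreal (cmod (v x) powr p) * indicator {t i..<t (Suc i)} x \<partial>lborel)"
    using False by (simp add: loc_energy_def)
  also have "\<dots> = (\<integral>\<^sup>+x. (\<Sum>i<N. ennreal (cmod (v x) powr p) * indicator {t i..<t (Suc i)} x) \<partial>lborel)"
    by (rule nn_integral_sum[symmetric]) measurable
  also have "\<dots> \<le> (\<integral>\<^sup>+x. ennreal (cmod (v x) powr p) * indicator {0..2*pi} x \<partial>lborel)"
  proof (intro nn_integral_mono)
    fix x
    have "(\<Sum>i<N. ennreal (cmod (v x) powr p) * indicator {t i..<t (Suc i)} x) = ennreal (cmod (v x) powr p) * indicator {t 0..<t N} x"
      using sum_indicator_Ico[of N t x] t(1) by (simp add: sum_distrib_left[symmetric])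
    also have "\<dots> \<le> ennreal (cmod (v x) powr p) * indicator {0..2*pi} x"
      using t by (intro mult_left_mono) (auto simp: indicator_def)
    finally show "(\<Sum>i<N. ennreal (cmod (v x) powr p) * indicator {t i..<t (Suc i)} x) \<le> ennreal (cmod (v x) powr p) * indicator {0..2*pi} x" .
  qed
  finally show ?thesis using False by (simp add: top_energy_def Lp_pow_def nn_integral_completion)
next
  case True
  have e: "1 + \<sigma> * p > 0" using True p by (simp add: add_pos_pos)
  have tmono: "0 \<le> t i \<and> t (Suc i) \<le> 2*pi" if "i < N" for i
  proof -
    have "t 0 \<le> t i" using sum_indicator_Ico[of i t] t(1) that by auto
    moreover have "t (Suc i) \<le> t N"
      using sum_indicator_Ico[of "N - Suc i" "\<lambda>j. t (j + Suc i)"] t(1) that by auto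
    ultimately show ?thesis using t by auto
  qed
  note [measurable] = cis_measurable
  let ?k = "\<lambda>x y. ennreal (cmod (v x - v y) powr p / \<bar>x - y\<bar> powr (1 + \<sigma> * p))"
  let ?c = "\<lambda>x y. ennreal (cmod (v x - v y) powr p / cmod (cis x - cis y) powr (1 + \<sigma> * p))"
  \<comment> \<open>The half-open period matters: for the pair 0 and 2 pi the chord vanishes and the
    quotient takes the default value 0.\<close>
  have kc: "?k x y \<le> ?c x y" if "x \<in> {0..<2*pi}" "y \<in> {0..<2*pi}" for x y
  proof (cases "x = y")
    case False
    have "cis x \<noteq> cis y"
    proof
      assume "cis x = cis y"
      then have "sin x = sin y \<and> cos x = cos y" by (simp add: cis.ctr)
      then obtain n::int where n: "x = y + 2*pi*n" using sin_cos_eq_iff by blast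
      then have "2*pi * \<bar>real_of_int n\<bar> = \<bar>x - y\<bar>" by (simp add: abs_mult)
      also have "\<dots> < 2*pi * 1" using that by auto
      finally have "2*pi * \<bar>real_of_int n\<bar> < 2*pi * 1" .
      then have "n = 0" by simp
      then show False using n False by simp
    qed
    then show ?thesis using False norm_cis_diff_le[of x y] e
      by (intro ennreal_leI divide_left_mono powr_mono2 mult_pos_pos) auto
  qed simp
  define G where "G = (\<lambda>x. \<integral>\<^sup>+y. ?c x y * indicator {0..2*pi} y \<partial>lborel)"
  have "(\<Sum>i<N. loc_energy \<sigma> p {t i..<t (Suc i)} v)
     = (\<Sum>i<N. \<integral>\<^sup>+x. (\<integral>\<^sup>+y. ?k x y * indicator {t i..<t (Suc i)} y \<partial>lborel) * indicator {t i..<t (Suc i)} x \<partial>lborel)"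
    using True by (simp add: loc_energy_def)
  also have "\<dots> = (\<integral>\<^sup>+x. (\<Sum>i<N. (\<integral>\<^sup>+y. ?k x y * indicator {t i..<t (Suc i)} y \<partial>lborel) * indicator {t i..<t (Suc i)} x) \<partial>lborel)"
    by (rule nn_integral_sum[symmetric]) measurable
  also have "\<dots> \<le> (\<integral>\<^sup>+x. G x * indicator {0..2*pi} x \<partial>lborel)"
  proof (intro nn_integral_mono)
    fix x
    have "(\<Sum>i<N. (\<integral>\<^sup>+y. ?k x y * indicator {t i..<t (Suc i)} y \<partial>lborel) * indicator {t i..<t (Suc i)} x)
       \<le> (\<Sum>i<N. G x * indicator {t i..<t (Suc i)} x)"
    proof (intro sum_mono)
      fix i assume i: "i \<in> {..<N}"
      have ti: "0 \<le> t i" "t (Suc i) \<le> 2*pi" using tmono[of i] i by auto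
      show "(\<integral>\<^sup>+y. ?k x y * indicator {t i..<t (Suc i)} y \<partial>lborel) * indicator {t i..<t (Suc i)} x \<le> G x * indicator {t i..<t (Suc i)} x"
      proof (cases "x \<in> {t i..<t (Suc i)}")
        case True
        then have x: "x \<in> {0..<2*pi}" using ti by auto
        have "(\<integral>\<^sup>+y. ?k x y * indicator {t i..<t (Suc i)} y \<partial>lborel) \<le> G x"
          unfolding G_def
        proof (intro nn_integral_mono)
          fix y show "?k x y * indicator {t i..<t (Suc i)} y \<le> ?c x y * indicator {0..2*pi} y"
          proof (cases "y \<in> {t i..<t (Suc i)}")
            case True
            then have "y \<in> {0..<2*pi}" using ti by auto
            then show ?thesis using kc[OF x, of y] True by simp
          qed simp
        qed
        then show ?thesis using True by simp
      qed simp
    qed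
    also have "\<dots> = G x * indicator {t 0..<t N} x"
      using sum_indicator_Ico[of N t x] t(1) by (simp add: sum_distrib_left[symmetric])
    also have "\<dots> \<le> G x * indicator {0..2*pi} x"
      using t by (intro mult_left_mono) (auto simp: indicator_def)
    finally show "(\<Sum>i<N. (\<integral>\<^sup>+y. ?k x y * indicator {t i..<t (Suc i)} y \<partial>lborel) * indicator {t i..<t (Suc i)} x) \<le> G x * indicator {0..2*pi} x" .
  qed
  also have "\<dots> = top_energy \<sigma> p v"
    using True by (simp add: top_energy_def Gag_pow_def nn_integral_completion G_def)
  finally show ?thesis .
qed

text \<open>Convexity of u^(-\<alpha>): after scaling by N / L, so that the u i have mean at most 1,
  each term lies above its tangent 1 - \<alpha> (u - 1) at 1, and the linear parts sum to at least
  0.\<close>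

lemma sum_powr_ge:
  fixes l :: "nat \<Rightarrow> real"
  assumes l: "\<And>i. i < N \<Longrightarrow> 0 < l i" and L: "(\<Sum>i<N. l i) \<le> L" "0 < L" and N: "0 < N" and \<alpha>: "0 \<le> \<alpha>"
  shows "real N powr (1 + \<alpha>) * L powr (- \<alpha>) \<le> (\<Sum>i<N. l i powr (- \<alpha>))"
proof -
  define u where "u = (\<lambda>i. l i * (real N / L))"
  have u: "0 < u i" if "i < N" for i using l[OF that] L N by (simp add: u_def)
  have "u i powr (- \<alpha>) \<ge> 1 - \<alpha> * (u i - 1)" if "i < N" for i
  proof -
    have "1 - \<alpha> * (u i - 1) \<le> 1 - \<alpha> * ln (u i)" using ln_le_minus_one[OF u[OF that]] \<alpha> by (simp add: mult_left_mono)
    also have "\<dots> \<le> exp (- \<alpha> * ln (u i))" using exp_ge_add_one_self[of "- \<alpha> * ln (u i)"] by simp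
    also have "\<dots> = u i powr (- \<alpha>)" using u[OF that] by (simp add: powr_def)
    finally show ?thesis .
  qed
  then have "(\<Sum>i<N. 1 - \<alpha> * (u i - 1)) \<le> (\<Sum>i<N. u i powr (- \<alpha>))" by (intro sum_mono) auto
  moreover have "(\<Sum>i<N. 1 - \<alpha> * (u i - 1)) = real N - \<alpha> * ((\<Sum>i<N. u i) - real N)"
    by (simp add: sum_subtractf sum_distrib_left[symmetric])
  moreover have "(\<Sum>i<N. u i) \<le> real N"
  proof -
    have "(\<Sum>i<N. u i) = (\<Sum>i<N. l i) * (real N / L)" by (simp add: u_def sum_distrib_right sum_divide_distrib)
    also have "\<dots> \<le> L * (real N / L)" using L by (intro mult_right_mono) auto
    finally show ?thesis using L by simp
  qed
  then have "\<alpha> * ((\<Sum>i<N. u i) - real N) \<le> 0" using \<alpha> by (simp add: mult_nonneg_nonpos)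
  ultimately have 1: "real N \<le> (\<Sum>i<N. u i powr (- \<alpha>))" by linarith
  have "l i powr (- \<alpha>) = (real N / L) powr \<alpha> * u i powr (- \<alpha>)" if "i < N" for i
  proof -
    have "u i powr (- \<alpha>) = l i powr (- \<alpha>) * (real N / L) powr (- \<alpha>)" unfolding u_def by (rule powr_mult)
    moreover have "(real N / L) powr \<alpha> * (real N / L) powr (- \<alpha>) = 1" using N L by (simp add: powr_add[symmetric])
    ultimately show ?thesis by (simp add: mult_ac)
  qed
  then have "(\<Sum>i<N. l i powr (- \<alpha>)) = (real N / L) powr \<alpha> * (\<Sum>i<N. u i powr (- \<alpha>))"
    by (simp add: sum_distrib_left)
  also have "\<dots> \<ge> (real N / L) powr \<alpha> * real N" using 1 by (intro mult_left_mono) auto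
  also have "(real N / L) powr \<alpha> * real N = real N powr (1 + \<alpha>) * L powr (- \<alpha>)"
    using N L powr_divide[of "real N" L \<alpha>] by (simp add: powr_add powr_minus_divide)
  finally show ?thesis by simp
qed

text \<open>\<theta> need not be monotone; ordered preimages are obtained by looking for each new
  level only to the right of the preceding point.\<close>

lemma IVT_chain:
  fixes \<theta> :: "real \<Rightarrow> real"
  assumes c: "continuous_on UNIV \<theta>" and ab: "a \<le> b" and y0: "\<theta> a \<le> y 0" and inc: "\<And>j. j < M \<Longrightarrow> y j < y (Suc j)"
    and yM: "\<And>j. j \<le> M \<Longrightarrow> y j \<le> \<theta> b"
  shows "\<exists>x. (\<forall>j\<le>M. a \<le> x j \<and> x j \<le> b \<and> \<theta> (x j) = y j) \<and> (\<forall>j<M. x j < (x (Suc j) :: real))"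
  using inc yM
proof (induction M)
  case 0
  obtain x where "a \<le> x" "x \<le> b" "\<theta> x = y 0"
    using IVT'[of \<theta> a "y 0" b] y0 0(2) ab continuous_on_subset[OF c] by auto
  then show ?case by (intro exI[of _ "\<lambda>_. x"]) auto
next
  case (Suc M)
  then obtain x where x: "\<forall>j\<le>M. a \<le> x j \<and> x j \<le> b \<and> \<theta> (x j) = y j" "\<forall>j<M. x j < x (Suc j)"
    by (metis less_SucI le_SucI)
  have lt: "y M < y (Suc M)" using Suc.prems by simp
  obtain z where z: "x M \<le> z" "z \<le> b" "\<theta> z = y (Suc M)"
    using IVT'[of \<theta> "x M" "y (Suc M)" b] x(1) lt Suc.prems(2)[of "Suc M"] continuous_on_subset[OF c] by auto
  have "z \<noteq> x M" using z x(1) lt by force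
  then have "x M < z" using z by simp
  then show ?case using x z
    by (intro exI[of _ "x(Suc M := z)"]) (auto simp: less_Suc_eq le_Suc_eq)
qed

lemma abs_sin_half_pi_int: "2 * \<bar>sin (pi * of_int n / 2)\<bar> = (if even n then 0 else 2)"
proof (cases "even n")
  case True
  then obtain e where "n = 2 * e" by blast
  then have "pi * of_int n / 2 = pi * of_int e" by simp
  then show ?thesis using True by (simp add: sin_int_times_real mult.commute)
next
  case False
  then obtain e where "n = 2 * e + 1" by (rule oddE)
  then have "pi * of_int n / 2 = pi * of_int e + pi / 2" by (simp add: algebra_simps)
  then have "sin (pi * of_int n / 2) = sin (pi * of_int e) * cos (pi / 2) + cos (pi * of_int e) * sin (pi / 2)"
    by (simp only: sin_add)
  then have "\<bar>sin (pi * of_int n / 2)\<bar> = \<bar>cos (pi * of_int e)\<bar>" by simp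
  also have "\<dots> = 1" using cos_int_times_real[of e] by (simp add: mult.commute)
  finally show ?thesis using False by simp
qed

text \<open>The constants of the two local estimates: Morrey for s < 1, Taylor for s >= 1.\<close>

definition low_const :: "nat \<Rightarrow> real \<Rightarrow> real \<Rightarrow> real" where
  "low_const k \<sigma> p = (if k = 0 then ((1 - 2 powr (- ((\<sigma> * p - 1) / p))) / 4) powr p else (1/4) powr p)"

lemma top_energy_ge_phase:
  fixes D :: "nat \<Rightarrow> real \<Rightarrow> complex"
  assumes D: "\<And>k t. (D k has_vector_derivative D (Suc k) t) (at t)"
    and \<theta>: "continuous_on UNIV \<theta>" and h: "\<And>x. cmod (D 0 x) = 2 * \<bar>sin (\<theta> x / 2)\<bar>"
    and inc: "\<theta> (2*pi) - \<theta> 0 = 2*pi * (real (k + 1) * real N)" and N: "1 \<le> N"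
    and \<sigma>: "0 \<le> \<sigma>" and p: "1 \<le> p" and sp: "1 < (real k + \<sigma>) * p"
  shows "ennreal (low_const k \<sigma> p * (2*pi) powr (1 - (real k + \<sigma>) * p) * real N powr ((real k + \<sigma>) * p)) \<le> top_energy \<sigma> p (D k)"
proof -
  define n0 where "n0 = \<lceil>\<theta> 0 / pi\<rceil>"
  \<comment> \<open>The phase rises by 2 (k + 1) N multiples of pi. The first level is pi n0, less
    than pi above the starting value, which loses at most one gap and leaves M of them.\<close>
  define M where "M = 2 * (k + 1) * N - 1"
  define Y where "Y = (\<lambda>j::nat. pi * of_int (n0 + int j))"
  have n0: "\<theta> 0 \<le> pi * of_int n0" "pi * of_int n0 < \<theta> 0 + pi"
  proof -
    have "\<theta> 0 / pi \<le> of_int n0" "of_int n0 < \<theta> 0 / pi + 1" unfolding n0_def by linarith+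
    then show "\<theta> 0 \<le> pi * of_int n0" "pi * of_int n0 < \<theta> 0 + pi" by (auto simp: field_simps)
  qed
  have YM: "Y j \<le> \<theta> (2*pi)" if "j \<le> M" for j
  proof -
    have "real j + 1 \<le> 2 * (real (k + 1) * real N)"
    proof -
      have "j + 1 \<le> 2 * ((k + 1) * N)" using that N by (simp add: M_def)
      then have "real (j + 1) \<le> real (2 * ((k + 1) * N))" by (simp only: of_nat_le_iff)
      then show ?thesis by (simp add: algebra_simps)
    qed
    then have "pi * (real j + 1) \<le> pi * (2 * (real (k + 1) * real N))" by (intro mult_left_mono) auto
    then show ?thesis using inc n0(2) by (simp add: Y_def algebra_simps)
  qed
  obtain x where x: "\<And>j. j \<le> M \<Longrightarrow> 0 \<le> x j \<and> x j \<le> 2*pi \<and> \<theta> (x j) = Y j" and xinc: "\<And>j. j < M \<Longrightarrow> x j < x (Suc j)"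
    using IVT_chain[of \<theta> 0 "2*pi" Y M] \<theta> n0(1) YM by (auto simp: Y_def)
  \<comment> \<open>n0 may be negative, so only its parity is kept as a natural number.\<close>
  define m where "m = nat (n0 mod 2)"
  have val: "cmod (D 0 (x j)) = (if even (m + j) then 0 else 2)" if "j \<le> M" for j
  proof -
    have "cmod (D 0 (x j)) = 2 * \<bar>sin (pi * of_int (n0 + int j) / 2)\<bar>"
      using h[of "x j"] x[OF that] by (simp add: Y_def)
    also have "\<dots> = (if even (n0 + int j) then 0 else 2)" by (rule abs_sin_half_pi_int)
    also have "even (n0 + int j) \<longleftrightarrow> even (m + j)"
    proof -
      have "int m = n0 mod 2" by (simp add: m_def)
      then have "even (int m) = even n0" by presburger
      then show ?thesis by simp
    qed
    finally show ?thesis .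
  qed
  \<comment> \<open>Each interval uses q gaps and shares its endpoints with its neighbours. N of
    them fit because 2 (k + 1) N - 1 >= (2 k + 1) N for N >= 1; this is where the factor k + 1 in
    the assumption on \<theta> comes from.\<close>
  define q where "q = 2 * k + 1"
  define t where "t = (\<lambda>i. x (i * q))"
  have qM: "i * q + j \<le> M" if "i < N" "j \<le> q" for i j
  proof -
    have "Suc i * q \<le> N * q" using that by (intro mult_le_mono1) auto
    then have "i * q + j \<le> N * q" using that by simp
    also have "N * q \<le> M" using N by (simp add: q_def M_def algebra_simps)
    finally show ?thesis .
  qed
  have xm: "i \<le> j \<Longrightarrow> j \<le> M \<Longrightarrow> x i \<le> x j" for i j
  proof (induction j)
    case (Suc j)
    then show ?case using xinc[of j] by (cases "i = Suc j") (auto simp: le_Suc_eq)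
  qed simp
  have tlt: "t i < t (Suc i)" if "i < N" for i
  proof -
    have "x (i * q) < x (Suc (i * q))" using qM[OF that, of q] by (intro xinc) (simp add: q_def)
    also have "\<dots> \<le> x (Suc i * q)" using qM[OF that, of q] by (intro xm) (auto simp: q_def)
    finally show ?thesis by (simp add: t_def)
  qed
  have NM: "N * q \<le> M" using N by (simp add: q_def M_def algebra_simps)
  have sm: "smooth (D j)" for j by (rule derivs_imp_smooth[of D]) (rule D)
  have loc: "ennreal (low_const k \<sigma> p * (t (Suc i) - t i) powr (1 - (real k + \<sigma>) * p)) \<le> loc_energy \<sigma> p {t i..<t (Suc i)} (D k)"
    if i: "i < N" for i
  \<comment> \<open>For k = 0 the condition 1 < (k + \<sigma>) p forces \<sigma> > 0, and two points
    suffice: f - g passes from modulus 0 to modulus 2 or back.\<close>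
  proof (cases "k = 0")
    case True
    then have q1: "q = 1" by (simp add: q_def)
    have v: "cmod (D 0 (x i)) = (if even (m + i) then 0 else 2)" "cmod (D 0 (x (Suc i))) = (if even (m + i) then 2 else 0)"
      using val[of i] val[of "Suc i"] qM[OF i, of 1] q1 by auto
    have "2 \<le> cmod (D 0 (t i) - D 0 (t (Suc i)))"
      using v norm_triangle_ineq3[of "D 0 (x i)" "D 0 (x (Suc i))"] by (simp add: t_def q1 split: if_splits)
    then show ?thesis
      unfolding loc_energy_Ico
      using loc_energy_ge_of_oscillation[of \<sigma> p "D 0" "t i" "t (Suc i)" "t i" "t (Suc i)"] True \<sigma> p sp tlt[OF i] smooth_continuous_on[OF sm, of UNIV 0]
      by (cases "\<sigma> = 0") (auto simp: low_const_def)
  next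
    case False
    define y where "y = (\<lambda>j. x (i * q + j))"
    have "ennreal ((1/4) powr p * (t (Suc i) - t i) powr (1 - (real k + \<sigma>) * p)) \<le> loc_energy \<sigma> p {t i..t (Suc i)} (D k)"
    proof (rule loc_energy_ge_of_alternation[where D=D and y=y and m="m + i * q"])
      show "(D j has_vector_derivative D (Suc j) u) (at u)" for j u by (rule D)
      show "t i < t (Suc i)" by (rule tlt[OF i])
      show "1 \<le> k" using False by simp
      show "y j < y (Suc j)" if "j \<le> 2*k" for j
        using qM[OF i, of "Suc j"] that xinc[of "i * q + j"] by (simp add: y_def q_def)
      show "y j \<in> {t i..t (Suc i)}" if "j \<le> 2*k+1" for j
        using qM[OF i, of q] qM[OF i, of j] that xm[of "i * q" "i * q + j"] xm[of "i * q + j" "Suc i * q"]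
        by (auto simp: y_def t_def q_def)
      show "cmod (D 0 (y j)) = (if even (m + i * q + j) then 0 else 2)" if "j \<le> 2*k+1" for j
        using val[of "i * q + j"] qM[OF i, of j] that by (simp add: y_def q_def add.assoc)
    qed (use \<sigma> p in auto)
    then show ?thesis using False by (simp add: low_const_def loc_energy_Ico)
  qed
  define \<alpha> where "\<alpha> = (real k + \<sigma>) * p - 1"
  have \<alpha>: "0 \<le> \<alpha>" "1 + \<alpha> = (real k + \<sigma>) * p" "- \<alpha> = 1 - (real k + \<sigma>) * p" using sp by (auto simp: \<alpha>_def)
  have c0: "0 \<le> low_const k \<sigma> p" by (simp add: low_const_def)
  have "real N powr (1 + \<alpha>) * (2*pi) powr (- \<alpha>) \<le> (\<Sum>i<N. (t (Suc i) - t i) powr (- \<alpha>))"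
  proof (rule sum_powr_ge)
    have "(\<Sum>i<N. t (Suc i) - t i) = t N - t 0" by (rule sum_lessThan_telescope)
    also have "\<dots> \<le> 2*pi" using x[of "N * q"] x[of 0] NM by (simp add: t_def)
    finally show "(\<Sum>i<N. t (Suc i) - t i) \<le> 2*pi" .
  qed (use tlt N \<alpha> in auto)
  then have "ennreal (low_const k \<sigma> p * (real N powr (1 + \<alpha>) * (2*pi) powr (- \<alpha>))) \<le> ennreal (low_const k \<sigma> p * (\<Sum>i<N. (t (Suc i) - t i) powr (- \<alpha>)))"
    using c0 by (intro ennreal_leI mult_left_mono)
  also have "\<dots> = (\<Sum>i<N. ennreal (low_const k \<sigma> p * (t (Suc i) - t i) powr (- \<alpha>)))"
    using c0 by (simp add: sum_distrib_left)
  also have "\<dots> \<le> (\<Sum>i<N. loc_energy \<sigma> p {t i..<t (Suc i)} (D k))"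
    unfolding \<alpha>(3) by (intro sum_mono loc) auto
  also have "\<dots> \<le> top_energy \<sigma> p (D k)"
    using tlt x[of "N * q"] x[of 0] NM p
    by (intro sum_loc_energy_le smooth_measurable sm) (auto simp: t_def less_imp_le)
  finally show ?thesis unfolding \<alpha>(2,3) by (simp add: mult_ac)
qed

section \<open>Scaling of the energy, and lifts over several periods\<close>

lemma Lp_pow_cmult:
  assumes [measurable]: "v \<in> borel_measurable borel"
  shows "Lp_pow p (\<lambda>x. c * v x) = ennreal (cmod c powr p) * Lp_pow p v"
  unfolding Lp_pow_def nn_integral_completion
  by (subst nn_integral_cmult[symmetric])
    (auto simp: norm_mult powr_mult ennreal_mult' mult.assoc)

lemma Gag_pow_cmult:
  assumes [measurable]: "v \<in> borel_measurable borel"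
  shows "Gag_pow \<sigma> p (\<lambda>x. c * v x) = ennreal (cmod c powr p) * Gag_pow \<sigma> p v"
proof -
  note [measurable] = cis_measurable
  have eq: "ennreal (cmod (c * v x - c * v y) powr p / cmod (cis x - cis y) powr (1 + \<sigma> * p))
    = ennreal (cmod c powr p) * ennreal (cmod (v x - v y) powr p / cmod (cis x - cis y) powr (1 + \<sigma> * p))" for x y
    by (simp add: right_diff_distrib[symmetric] norm_mult powr_mult ennreal_mult'[symmetric])
  show ?thesis
    unfolding Gag_pow_def nn_integral_completion eq mult.assoc
    by (simp add: nn_integral_cmult mult.assoc)
qed

text \<open>The L^p energy is invariant under x -> n x; inserting the factor n^(1 + \<sigma> p) >= 1
  there too gives one statement for both kinds of energy. Only a fixed n is used in the lower bound,
  so sharpness in n is irrelevant.\<close>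

lemma top_energy_scale_le:
  assumes v: "v \<in> borel_measurable borel" and per: "periodic2pi v" and n: "0 < n" and \<sigma>: "0 \<le> \<sigma>" and p: "1 \<le> p"
  shows "top_energy \<sigma> p (\<lambda>x. c * v (real n * x)) \<le> ennreal (cmod c powr p * real n powr (1 + \<sigma> * p)) * top_energy \<sigma> p v"
proof -
  have m: "(\<lambda>x. v (real n * x)) \<in> borel_measurable borel" using v by measurable
  have e: "0 \<le> \<sigma> * p" using \<sigma> p by simp
  have ge1: "1 \<le> real n powr (1 + \<sigma> * p)" using n e by (intro ge_one_powr_ge_zero) auto
  have L: "Lp_pow p v \<le> ennreal (real n powr (1 + \<sigma> * p)) * Lp_pow p v"
    using mult_right_mono[of 1 "ennreal (real n powr (1 + \<sigma> * p))" "Lp_pow p v"] ennreal_leI[OF ge1] by simp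
  show ?thesis
    using Gag_pow_scale_le[OF v per n, of \<sigma> p] e
    by (auto simp: top_energy_def Gag_pow_cmult[OF m] Lp_pow_cmult[OF m] Lp_pow_scale[OF v per n] ennreal_mult' mult.assoc
        intro!: mult_left_mono L)
qed

text \<open>The gain \<psi> over one period satisfies cis \<psi> = 1; differentiating this identity
  shows that \<psi> is constant.\<close>

lemma lift_period:
  assumes \<phi>: "smooth \<phi>" and per: "periodic2pi (\<lambda>x. cis (\<phi> x))"
  shows "\<phi> (x + 2*pi) - \<phi> x = \<phi> (2*pi) - \<phi> 0"
proof -
  define \<psi> where "\<psi> = (\<lambda>x. \<phi> (1 * x + 2*pi) - \<phi> x)"
  have "smooth \<psi>" unfolding \<psi>_def by (intro smooth_diff smooth_affine \<phi>)
  then obtain \<psi>' where \<psi>': "\<And>t. (\<psi> has_vector_derivative \<psi>' t) (at t)"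
    using smooth_has_derivative by blast
  have one: "(\<lambda>x. cis (\<psi> x)) = (\<lambda>x. 1)"
  proof
    fix x
    have "cis (\<psi> x) = cis (\<phi> (x + 2*pi)) / cis (\<phi> x)" by (simp add: \<psi>_def cis_divide)
    then show "cis (\<psi> x) = 1" using per by (simp add: periodic2pi_def)
  qed
  have "\<psi>' t = 0" for t
  proof -
    have "((\<lambda>x. cis (\<psi> x)) has_vector_derivative \<psi>' t *\<^sub>R (\<i> * cis (\<psi> t))) (at t)"
      by (rule cis_has_vector_derivative[OF \<psi>'])
    moreover have "((\<lambda>x. cis (\<psi> x)) has_vector_derivative 0) (at t)" unfolding one by simp
    ultimately have "\<psi>' t *\<^sub>R (\<i> * cis (\<psi> t)) = 0" using vector_derivative_unique_at by blast
    then show ?thesis by simp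
  qed
  then have "(\<psi> has_real_derivative 0) (at t)" for t using \<psi>'[of t] by (simp add: has_real_derivative_iff_has_vector_derivative)
  then have "\<psi> x = \<psi> 0" using DERIV_isconst_all[of \<psi>] by blast
  then show ?thesis by (simp add: \<psi>_def)
qed

lemma lift_periods:
  assumes "smooth \<phi>" "periodic2pi (\<lambda>x. cis (\<phi> x))"
  shows "\<phi> (2*pi * real n) - \<phi> 0 = real n * (\<phi> (2*pi) - \<phi> 0)"
proof (induction n)
  case (Suc n)
  have "\<phi> (2*pi * real (Suc n)) = \<phi> (2*pi * real n + 2*pi)" by (simp add: algebra_simps)
  then show ?case using Suc lift_period[OF assms, of "2*pi * real n"] by (simp add: algebra_simps)
qed simp

text \<open>The alternation count needs the phase to turn (k + 1) N times, so it is applied to f (R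
  x) and g (R x) with R = k + 1. The chain rule contributes R^k and the energy scaling R^(1 +
  \<sigma> p); both are collected in \<open>c2\<close> and divided out.\<close>

lemma top_energy_ge_smooth:
  assumes \<sigma>: "0 \<le> \<sigma>" and p: "1 \<le> p" and sp: "1 < (real k + \<sigma>) * p"
  shows "\<exists>c>0. \<forall>f g D (d1::int) (d2::int). smooth f \<longrightarrow> smooth g \<longrightarrow> periodic2pi f \<longrightarrow> periodic2pi g
    \<longrightarrow> (\<forall>x. cmod (f x) = 1) \<longrightarrow> (\<forall>x. cmod (g x) = 1) \<longrightarrow> top_deg f = of_int d1 \<longrightarrow> top_deg g = of_int d2
    \<longrightarrow> D 0 = (\<lambda>x. f x - g x) \<longrightarrow> (\<forall>k t. (D k has_vector_derivative D (Suc k) t) (at t))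
    \<longrightarrow> ennreal (c * \<bar>real_of_int (d1 - d2)\<bar> powr ((real k + \<sigma>) * p)) \<le> top_energy \<sigma> p (D k)"
proof -
  define R where "R = k + 1"
  define c1 where "c1 = low_const k \<sigma> p * (2*pi) powr (1 - (real k + \<sigma>) * p)"
  define c2 where "c2 = (real R ^ k) powr p * real R powr (1 + \<sigma> * p)"
  have c2: "c2 > 0" by (simp add: c2_def R_def)
  have c1: "c1 > 0"
  proof -
    have "2 powr (- ((\<sigma> * p - 1) / p)) < 1" if "k = 0" using that sp p by (intro powr_less_one) auto
    then have "low_const k \<sigma> p > 0" by (cases "k = 0") (auto simp: low_const_def)
    then show ?thesis by (simp add: c1_def)
  qed
  have "ennreal (c1 / c2 * \<bar>real_of_int (d1 - d2)\<bar> powr ((real k + \<sigma>) * p)) \<le> top_energy \<sigma> p (D k)"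
    if f: "smooth f" "periodic2pi f" "\<And>x. cmod (f x) = 1" "top_deg f = of_int d1"
      and g: "smooth g" "periodic2pi g" "\<And>x. cmod (g x) = 1" "top_deg g = of_int d2"
      and D0: "D 0 = (\<lambda>x. f x - g x)" and D: "\<And>k t. (D k has_vector_derivative D (Suc k) t) (at t)"
    for f g D and d1 d2 :: int
  proof (cases "d1 = d2")
    case False
    obtain \<phi> where \<phi>: "smooth \<phi>" "\<And>x. f x = cis (\<phi> x)" using smooth_unit_lift[OF f(1,3)] by blast
    obtain \<psi> where \<psi>: "smooth \<psi>" "\<And>x. g x = cis (\<psi> x)" using smooth_unit_lift[OF g(1,3)] by blast
    have f': "f = (\<lambda>x. cis (\<phi> x))" and g': "g = (\<lambda>x. cis (\<psi> x))" using \<phi> \<psi> by auto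
    have inc: "\<phi> (2*pi) - \<phi> 0 = 2*pi * of_int d1" "\<psi> (2*pi) - \<psi> 0 = 2*pi * of_int d2"
    proof -
      have "complex_of_real ((\<phi> (2*pi) - \<phi> 0) / (2*pi)) = complex_of_real (of_int d1)" using top_deg_cis[OF \<phi>(1)] f(4) f' by simp
      then have "(\<phi> (2*pi) - \<phi> 0) / (2*pi) = of_int d1" by (simp only: of_real_eq_iff)
      then show "\<phi> (2*pi) - \<phi> 0 = 2*pi * of_int d1" by (simp add: field_simps)
      have "complex_of_real ((\<psi> (2*pi) - \<psi> 0) / (2*pi)) = complex_of_real (of_int d2)" using top_deg_cis[OF \<psi>(1)] g(4) g' by simp
      then have "(\<psi> (2*pi) - \<psi> 0) / (2*pi) = of_int d2" by (simp only: of_real_eq_iff)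
      then show "\<psi> (2*pi) - \<psi> 0 = 2*pi * of_int d2" by (simp add: field_simps)
    qed
    define N where "N = nat \<bar>d1 - d2\<bar>"
    \<comment> \<open>The sign makes \<theta> gain over the period also when d1 < d2; |sin (\<theta>
      / 2)| does not notice it.\<close>
    define \<epsilon> where "\<epsilon> = real_of_int (sgn (d1 - d2))"
    have \<epsilon>: "\<bar>\<epsilon>\<bar> = 1" "\<epsilon> * real_of_int (d1 - d2) = real N"
      using False by (auto simp: \<epsilon>_def N_def sgn_if)
    define \<theta> where "\<theta> = (\<lambda>x. \<epsilon> * (\<phi> (real R * x) - \<psi> (real R * x)))"
    define E where "E = (\<lambda>j x. of_real (real R ^ j) * D j (real R * x))"
    have E: "(E j has_vector_derivative E (Suc j) t) (at t)" for j t
    proof -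
      have "((\<lambda>x. real R * x) has_vector_derivative real R) (at t)"
        by (auto intro!: derivative_eq_intros simp: has_real_derivative_iff_has_vector_derivative[symmetric])
      from vector_diff_chain_at[OF this D]
      have "((\<lambda>x. D j (real R * x)) has_vector_derivative real R *\<^sub>R D (Suc j) (real R * t)) (at t)" by (simp add: o_def)
      from has_vector_derivative_mult_right[OF this, of "of_real (real R ^ j)"] show ?thesis
        by (simp add: E_def scaleR_conv_of_real mult_ac)
    qed
    have "ennreal (low_const k \<sigma> p * (2*pi) powr (1 - (real k + \<sigma>) * p) * real N powr ((real k + \<sigma>) * p)) \<le> top_energy \<sigma> p (E k)"
    proof (rule top_energy_ge_phase[where D=E and \<theta>=\<theta>])
      show "(E j has_vector_derivative E (Suc j) t) (at t)" for j t by (rule E)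
      show "continuous_on UNIV \<theta>" unfolding \<theta>_def
        by (intro smooth_continuous_on smooth_cmult smooth_diff smooth_scale \<phi> \<psi>)
      show "cmod (E 0 x) = 2 * \<bar>sin (\<theta> x / 2)\<bar>" for x
      proof -
        have "cmod (E 0 x) = 2 * \<bar>sin ((\<phi> (real R * x) - \<psi> (real R * x)) / 2)\<bar>"
          by (simp add: E_def D0 \<phi> \<psi> norm_cis_diff)
        also have "\<bar>sin ((\<phi> (real R * x) - \<psi> (real R * x)) / 2)\<bar> = \<bar>sin (\<theta> x / 2)\<bar>"
        proof -
          have "\<epsilon> = 1 \<or> \<epsilon> = -1" using \<epsilon>(1) by auto
          then show ?thesis
          proof
            assume "\<epsilon> = -1"
            then have "\<theta> x / 2 = - ((\<phi> (real R * x) - \<psi> (real R * x)) / 2)" by (simp add: \<theta>_def field_simps)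
            then show ?thesis by (simp only: sin_minus abs_minus_cancel)
          qed (simp add: \<theta>_def)
        qed
        finally show ?thesis .
      qed
      have "\<theta> (2*pi) - \<theta> 0 = \<epsilon> * ((\<phi> (2*pi * real R) - \<phi> 0) - (\<psi> (2*pi * real R) - \<psi> 0))"
        by (simp add: \<theta>_def algebra_simps)
      also have "\<dots> = \<epsilon> * (real R * (2*pi * of_int d1) - real R * (2*pi * of_int d2))"
        using lift_periods[OF \<phi>(1), of R] lift_periods[OF \<psi>(1), of R] f(2) g(2) inc f' g' by simp
      also have "\<dots> = 2*pi * (real R * (\<epsilon> * real_of_int (d1 - d2)))" by (simp add: algebra_simps)
      also have "\<epsilon> * real_of_int (d1 - d2) = real N" by (rule \<epsilon>(2))
      finally show "\<theta> (2*pi) - \<theta> 0 = 2*pi * (real (k + 1) * real N)" by (simp only: R_def)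
      show "1 \<le> N" using False by (simp add: N_def)
    qed (use \<sigma> p sp in auto)
    also have "top_energy \<sigma> p (E k) \<le> ennreal (cmod (of_real (real R ^ k)) powr p * real R powr (1 + \<sigma> * p)) * top_energy \<sigma> p (D k)"
      unfolding E_def
    proof (rule top_energy_scale_le)
      show "D k \<in> borel_measurable borel" by (intro smooth_measurable derivs_imp_smooth[of D] D)
      show "periodic2pi (D k)"
      proof (induction k)
        case 0 show ?case using f(2) g(2) by (simp add: D0 periodic2pi_def)
      next
        case (Suc k) then show ?case using periodic_derivative D by blast
      qed
    qed (use \<sigma> p in \<open>auto simp: R_def\<close>)
    also have "cmod (of_real (real R ^ k)) powr p * real R powr (1 + \<sigma> * p) = c2" by (simp add: c2_def norm_power)
    finally have main: "ennreal (c1 * real N powr ((real k + \<sigma>) * p)) \<le> ennreal c2 * top_energy \<sigma> p (D k)" by (simp add: c1_def)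
    have "ennreal (1 / c2) * ennreal (c1 * real N powr ((real k + \<sigma>) * p)) \<le> ennreal (1 / c2) * (ennreal c2 * top_energy \<sigma> p (D k))"
      by (intro mult_left_mono main) auto
    also have "\<dots> = top_energy \<sigma> p (D k)" using c2 by (simp add: mult.assoc[symmetric] ennreal_mult'[symmetric])
    also have "ennreal (1 / c2) * ennreal (c1 * real N powr ((real k + \<sigma>) * p)) = ennreal (c1 / c2 * real N powr ((real k + \<sigma>) * p))"
      using c2 c1 by (simp add: ennreal_mult'[symmetric])
    moreover have "real N = \<bar>real_of_int (d1 - d2)\<bar>" by (simp add: N_def)
    ultimately show ?thesis by simp
  qed simp
  then show ?thesis using c1 c2 by (intro exI[of _ "c1 / c2"] conjI allI impI) auto
qed

subsection \<open>Pairs of maps with prescribed degrees\<close>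

lemma reduce_mod_2pi:
  obtains j :: int where "\<bar>x - a - 2*pi * of_int j\<bar> \<le> pi"
proof -
  have "\<bar>of_int (round ((x - a) / (2*pi))) - (x - a) / (2*pi)\<bar> \<le> 1/2" by (rule of_int_round_abs_le)
  then have "2*pi * \<bar>of_int (round ((x - a) / (2*pi))) - (x - a) / (2*pi)\<bar> \<le> 2*pi * (1/2)" by (intro mult_left_mono) auto
  moreover have "2*pi * \<bar>of_int (round ((x - a) / (2*pi))) - (x - a) / (2*pi)\<bar> = \<bar>x - a - 2*pi * of_int (round ((x - a) / (2*pi)))\<bar>"
  proof -
    have "2*pi * \<bar>of_int (round ((x - a) / (2*pi))) - (x - a) / (2*pi)\<bar> = \<bar>2*pi * (of_int (round ((x - a) / (2*pi))) - (x - a) / (2*pi))\<bar>"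
      by (simp add: abs_mult)
    also have "2*pi * (of_int (round ((x - a) / (2*pi))) - (x - a) / (2*pi)) = - (x - a - 2*pi * of_int (round ((x - a) / (2*pi))))"
      by (simp add: field_simps)
    finally show ?thesis by (simp only: abs_minus_cancel)
  qed
  ultimately show ?thesis using that by simp
qed

lemma abs_le_of_cos_le:
  assumes "\<bar>y\<bar> \<le> pi" "0 \<le> b" "cos b \<le> cos y" shows "\<bar>y\<bar> \<le> b"
proof (rule ccontr)
  assume "\<not> \<bar>y\<bar> \<le> b"
  then have "cos \<bar>y\<bar> < cos b" using assms by (intro cos_monotone_0_pi) auto
  then show False using assms by simp
qed

lemma cos_shift_int: "cos (x + 2*pi * of_int j) = cos x"
  using sin_cos_eq_iff[of "x + 2*pi * of_int j" x] by auto

lemma cis_shift_int: "cis (x + 2*pi * of_int j) = cis x"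
  by (rule periodic2pi_int) (auto simp: periodic2pi_def cis.ctr)

text \<open>On an arc where the density vanishes the phase stands still, and on the translates of
  that arc it is a multiple of 2 pi. Hence cis P = 1 there.\<close>

lemma phase_const:
  assumes d: "\<And>t. (P has_real_derivative c * \<rho> t) (at t)" and per: "\<And>x. P (x + 2*pi) = P x + 2*pi" and a: "P a = 0"
    and z: "\<And>x. \<bar>x - a\<bar> \<le> b \<Longrightarrow> \<rho> x = 0" and x: "\<bar>x - a - 2*pi * of_int j\<bar> \<le> b"
  shows "P x = 2*pi * of_int j"
proof -
  have b: "b \<ge> 0" using x by simp
  have "\<exists>c0. \<forall>x\<in>{a-b..a+b}. P x = c0"
  proof (rule has_field_derivative_zero_constant)
    fix x assume "x \<in> {a-b..a+b}"
    then have "\<rho> x = 0" by (intro z) auto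
    then show "(P has_field_derivative 0) (at x within {a-b..a+b})"
      using d[of x] by (auto intro: has_field_derivative_at_within)
  qed simp
  then have const: "P y = 0" if "\<bar>y - a\<bar> \<le> b" for y
    using a b that by (metis abs_diff_le_iff atLeastAtMost_iff abs_0 diff_self)
  have perj: "P (y + 2*pi * of_int j) = P y + 2*pi * of_int j" for y and j :: int
  proof -
    have nat: "P (y + 2*pi * real n) = P y + 2*pi * real n" for n y
    proof (induction n)
      case (Suc n)
      have "P (y + 2*pi * real (Suc n)) = P ((y + 2*pi * real n) + 2*pi)" by (simp add: algebra_simps)
      also have "\<dots> = P (y + 2*pi * real n) + 2*pi" by (rule per)
      finally show ?case using Suc by (simp add: algebra_simps)
    qed simp
    show ?thesis
    proof (cases "j \<ge> 0")
      case True then show ?thesis using nat[of y "nat j"] by simp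
    next
      case False
      then show ?thesis using nat[of "y + 2*pi * of_int j" "nat (- j)"] by simp
    qed
  qed
  have "P (x - 2*pi * of_int j) = 0" using x by (intro const) (simp add: algebra_simps)
  then show ?thesis using perj[of "x - 2*pi * of_int j" j] by simp
qed

text \<open>All the winding takes place within distance r of the multiples of 2 pi. The density
  vanishes on the complementary arc, centred at pi with half width pi - r, and P is normalised to be
  0 there.\<close>

lemma bump_phase:
  assumes r: "0 < r" "r < pi"
  obtains P where "smooth P" "\<And>x. P (x + 2*pi) = P x + 2*pi" "\<And>x. r \<le> x \<Longrightarrow> x \<le> 2*pi - r \<Longrightarrow> P x = 0"
    "\<And>x. cos x \<le> cos r \<Longrightarrow> \<exists>j::int. P x = 2*pi * of_int j"
proof -
  define \<rho> where "\<rho> = (\<lambda>x. flat_exp 0 (cos x - cos r))"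
  have pos: "0 < \<rho> 0" using cos_monotone_0_pi[of 0 r] r by (simp add: \<rho>_def flat_exp_pos_iff)
  have sm: "smooth \<rho>" unfolding \<rho>_def by (intro smooth_intros)
  have per: "\<rho> (x + 2*pi) = \<rho> x" and nn: "0 \<le> \<rho> x" for x by (simp_all add: \<rho>_def flat_exp_nonneg)
  obtain P c where P: "smooth P" "c > 0" "\<And>t. (P has_real_derivative c * \<rho> t) (at t)"
    "\<And>x. P (x + 2*pi) = P x + 2*pi" "P pi = 0"
    by (rule phase_exists[OF sm per nn pos]) (rule that; assumption)
  have z: "\<rho> x = 0" if "\<bar>x - pi\<bar> \<le> pi - r" for x
  proof -
    have "cos (pi - r) \<le> cos \<bar>x - pi\<bar>" using that r by (intro cos_monotone_0_pi_le) auto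
    then have "cos x \<le> cos r" by (simp add: cos_diff)
    then show ?thesis by (simp add: \<rho>_def flat_exp_eq_0)
  qed
  have const: "P x = 2*pi * of_int j" if "\<bar>x - pi - 2*pi * of_int j\<bar> \<le> pi - r" for x and j :: int
    by (rule phase_const[OF P(3,4,5) z that])
  show ?thesis
  proof (rule that[OF P(1,4)])
    show "P x = 0" if "r \<le> x" "x \<le> 2*pi - r" for x
      using const[of x 0] that by (simp add: abs_le_iff)
    show "\<exists>j::int. P x = 2*pi * of_int j" if c: "cos x \<le> cos r" for x
    proof -
      obtain j :: int where j: "\<bar>x - pi - 2*pi * of_int j\<bar> \<le> pi" by (rule reduce_mod_2pi)
      have "cos (x - pi - 2*pi * of_int j) = - cos x"
        using cos_shift_int[of "x - pi" "- j"] by (simp add: cos_diff)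
      moreover have "cos (pi - r) = - cos r" by (simp add: cos_diff)
      ultimately have "cos (pi - r) \<le> cos (x - pi - 2*pi * of_int j)" using c by linarith
      then have "\<bar>x - pi - 2*pi * of_int j\<bar> \<le> pi - r"
        using abs_le_of_cos_le[OF j, of "pi - r"] r by linarith
      then show ?thesis using const by blast
    qed
  qed
qed

lemma periodic2pi_scale:
  assumes "periodic2pi h" shows "periodic2pi (\<lambda>x. h (real n * x))"
  unfolding periodic2pi_def
proof
  fix x
  have "real n * (x + 2*pi) = real n * x + 2*pi * of_int (int n)" by (simp add: algebra_simps)
  then show "h (real n * (x + 2*pi)) = h (real n * x)" using periodic2pi_int[OF assms] by metis
qed

lemma twisted_map:
  fixes n :: nat and e :: int
  assumes \<phi>: "smooth \<phi>" "periodic2pi (\<lambda>x. cis (\<phi> x))" "\<phi> (2*pi) - \<phi> 0 = 2*pi * of_int m"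
    and P: "smooth P" "\<And>x. P (x + 2*pi) = P x + 2*pi"
  defines "F \<equiv> (\<lambda>x. cis (\<phi> (real n * x) + of_int e * P x))"
  shows "smooth F" "periodic2pi F" "\<And>x. cmod (F x) = 1" "top_deg F = of_int (int n * m + e)"
    "\<And>x. F x = cis (\<phi> (real n * x)) * cis (of_int e * P x)"
proof -
  have s: "smooth (\<lambda>x. \<phi> (real n * x) + of_int e * P x)" by (intro smooth_intros smooth_scale \<phi> P)
  then show "smooth F" unfolding F_def by (rule smooth_cis)
  show eq: "F x = cis (\<phi> (real n * x)) * cis (of_int e * P x)" for x by (simp add: F_def cis_mult)
  have "cis (of_int e * P (x + 2*pi)) = cis (of_int e * P x)" for x
    unfolding P(2) distrib_left using cis_shift_int[of "of_int e * P x" e] by (simp add: mult_ac)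
  then show "periodic2pi F" using periodic2pi_scale[OF \<phi>(2), of n] by (simp add: periodic2pi_def eq)
  show "cmod (F x) = 1" for x by (simp add: F_def)
  have "\<phi> (2*pi * real n) - \<phi> 0 = real n * (2*pi * of_int m)"
    using lift_periods[OF \<phi>(1,2), of n] \<phi>(3) by simp
  moreover have "P (2*pi) = P 0 + 2*pi" using P(2)[of 0] by simp
  ultimately have "(\<phi> (real n * (2*pi)) + of_int e * P (2*pi)) - (\<phi> (real n * 0) + of_int e * P 0) = 2*pi * (real n * of_int m + of_int e)"
    by (simp add: algebra_simps)
  then show "top_deg F = of_int (int n * m + e)"
    unfolding F_def using top_deg_cis[OF s] by simp
qed

text \<open>f0 (n x) and g0 (n x) have degrees n and 0; the common factor cis (e P) adds e = min d1
  d2 to both, which gives the larger and the smaller of d1, d2. The sign \<epsilon> records which of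
  them is d1.\<close>

lemma realize_pair:
  assumes f0: "smooth f0" "periodic2pi f0" "\<And>x. cmod (f0 x) = 1" "top_deg f0 = 1"
    and g0: "smooth g0" "periodic2pi g0" "\<And>x. cmod (g0 x) = 1" "top_deg g0 = 0"
    and eq: "\<And>x. cos x \<ge> 0 \<Longrightarrow> f0 x = g0 x" and d: "d1 \<noteq> d2" and n: "n = nat \<bar>d1 - d2\<bar>"
  obtains f g \<epsilon> where "smooth f" "periodic2pi f" "\<And>x. cmod (f x) = 1" "top_deg f = of_int d1"
    "smooth g" "periodic2pi g" "\<And>x. cmod (g x) = 1" "top_deg g = of_int d2"
    "\<bar>\<epsilon>\<bar> = (1::real)" "\<And>x. f x - g x = of_real \<epsilon> * (f0 (real n * x) - g0 (real n * x))"
proof -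
  obtain \<phi> where \<phi>: "smooth \<phi>" "\<And>x. f0 x = cis (\<phi> x)" using smooth_unit_lift[OF f0(1,3)] by blast
  obtain \<psi> where \<psi>: "smooth \<psi>" "\<And>x. g0 x = cis (\<psi> x)" using smooth_unit_lift[OF g0(1,3)] by blast
  have f': "f0 = (\<lambda>x. cis (\<phi> x))" and g': "g0 = (\<lambda>x. cis (\<psi> x))" using \<phi> \<psi> by auto
  have inc: "\<phi> (2*pi) - \<phi> 0 = 2*pi * of_int 1" "\<psi> (2*pi) - \<psi> 0 = 2*pi * of_int 0"
  proof -
    have "complex_of_real ((\<phi> (2*pi) - \<phi> 0) / (2*pi)) = complex_of_real 1" using top_deg_cis[OF \<phi>(1)] f0(4) f' by simp
    then have "(\<phi> (2*pi) - \<phi> 0) / (2*pi) = 1" by (simp only: of_real_eq_iff)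
    then show "\<phi> (2*pi) - \<phi> 0 = 2*pi * of_int 1" by (simp add: field_simps)
    have "complex_of_real ((\<psi> (2*pi) - \<psi> 0) / (2*pi)) = complex_of_real 0" using top_deg_cis[OF \<psi>(1)] g0(4) g' by simp
    then have "(\<psi> (2*pi) - \<psi> 0) / (2*pi) = 0" by (simp only: of_real_eq_iff)
    then show "\<psi> (2*pi) - \<psi> 0 = 2*pi * of_int 0" by simp
  qed
  have n1: "n \<ge> 1" using d n by simp
  \<comment> \<open>If x is within r of a multiple of 2 pi, then n x is within pi / 2 of one, where
    f0 and g0 coincide. The common factor may therefore wind on this arc without affecting the
    difference.\<close>
  define r where "r = pi / (2 * real n)"
  have r: "0 < r" "r < pi" using n1 by (auto simp: r_def field_simps)
  obtain P where P: "smooth P" "\<And>x. P (x + 2*pi) = P x + 2*pi" "\<And>x. cos x \<le> cos r \<Longrightarrow> \<exists>j::int. P x = 2*pi * of_int j"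
    using bump_phase[OF r] by metis
  define e where "e = min d1 d2"
  define F where "F = (\<lambda>x. cis (\<phi> (real n * x) + of_int e * P x))"
  define G where "G = (\<lambda>x. cis (\<psi> (real n * x) + of_int e * P x))"
  have perf: "periodic2pi (\<lambda>x. cis (\<phi> x))" "periodic2pi (\<lambda>x. cis (\<psi> x))" using f0(2) g0(2) f' g' by auto
  have F5: "F x = cis (\<phi> (real n * x)) * cis (of_int e * P x)" and G5: "G x = cis (\<psi> (real n * x)) * cis (of_int e * P x)" for x
    by (simp_all add: F_def G_def cis_mult)
  have unit: "cmod (F x) = 1" "cmod (G x) = 1" for x by (simp_all add: F_def G_def)
  note F = twisted_map[OF \<phi>(1) perf(1) inc(1) P(1,2), of n e, folded F_def]
  note G = twisted_map[OF \<psi>(1) perf(2) inc(2) P(1,2), of n e, folded G_def]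
  have FG: "F x - G x = f0 (real n * x) - g0 (real n * x)" for x
  proof (cases "cos x \<le> cos r")
    case True
    then obtain j :: int where "P x = 2*pi * of_int j" using P(3) by blast
    then have "cis (of_int e * P x) = cis (0 + 2*pi * of_int (e * j))" by (simp add: algebra_simps)
    also have "\<dots> = cis 0" by (rule cis_shift_int)
    finally have "cis (of_int e * P x) = 1" by simp
    then show ?thesis by (simp add: F5 G5 \<phi> \<psi>)
  next
    case False
    obtain j :: int where j: "\<bar>x - 0 - 2*pi * of_int j\<bar> \<le> pi" by (rule reduce_mod_2pi)
    have "cos (x - 0 - 2*pi * of_int j) = cos x" using cos_shift_int[of x "- j"] by simp
    then have "cos r \<le> cos (x - 0 - 2*pi * of_int j)" using False by linarith
    then have "\<bar>x - 0 - 2*pi * of_int j\<bar> \<le> r" using abs_le_of_cos_le[OF j less_imp_le[OF r(1)]] by blast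
    then have "real n * \<bar>x - 2*pi * of_int j\<bar> \<le> real n * r" by (intro mult_left_mono) auto
    also have "real n * r = pi / 2" using n1 by (simp add: r_def)
    finally have "\<bar>real n * (x - 2*pi * of_int j)\<bar> \<le> pi / 2" by (simp add: abs_mult)
    then have "0 \<le> cos (real n * (x - 2*pi * of_int j))" by (intro cos_ge_zero) auto
    also have "cos (real n * (x - 2*pi * of_int j)) = cos (real n * x)"
      using cos_shift_int[of "real n * x" "- (int n * j)"] by (simp add: algebra_simps)
    finally have "f0 (real n * x) = g0 (real n * x)" by (rule eq)
    then show ?thesis by (simp add: F5 G5 \<phi> \<psi>)
  qed
  show ?thesis
  proof (cases "d2 < d1")
    case True
    then have "int n * 1 + e = d1" "int n * 0 + e = d2" using n by (auto simp: e_def)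
    then have "top_deg F = of_int d1" "top_deg G = of_int d2" using F(4) G(4) by (simp_all only:)
    then show ?thesis by (intro that[of F G 1] F(1,2) G(1,2) unit) (simp_all add: FG)
  next
    case False
    then have "int n * 1 + e = d2" "int n * 0 + e = d1" using n d by (auto simp: e_def)
    then have "top_deg F = of_int d2" "top_deg G = of_int d1" using F(4) G(4) by (simp_all only:)
    then show ?thesis by (intro that[of G F "-1"] F(1,2) G(1,2) unit) (simp_all add: FG[symmetric])
  qed
qed

subsection \<open>Norms of smooth functions\<close>

lemma scaled_derivs:
  fixes D :: "nat \<Rightarrow> real \<Rightarrow> complex" and N :: real and c \<epsilon> :: complex
  assumes D: "\<And>k t. (D k has_vector_derivative D (Suc k) t) (at t)"
  defines "E \<equiv> (\<lambda>j x. \<epsilon> * of_real (N ^ j) * D j (N * x) - (if j = 0 then c else 0))"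
  shows "(E k has_vector_derivative E (Suc k) t) (at t)"
proof -
  have "((\<lambda>x. N * x) has_vector_derivative N) (at t)"
    by (auto intro!: derivative_eq_intros simp: has_real_derivative_iff_has_vector_derivative[symmetric])
  from vector_diff_chain_at[OF this D]
  have "((\<lambda>x. D k (N * x)) has_vector_derivative N *\<^sub>R D (Suc k) (N * t)) (at t)" by (simp add: o_def)
  from has_vector_derivative_diff_const[THEN iffD2, OF has_vector_derivative_mult_right[OF this, of "\<epsilon> * of_real (N ^ k)"], of "if k = 0 then c else 0"]
  show ?thesis by (simp add: E_def scaleR_conv_of_real mult_ac)
qed

text \<open>The j-th derivative grows like n^j with j <= k <= s, which settles the L^p terms. The
  Gagliardo term comes from \<open>Gag_pow_le\<close>, as \<open>Gag_pow_scale_le\<close> would lose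
  a factor n. The bound is uniform in c because c will be the mean of the function, which depends on
  n.\<close>

lemma Wsp_pow_scaled_le:
  fixes D :: "nat \<Rightarrow> real \<Rightarrow> complex"
  assumes s: "0 < s" and p: "1 \<le> p" and D: "\<And>k t. (D k has_vector_derivative D (Suc k) t) (at t)" and per: "periodic2pi (D 0)"
    and M0: "\<And>x. cmod (D 0 x) \<le> M0"
  obtains C where "0 < C" "\<And>n \<epsilon> c. 1 \<le> n \<Longrightarrow> cmod \<epsilon> \<le> 1 \<Longrightarrow> cmod c \<le> M0 \<Longrightarrow>
     Wsp_pow s p (\<lambda>j x. \<epsilon> * of_real (real n ^ j) * D j (real n * x) - (if j = 0 then c else 0)) \<le> ennreal (C * real n powr (s * p))"
proof -
  define k where "k = nat \<lfloor>s\<rfloor>"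
  define \<sigma> where "\<sigma> = s - of_int \<lfloor>s\<rfloor>"
  have ks: "real k = of_int \<lfloor>s\<rfloor>" "real k + \<sigma> = s" "0 \<le> \<sigma>" "\<sigma> < 1" using s by (auto simp: k_def \<sigma>_def) linarith+
  have sm: "smooth (D j)" for j by (rule derivs_imp_smooth[of D]) (rule D)
  have pr: "periodic2pi (D j)" for j
  proof (induction j)
    case (Suc j) then show ?case using periodic_derivative D by blast
  qed (rule per)
  have "\<exists>M>0. \<forall>x. cmod (D j x) \<le> M" for j using smooth_periodic_bounded[OF sm pr, of j] by metis
  then obtain M' where M': "\<And>j. M' j > 0" "\<And>j x. cmod (D j x) \<le> M' j" by metis
  define M where "M = (\<lambda>j. M' j + \<bar>M0\<bar>)"
  have M: "M j > 0" "cmod (D j x) \<le> M j" "M0 \<le> M j" for j x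
    using M'(1)[of j] M'(2)[of j x] abs_ge_zero[of M0] abs_ge_self[of M0] unfolding M_def by linarith+
  obtain L where L: "L > 0" "\<And>x y. cmod (D k x - D k y) \<le> L * \<bar>x - y\<bar>"
    using smooth_periodic_lipschitz[OF sm pr, of k] by metis
  define C1 where "C1 = (\<Sum>j\<le>k. 2*pi * (2 * M j) powr p)"
  define C2 where "C2 = Gag_const \<sigma> p * ((2 * M k) powr (p * (1 - \<sigma>)) * L powr (p * \<sigma>))"
  have C1: "C1 \<ge> 0" unfolding C1_def by (intro sum_nonneg) auto
  have "Wsp_pow s p (\<lambda>j x. \<epsilon> * of_real (real n ^ j) * D j (real n * x) - (if j = 0 then c else 0)) \<le> ennreal ((C1 + \<bar>C2\<bar> + 1) * real n powr (s * p))"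
    if n: "1 \<le> n" and \<epsilon>: "cmod \<epsilon> \<le> 1" and c: "cmod c \<le> M0" for n \<epsilon> c
  proof -
    define E where "E = (\<lambda>j x. \<epsilon> * of_real (real n ^ j) * D j (real n * x) - (if j = 0 then c else 0))"
    have np: "real n ^ j = real n powr real j" for j using n by (simp add: powr_realpow)
    have Lp: "Lp_pow p (E j) \<le> ennreal (2*pi * (2 * M j) powr p * real n powr (s * p))" if "j \<le> k" for j
    proof -
      have "cmod (E j x) \<le> 2 * M j * real n powr real j" for x
      proof -
        have "cmod (\<epsilon> * of_real (real n ^ j) * D j (real n * x)) = cmod \<epsilon> * (real n ^ j * cmod (D j (real n * x)))"
          by (simp add: norm_mult norm_power)
        also have "\<dots> \<le> 1 * (real n ^ j * M j)" using \<epsilon> M by (intro mult_mono mult_left_mono) auto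
        finally have 1: "cmod (\<epsilon> * of_real (real n ^ j) * D j (real n * x)) \<le> M j * real n ^ j" by (simp add: mult.commute)
        have "1 \<le> real n ^ j" using n by (simp add: one_le_power)
        then have "cmod (if j = 0 then c else 0) \<le> M j * real n ^ j"
          using M(1)[of j] M(3)[of j] c by auto
        then show ?thesis unfolding E_def np[symmetric]
          using 1 norm_triangle_ineq4[of "\<epsilon> * of_real (real n ^ j) * D j (real n * x)" "if j = 0 then c else 0"] by simp
      qed
      then have "Lp_pow p (E j) \<le> ennreal (2*pi * (2 * M j * real n powr real j) powr p)"
        using p by (intro Lp_pow_le) auto
      also have "\<dots> \<le> ennreal (2*pi * (2 * M j) powr p * real n powr (s * p))"
      proof (rule ennreal_leI)
        have "real j * p \<le> s * p" using that ks p by (intro mult_right_mono) auto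
        then have "(real n powr real j) powr p \<le> real n powr (s * p)" using n by (simp add: powr_powr powr_mono)
        then show "2*pi * (2 * M j * real n powr real j) powr p \<le> 2*pi * (2 * M j) powr p * real n powr (s * p)"
          unfolding powr_mult[of "2 * M j"] by (simp add: mult_left_mono)
      qed
      finally show ?thesis .
    qed
    have Lps: "(\<Sum>j\<le>k. Lp_pow p (E j)) \<le> ennreal (C1 * real n powr (s * p))"
    proof -
      have "(\<Sum>j\<le>k. Lp_pow p (E j)) \<le> (\<Sum>j\<le>k. ennreal (2*pi * (2 * M j) powr p * real n powr (s * p)))"
        by (intro sum_mono Lp) auto
      also have "\<dots> = ennreal (C1 * real n powr (s * p))"
        by (simp add: C1_def sum_distrib_right)
      finally show ?thesis .
    qed
    have Gag: "Gag_pow \<sigma> p (E k) \<le> ennreal (C2 * real n powr (s * p))" if \<sigma>0: "\<sigma> > 0"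
    proof -
      \<comment> \<open>A and B bound the oscillation and the Lipschitz constant; interpolation
        gives n to the power k p (1 - \<sigma>) + (k + 1) p \<sigma> = (k + \<sigma>) p = s
        p.\<close>
      define A where "A = 2 * M k * real n powr real k"
      define B where "B = L * real n powr (real k + 1)"
      have diff: "cmod (E k x - E k y) \<le> real n powr real k * cmod (D k (real n * x) - D k (real n * y))" for x y
      proof -
        have "cmod (E k x - E k y) = cmod \<epsilon> * (real n ^ k * cmod (D k (real n * x) - D k (real n * y)))"
          by (simp add: E_def right_diff_distrib[symmetric] norm_mult norm_power)
        also have "\<dots> \<le> 1 * (real n ^ k * cmod (D k (real n * x) - D k (real n * y)))"
          using \<epsilon> by (intro mult_right_mono) auto
        finally show ?thesis by (simp add: np)
      qed
      have "Gag_pow \<sigma> p (E k) \<le> ennreal (Gag_const \<sigma> p * (A powr (p * (1 - \<sigma>)) * B powr (p * \<sigma>)))"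
      proof (rule Gag_pow_le)
        show "0 < A" "0 < B" using M[of k] L n by (auto simp: A_def B_def)
        show "periodic2pi (E k)" using periodic2pi_scale[OF pr, of k n] by (simp add: periodic2pi_def E_def)
        show "cmod (E k x - E k y) \<le> A" for x y
        proof -
          have "cmod (D k (real n * x) - D k (real n * y)) \<le> 2 * M k"
            using norm_triangle_ineq4[of "D k (real n * x)" "D k (real n * y)"] M(2)[of k "real n * x"] M(2)[of k "real n * y"] by linarith
          then have "real n powr real k * cmod (D k (real n * x) - D k (real n * y)) \<le> real n powr real k * (2 * M k)"
            by (intro mult_left_mono) auto
          then show ?thesis using diff[of x y] by (simp add: A_def mult_ac)
        qed
        show "cmod (E k x - E k y) \<le> B * \<bar>x - y\<bar>" for x y
        proof -
          have "cmod (D k (real n * x) - D k (real n * y)) \<le> L * (real n * \<bar>x - y\<bar>)"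
            using L(2)[of "real n * x" "real n * y"] by (simp add: right_diff_distrib[symmetric] abs_mult)
          then have "real n powr real k * cmod (D k (real n * x) - D k (real n * y)) \<le> real n powr real k * (L * (real n * \<bar>x - y\<bar>))"
            by (intro mult_left_mono) auto
          also have "\<dots> = B * \<bar>x - y\<bar>" using n by (simp add: B_def powr_add)
          finally show ?thesis using diff[of x y] by simp
        qed
      qed (use \<sigma>0 ks p in auto)
      also have "A powr (p * (1 - \<sigma>)) * B powr (p * \<sigma>) = (2 * M k) powr (p * (1 - \<sigma>)) * L powr (p * \<sigma>) * real n powr (s * p)"
      proof -
        have "A powr (p * (1 - \<sigma>)) = (2 * M k) powr (p * (1 - \<sigma>)) * real n powr (real k * (p * (1 - \<sigma>)))"
          unfolding A_def powr_mult[of "2 * M k"] powr_powr ..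
        moreover have "B powr (p * \<sigma>) = L powr (p * \<sigma>) * real n powr ((real k + 1) * (p * \<sigma>))"
          unfolding B_def powr_mult powr_powr ..
        moreover have "real n powr (real k * (p * (1 - \<sigma>))) * real n powr ((real k + 1) * (p * \<sigma>)) = real n powr (s * p)"
          unfolding powr_add[symmetric] ks(2)[symmetric] by (simp add: algebra_simps)
        ultimately show ?thesis by (simp add: mult_ac)
      qed
      finally show ?thesis by (simp add: C2_def mult_ac)
    qed
    have "Wsp_pow s p E \<le> ennreal (C1 * real n powr (s * p)) + ennreal (\<bar>C2\<bar> * real n powr (s * p))"
    proof -
      have "(if s - of_int \<lfloor>s\<rfloor> > 0 then Gag_pow (s - of_int \<lfloor>s\<rfloor>) p (E (nat \<lfloor>s\<rfloor>)) else 0) \<le> ennreal (\<bar>C2\<bar> * real n powr (s * p))"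
        using Gag unfolding \<sigma>_def[symmetric] k_def[symmetric]
        by (auto intro: order_trans[OF _ ennreal_leI[OF mult_right_mono]])
      then show ?thesis unfolding Wsp_pow_def using Lps unfolding k_def[symmetric] by (intro add_mono) auto
    qed
    also have "\<dots> = ennreal ((C1 + \<bar>C2\<bar>) * real n powr (s * p))"
      using C1 by (simp add: ennreal_plus[symmetric] distrib_right del: ennreal_plus)
    also have "\<dots> \<le> ennreal ((C1 + \<bar>C2\<bar> + 1) * real n powr (s * p))"
      by (intro ennreal_leI mult_right_mono) auto
    finally show ?thesis unfolding E_def .
  qed
  then show ?thesis using C1 by (intro that[of "C1 + \<bar>C2\<bar> + 1"]) auto
qed

text \<open>The case n = 1, \<epsilon> = 1, c = 0 of the preceding estimate.\<close>

lemma smooth_Wsp_pow_finite: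
  assumes "0 < s" "1 \<le> p" "\<And>k t. (D k has_vector_derivative D (Suc k) t) (at t)" "periodic2pi (D 0)"
  shows "Wsp_pow s p D < \<infinity>"
proof -
  obtain M where M: "M > 0" "\<And>x. cmod (D 0 x) \<le> M"
    using smooth_periodic_bounded[OF derivs_imp_smooth[of D] assms(4)] assms(3) by blast
  obtain C where C: "0 < C" "\<And>n \<epsilon> c. 1 \<le> n \<Longrightarrow> cmod \<epsilon> \<le> 1 \<Longrightarrow> cmod c \<le> M \<Longrightarrow>
     Wsp_pow s p (\<lambda>j x. \<epsilon> * of_real (real n ^ j) * D j (real n * x) - (if j = 0 then c else 0)) \<le> ennreal (C * real n powr (s * p))"
    by (rule Wsp_pow_scaled_le[where D=D, OF assms M(2)]) (rule that; assumption)
  from C(2)[of 1 1 0] M(1) have "Wsp_pow s p D \<le> ennreal C" by simp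
  then show ?thesis using order_le_less_trans by fastforce
qed

lemma S1_mean_bound:
  assumes "continuous_on UNIV h" "\<And>x. cmod (h x) \<le> M"
  shows "cmod (S1_mean h) \<le> M"
proof -
  have "(LINT x:{0..2*pi}|lebesgue. h x) = integral {0..2*pi} h"
    by (intro set_lebesgue_integral_eq_integral set_integrable_continuous assms)
  moreover have "cmod (integral {0..2*pi} h) \<le> M * (2*pi - 0)"
    using assms by (intro integral_bound) (auto intro: continuous_on_subset)
  ultimately show ?thesis by (simp add: S1_mean_def norm_divide norm_mult field_simps)
qed

lemma Wsp_norm_zero:
  assumes p: "1 \<le> p" shows "Wsp_norm s p (\<lambda>x. 0) = 0"
proof -
  have "weak_derivs (nat \<lfloor>s\<rfloor>) (\<lambda>x. 0) (\<lambda>j x. if j = 0 then 0 else 0)" by (rule weak_derivs_const)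
  moreover have "Wsp_pow s p (\<lambda>j x. if j = 0 then 0 else 0) = 0"
    using p by (simp add: Wsp_pow_def Lp_pow_def Gag_pow_def)
  ultimately show ?thesis using Wsp_norm_eq[of s "\<lambda>x. 0" _ p] by simp
qed

text \<open>A smooth map is approximated by the constant sequence equal to itself.\<close>

lemma smooth_in_Edeg:
  assumes s: "0 < s" and p: "1 \<le> p" and f: "smooth f" "periodic2pi f" "\<And>x. cmod (f x) = 1" "top_deg f = of_int d"
  shows "f \<in> Edeg s p d"
proof -
  obtain D where D: "D 0 = f" "\<And>k t. (D k has_vector_derivative D (Suc k) t) (at t)"
    using smooth_derivs[OF f(1)] by metis
  have "weak_derivs (nat \<lfloor>s\<rfloor>) f D" using weak_derivs_classical[of D] D f(2) by simp
  moreover have "Wsp_pow s p D < \<infinity>" using smooth_Wsp_pow_finite[where D=D, OF s p D(2)] D(1) f(2) by simp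
  ultimately have W: "f \<in> Wsp s p" using f(2) by (auto simp: Wsp_def)
  have "(\<lambda>n::nat. Wsp_norm s p (\<lambda>x. f x - f x)) \<longlonglongrightarrow> 0" using Wsp_norm_zero[OF p] by simp
  then show ?thesis unfolding Edeg_def WspS1_def using W f
    by (auto simp: smooth_periodic_iff intro!: exI[of _ "\<lambda>n. f"])
qed

text \<open>The witness is x -> e^(i d x). Nonemptiness is essential: a real infimum over the empty
  set would carry no information.\<close>

lemma Edeg_nonempty:
  assumes "0 < s" "1 \<le> p" shows "Edeg s p d \<noteq> {}"
proof -
  have s: "smooth (\<lambda>x. of_int d * x :: real)" by (intro smooth_intros)
  have "(\<lambda>x. cis (of_int d * x)) \<in> Edeg s p d"
  proof (rule smooth_in_Edeg[OF assms])
    show "smooth (\<lambda>x. cis (of_int d * x))" by (rule smooth_cis[OF s])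
    show "periodic2pi (\<lambda>x. cis (of_int d * x))"
      unfolding periodic2pi_def
    proof
      fix x
      have "cis (of_int d * (x + 2*pi)) = cis (of_int d * x + 2*pi * of_int d)" by (simp add: algebra_simps)
      also have "\<dots> = cis (of_int d * x)" by (rule cis_shift_int)
      finally show "cis (of_int d * (x + 2*pi)) = cis (of_int d * x)" .
    qed
    show "top_deg (\<lambda>x. cis (of_int d * x)) = of_int d" using top_deg_cis[OF s] by simp
  qed simp
  then show ?thesis by blast
qed

section \<open>The distance between degree classes\<close>

lemma Wsp_seminorm_nonneg: "0 \<le> Wsp_seminorm s p h"
  by (simp add: Wsp_seminorm_def Wsp_norm_def)

lemma dist_E_le:
  assumes "f \<in> Edeg s p d1" "g \<in> Edeg s p d2"
  shows "dist_E s p d1 d2 \<le> Wsp_seminorm s p (\<lambda>x. f x - g x)"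
proof -
  have b: "bdd_below ((\<lambda>g. Wsp_seminorm s p (\<lambda>x. f x - g x)) ` Edeg s p d2)" for f
    by (rule bdd_belowI[of _ 0]) (auto simp: Wsp_seminorm_nonneg)
  have "dist_E s p d1 d2 \<le> (INF g\<in>Edeg s p d2. Wsp_seminorm s p (\<lambda>x. f x - g x))"
    unfolding dist_E_def
  proof (rule cINF_lower[OF bdd_belowI[of _ 0] assms(1)])
    fix y assume "y \<in> (\<lambda>f. INF g\<in>Edeg s p d2. Wsp_seminorm s p (\<lambda>x. f x - g x)) ` Edeg s p d1"
    then obtain f where "y = (INF g\<in>Edeg s p d2. Wsp_seminorm s p (\<lambda>x. f x - g x))" by blast
    then show "0 \<le> y" using assms(2) by (auto intro!: cINF_greatest simp: Wsp_seminorm_nonneg)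
  qed
  also have "\<dots> \<le> Wsp_seminorm s p (\<lambda>x. f x - g x)" by (rule cINF_lower[OF b assms(2)])
  finally show ?thesis .
qed

lemma dist_E_ge:
  assumes "0 < s" "1 \<le> p" "\<And>f g. f \<in> Edeg s p d1 \<Longrightarrow> g \<in> Edeg s p d2 \<Longrightarrow> m \<le> Wsp_seminorm s p (\<lambda>x. f x - g x)"
  shows "m \<le> dist_E s p d1 d2"
  unfolding dist_E_def using assms Edeg_nonempty by (intro cINF_greatest) auto

lemma dist_E_nonneg: "0 < s \<Longrightarrow> 1 \<le> p \<Longrightarrow> 0 \<le> dist_E s p d1 d2"
  by (rule dist_E_ge) (auto simp: Wsp_seminorm_nonneg)

lemma dist_E_same:
  assumes "0 < s" "1 \<le> p" shows "dist_E s p d d = 0"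
proof -
  obtain f where f: "f \<in> Edeg s p d" using Edeg_nonempty[OF assms] by blast
  have m: "S1_mean (\<lambda>x. 0) = 0" by (simp add: S1_mean_def)
  have "Wsp_seminorm s p (\<lambda>x. f x - f x) = 0" using Wsp_norm_zero[OF assms(2)] by (simp add: Wsp_seminorm_def m)
  then show ?thesis using dist_E_le[OF f f] dist_E_nonneg[OF assms, of d d] by simp
qed

lemma Wsp_seminorm_scaled:
  fixes D :: "nat \<Rightarrow> real \<Rightarrow> complex"
  assumes s: "0 < s" and p: "1 \<le> p" and D: "\<And>k t. (D k has_vector_derivative D (Suc k) t) (at t)" and per: "periodic2pi (D 0)"
    and h: "\<And>x. h x = \<epsilon> * D 0 (real n * x)"
  shows "Wsp_seminorm s p h = enn2real (Wsp_pow s p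
     (\<lambda>j x. \<epsilon> * of_real (real n ^ j) * D j (real n * x) - (if j = 0 then S1_mean h else 0))) powr (1/p)"
proof -
  define E where "E = (\<lambda>j x. \<epsilon> * of_real (real n ^ j) * D j (real n * x) - (if j = 0 then S1_mean h else 0))"
  have E: "(E k has_vector_derivative E (Suc k) t) (at t)" for k t
    unfolding E_def by (rule scaled_derivs[where D=D]) (rule D)
  have E0: "E 0 = (\<lambda>x. h x - S1_mean h)" by (auto simp: E_def h)
  have pE: "periodic2pi (E 0)" using periodic2pi_scale[OF per, of n] by (simp add: periodic2pi_def E_def)
  have "weak_derivs (nat \<lfloor>s\<rfloor>) (\<lambda>x. h x - S1_mean h) E" using weak_derivs_classical[where D=E, OF pE E] E0 by simp
  then show ?thesis unfolding Wsp_seminorm_def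
    using Wsp_norm_eq smooth_Wsp_pow_finite[where D=E, OF s p E pE] unfolding E_def by blast
qed

text \<open>The initial pair is g0 = 1 and f0 = cis P, where P moves only on the half circle cos x <
  0. After realising the degrees the difference is \<epsilon> (f0 - 1) at n x, with p-th power
  energy at most C n^(s p), and the p-th root gives n^s.\<close>

lemma dist_E_upper:
  assumes s: "0 < s" and p: "1 \<le> p"
  obtains C where "0 < C" "\<And>d1 d2 :: int. dist_E s p d1 d2 \<le> C * \<bar>real_of_int (d1 - d2)\<bar> powr s"
proof -
  define \<rho> where "\<rho> = (\<lambda>x. flat_exp 0 (- cos x))"
  have sm: "smooth \<rho>" unfolding \<rho>_def by (intro smooth_intros)
  have per: "\<rho> (x + 2*pi) = \<rho> x" and nn: "0 \<le> \<rho> x" for x by (simp_all add: \<rho>_def flat_exp_nonneg)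
  have pos: "0 < \<rho> pi" by (simp add: \<rho>_def flat_exp_pos_iff)
  obtain P c where P: "smooth P" "c > 0" "\<And>t. (P has_real_derivative c * \<rho> t) (at t)"
    "\<And>x. P (x + 2*pi) = P x + 2*pi" "P 0 = 0"
    by (rule phase_exists[OF sm per nn pos]) (rule that; assumption)
  define f0 where "f0 = (\<lambda>x. cis (P x))"
  have f0: "smooth f0" unfolding f0_def by (intro smooth_cis P)
  have perf: "periodic2pi f0" by (simp add: f0_def periodic2pi_def P(4) cis.ctr)
  have deg: "top_deg f0 = 1" using top_deg_cis[OF P(1)] P(4)[of 0] by (simp add: f0_def)
  have one: "f0 x = 1" if c: "cos x \<ge> 0" for x
  proof -
    have z: "\<rho> y = 0" if "\<bar>y - 0\<bar> \<le> pi/2" for y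
    proof -
      have "0 \<le> cos y" using that by (intro cos_ge_zero) auto
      then show ?thesis by (simp add: \<rho>_def flat_exp_eq_0)
    qed
    obtain j :: int where j: "\<bar>x - 0 - 2*pi * of_int j\<bar> \<le> pi" by (rule reduce_mod_2pi)
    have "cos (x - 0 - 2*pi * of_int j) = cos x" using cos_shift_int[of x "- j"] by simp
    then have "cos (pi/2) \<le> cos (x - 0 - 2*pi * of_int j)" unfolding cos_pi_half using c by linarith
    then have "\<bar>x - 0 - 2*pi * of_int j\<bar> \<le> pi/2" using abs_le_of_cos_le[OF j, of "pi/2"] pi_ge_zero by simp
    from phase_const[OF P(3,4,5) z this] have "f0 x = cis (0 + 2*pi * of_int j)" by (simp add: f0_def)
    also have "\<dots> = cis 0" by (rule cis_shift_int)
    finally show ?thesis by simp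
  qed
  define w where "w = (\<lambda>x. f0 x - 1)"
  have w: "smooth w" unfolding w_def by (intro smooth_intros f0)
  have pw: "periodic2pi w" using perf by (simp add: w_def periodic2pi_def)
  obtain D where D: "D 0 = w" "\<And>k t. (D k has_vector_derivative D (Suc k) t) (at t)" using smooth_derivs[OF w] by metis
  have M0: "cmod (D 0 x) \<le> 2" for x
    using norm_triangle_ineq4[of "f0 x" 1] by (simp add: D(1) w_def f0_def)
  obtain C where C: "0 < C" "\<And>n \<epsilon> c. 1 \<le> n \<Longrightarrow> cmod \<epsilon> \<le> 1 \<Longrightarrow> cmod c \<le> 2 \<Longrightarrow>
     Wsp_pow s p (\<lambda>j x. \<epsilon> * of_real (real n ^ j) * D j (real n * x) - (if j = 0 then c else 0)) \<le> ennreal (C * real n powr (s * p))"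
    by (rule Wsp_pow_scaled_le[where D=D, OF s p D(2) pw[folded D(1)] M0]) (rule that; assumption)
  have "dist_E s p d1 d2 \<le> C powr (1/p) * \<bar>real_of_int (d1 - d2)\<bar> powr s" for d1 d2 :: int
  proof (cases "d1 = d2")
    case True then show ?thesis using dist_E_same[OF s p] by simp
  next
    case False
    define n where "n = nat \<bar>d1 - d2\<bar>"
    have n: "1 \<le> n" "real n = \<bar>real_of_int (d1 - d2)\<bar>" using False by (auto simp: n_def)
    have one': "smooth (\<lambda>x::real. 1 :: complex)" "periodic2pi (\<lambda>x. 1)" "top_deg (\<lambda>x. 1) = 0"
      using top_deg_cis[OF smooth_const[of 0]] by (auto intro: smooth_const simp: periodic2pi_def)
    have fu: "cmod (f0 x) = 1" and gu: "cmod 1 = 1" for x by (simp_all add: f0_def)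
    obtain f g \<epsilon> where fg: "smooth f" "periodic2pi f" "\<And>x. cmod (f x) = 1" "top_deg f = of_int d1"
      "smooth g" "periodic2pi g" "\<And>x. cmod (g x) = 1" "top_deg g = of_int d2"
      and \<epsilon>: "\<bar>\<epsilon>\<bar> = (1::real)" and h: "\<And>x. f x - g x = of_real \<epsilon> * (f0 (real n * x) - 1)"
      by (rule realize_pair[OF f0 perf fu deg one'(1,2) gu one'(3) _ False n_def]) (erule one, rule that, assumption+)
    define H where "H = (\<lambda>x. f x - g x)"
    have HD: "H x = of_real \<epsilon> * D 0 (real n * x)" for x by (simp add: H_def h D(1) w_def)
    have "cmod (S1_mean H) \<le> 2"
    proof (rule S1_mean_bound)
      show "continuous_on UNIV H" unfolding H_def by (intro smooth_continuous_on smooth_diff fg)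
      show "cmod (H x) \<le> 2" for x using M0[of "real n * x"] \<epsilon> by (simp add: HD norm_mult)
    qed
    then have "Wsp_pow s p (\<lambda>j x. of_real \<epsilon> * of_real (real n ^ j) * D j (real n * x) - (if j = 0 then S1_mean H else 0)) \<le> ennreal (C * real n powr (s * p))"
      using \<epsilon> n by (intro C) auto
    then have "enn2real (Wsp_pow s p (\<lambda>j x. of_real \<epsilon> * of_real (real n ^ j) * D j (real n * x) - (if j = 0 then S1_mean H else 0))) \<le> C * real n powr (s * p)"
      using C(1) by (intro enn2real_leI) auto
    then have "Wsp_seminorm s p H \<le> (C * real n powr (s * p)) powr (1/p)"
      unfolding Wsp_seminorm_scaled[where D=D, OF s p D(2) pw[folded D(1)] HD] using p by (intro powr_mono2) auto
    also have "\<dots> = C powr (1/p) * real n powr s" using p by (simp add: powr_mult powr_powr)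
    finally show ?thesis
      using dist_E_le[OF smooth_in_Edeg[OF s p fg(1-4)] smooth_in_Edeg[OF s p fg(5-8)]] n(2) unfolding H_def by simp
  qed
  then show ?thesis using that[of "C powr (1/p)"] C(1) by simp
qed

subsection \<open>The critical case\<close>

text \<open>For t > 1 apply ln y <= y - 1 to y = t^(1/p); the surplus -p absorbs the ln 2 from 1 + t
  <= 2 t. The power 1/p is chosen so that raising to p - 1 gives the exponent (p - 1) / p < 1, an
  integrable singularity.\<close>

lemma ln_one_plus_le_powr:
  fixes t p :: real
  assumes t: "0 < t" and p: "1 \<le> p" shows "ln (1 + t) \<le> p * t powr (1/p)"
proof (cases "t \<le> 1")
  case True
  have "ln (1 + t) \<le> t" using t ln_add_one_self_le_self[of t] by simp
  also have "t = t powr 1" using t by simp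
  also have "\<dots> \<le> t powr (1/p)" using t True p by (intro powr_mono') auto
  also have "\<dots> \<le> p * t powr (1/p)" using p by (simp add: mult_le_cancel_right1)
  finally show ?thesis .
next
  case False
  have "ln (1 + t) \<le> ln (2 * t)" using False by (subst ln_le_cancel_iff) auto
  also have "\<dots> = ln 2 + ln t" using False by (simp add: ln_mult)
  also have "ln t = p * ln (t powr (1/p))" using False p by (simp add: ln_powr)
  also have "\<dots> \<le> p * (t powr (1/p) - 1)" using False p ln_le_minus_one[of "t powr (1/p)"] by (intro mult_left_mono) auto
  finally show ?thesis using p ln_2_less_1 by (simp add: right_diff_distrib)
qed

text \<open>\<open>\<alpha> r - \<alpha> s\<close> is the integral of m over \<open>[r, s]\<close>; exchanging the order of integration leaves, for each \<open>\<tau>\<close>,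
  the scale invariant integral of \<open>(s - r)^(\<beta> - 2) r^(-\<beta>)\<close> over \<open>r < \<tau> < s\<close>.\<close>
lemma log_energy:
  fixes \<alpha> m :: "real \<Rightarrow> real"
  assumes p: "1 < p" and \<kappa>: "0 < \<kappa>" and m: "continuous_on UNIV m" "\<And>t. 0 \<le> m t"
    and d\<alpha>: "\<And>r. (\<alpha> has_real_derivative - m r) (at r)"
    and osc: "\<And>r s. 0 < r \<Longrightarrow> r < s \<Longrightarrow> s \<le> pi \<Longrightarrow> \<alpha> r - \<alpha> s \<le> \<kappa> * ln (s / r)"
    and tot: "\<alpha> 0 - \<alpha> pi \<le> B" and \<beta>: "\<beta> = (p - 1) / p"
  shows "(\<integral>\<^sup>+r. \<integral>\<^sup>+s. ennreal (if 0 < r \<and> r < s \<and> s \<le> pi then (\<alpha> r - \<alpha> s) powr p / (s - r)\<^sup>2 else 0) \<partial>lborel \<partial>lborel)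
    \<le> ennreal ((\<kappa> * p) powr (p - 1) * ((1 / (1 - \<beta>) + 1 / \<beta>) / (1 - \<beta>) * B))"
proof -
  have \<beta>01: "0 < \<beta>" "\<beta> < 1" using p by (auto simp: \<beta> field_simps)
  define K where "K = (\<kappa> * p) powr (p - 1)"
  have K: "0 \<le> K" by (simp add: K_def)
  have [measurable]: "m \<in> borel_measurable borel" using m(1) by (simp add: borel_measurable_continuous_onI)
  have c\<alpha>: "continuous_on UNIV \<alpha>" using d\<alpha> by (meson DERIV_isCont continuous_at_imp_continuous_on)
  then have [measurable]: "\<alpha> \<in> borel_measurable borel" by (simp add: borel_measurable_continuous_onI)
  have FTC: "(\<integral>\<^sup>+t. ennreal (m t) * indicator {r..s} t \<partial>lborel) = ennreal (\<alpha> r - \<alpha> s)" if "r \<le> s" for r s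
  proof -
    have "((\<lambda>t. - \<alpha> t) has_vector_derivative m t) (at t)" for t
      using DERIV_minus[OF d\<alpha>[of t]] by (simp add: has_real_derivative_iff_has_vector_derivative)
    then have "(m has_integral (- \<alpha> s - - \<alpha> r)) {r..s}"
      using that by (intro fundamental_theorem_of_calculus) (auto intro: has_vector_derivative_at_within)
    then have "integral {r..s} m = \<alpha> r - \<alpha> s" by (simp add: integral_unique)
    then show ?thesis using nn_integral_continuous_Icc[of r s m] m(2) continuous_on_subset[OF m(1), of "{r..s}"] by simp
  qed
  define H where "H = (\<lambda>r s t. ennreal (if 0 < r \<and> r \<le> t \<and> t \<le> s \<and> r < s \<and> s \<le> pi then m t * ((s - r) powr (\<beta> - 2) * r powr (- \<beta>)) else 0))"
  have pw: "ennreal (if 0 < r \<and> r < s \<and> s \<le> pi then (\<alpha> r - \<alpha> s) powr p / (s - r)\<^sup>2 else 0) \<le> ennreal K * (\<integral>\<^sup>+t. H r s t \<partial>lborel)" for r s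
  proof (cases "0 < r \<and> r < s \<and> s \<le> pi")
    case True
    define w where "w = (s - r) powr (\<beta> - 2) * r powr (- \<beta>)"
    have w: "0 \<le> w" by (simp add: w_def)
    define d where "d = \<alpha> r - \<alpha> s"
    have dn: "0 \<le> d" using DERIV_nonpos_imp_nonincreasing[of r s \<alpha>] d\<alpha> m(2) True by (force simp: d_def)
    have "d \<le> \<kappa> * ln (s / r)" using osc True by (simp add: d_def)
    also have "ln (s / r) = ln (1 + (s - r) / r)" using True by (simp add: field_simps)
    also have "\<dots> \<le> p * ((s - r) / r) powr (1/p)" using True p by (intro ln_one_plus_le_powr) auto
    finally have dle: "d \<le> \<kappa> * p * ((s - r) / r) powr (1/p)" using \<kappa> by (simp add: mult_left_mono mult.assoc)
    \<comment> \<open>Only p - 1 of the p factors are estimated by the logarithm; they produce the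
      small constant \<open>K\<close>. The remaining one is kept as an integral of m, whose total
      mass on [0, pi] is at most B.\<close>
    have "d powr p = d * d powr (p - 1)" using dn p by (cases "d = 0") (auto simp: powr_mult_base)
    also have "\<dots> \<le> d * (\<kappa> * p * ((s - r) / r) powr (1/p)) powr (p - 1)" using dn dle p by (intro mult_left_mono powr_mono2) auto
    also have "(\<kappa> * p * ((s - r) / r) powr (1/p)) powr (p - 1) = K * ((s - r) / r) powr \<beta>"
      unfolding K_def powr_mult[of "\<kappa> * p"] powr_powr by (simp add: \<beta>)
    also have "((s - r) / r) powr \<beta> = (s - r) powr \<beta> * r powr (- \<beta>)"
      using True powr_divide[of "s - r" r \<beta>] by (simp add: powr_minus_divide)
    finally have "d powr p / (s - r)\<^sup>2 \<le> d * (K * ((s - r) powr \<beta> * r powr (- \<beta>))) / (s - r)\<^sup>2" by (intro divide_right_mono) auto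
    also have "\<dots> = K * (w * d)"
    proof -
      have "(s - r) powr \<beta> = (s - r) powr (\<beta> - 2) * (s - r) powr 2" by (simp add: powr_add[symmetric])
      also have "(s - r) powr 2 = (s - r)\<^sup>2" using True by simp
      finally show ?thesis using True by (simp add: w_def)
    qed
    finally have 1: "d powr p / (s - r)\<^sup>2 \<le> K * (w * d)" .
    have "(\<integral>\<^sup>+t. H r s t \<partial>lborel) = (\<integral>\<^sup>+t. ennreal w * (ennreal (m t) * indicator {r..s} t) \<partial>lborel)"
      using True w by (intro nn_integral_cong) (auto simp: H_def w_def indicator_def ennreal_mult'[symmetric] mult_ac m(2))
    also have "\<dots> = ennreal w * (\<integral>\<^sup>+t. ennreal (m t) * indicator {r..s} t \<partial>lborel)" by (rule nn_integral_cmult) measurable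
    also have "\<dots> = ennreal (w * d)" using True w by (simp add: FTC d_def ennreal_mult')
    finally have "ennreal K * (\<integral>\<^sup>+t. H r s t \<partial>lborel) = ennreal (K * (w * d))" using K by (simp add: ennreal_mult')
    then show ?thesis using True 1 by (simp add: d_def ennreal_leI)
  qed (auto simp: H_def)
  have Hm [measurable]: "(\<lambda>(r, s, t). H r s t) \<in> borel_measurable (lborel \<Otimes>\<^sub>M lborel \<Otimes>\<^sub>M lborel)"
    unfolding H_def by measurable
  \<comment> \<open>At r = t the integral of (s - r)^(\<beta> - 2) up to s = r may diverge; this
    null set of r is left out.\<close>
  have inner_s: "(\<integral>\<^sup>+s. H r s t \<partial>lborel) \<le> ennreal (m t / (1 - \<beta>)) * ennreal (if 0 < r \<and> r < t \<and> t \<le> pi then r powr (- \<beta>) * (t - r) powr (\<beta> - 1) else 0)" if "r \<noteq> t" for r t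
  proof (cases "0 < r \<and> r < t \<and> t \<le> pi")
    case False
    then have "H r s t = 0" for s using that by (auto simp: H_def)
    then show ?thesis by simp
  next
    case True
    have "(\<integral>\<^sup>+s. H r s t \<partial>lborel) \<le> (\<integral>\<^sup>+s. ennreal (m t * r powr (- \<beta>)) * (ennreal ((s - r) powr (- (1 - \<beta>) - 1)) * indicator {t - r..} (s - r)) \<partial>lborel)"
      using True m(2)[of t] by (intro nn_integral_mono) (auto simp: H_def indicator_def ennreal_mult'[symmetric] mult_ac)
    also have "\<dots> = ennreal (m t * r powr (- \<beta>)) * (\<integral>\<^sup>+s. ennreal ((s - r) powr (- (1 - \<beta>) - 1)) * indicator {t - r..} (s - r) \<partial>lborel)"
      by (rule nn_integral_cmult) measurable
    also have "(\<integral>\<^sup>+s. ennreal ((s - r) powr (- (1 - \<beta>) - 1)) * indicator {t - r..} (s - r) \<partial>lborel)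
       = (\<integral>\<^sup>+s. ennreal (s powr (- (1 - \<beta>) - 1)) * indicator {t - r..} s \<partial>lborel)"
      using nn_integral_real_affine[of "\<lambda>s. ennreal (s powr (- (1 - \<beta>) - 1)) * indicator {t - r..} s" 1 "- r"] by (simp add: add.commute)
    also have "\<dots> = ennreal ((t - r) powr (- (1 - \<beta>)) / (1 - \<beta>))" using True \<beta>01 by (intro nn_integral_powr_inf) auto
    also have "ennreal (m t * r powr (- \<beta>)) * ennreal ((t - r) powr (- (1 - \<beta>)) / (1 - \<beta>)) = ennreal (m t / (1 - \<beta>)) * ennreal (r powr (- \<beta>) * (t - r) powr (\<beta> - 1))"
      using m(2)[of t] \<beta>01 by (simp add: ennreal_mult'[symmetric])
    finally show ?thesis using True by simp
  qed
  have inner_r: "(\<integral>\<^sup>+r. ennreal (if 0 < r \<and> r < t \<and> t \<le> pi then r powr (- \<beta>) * (t - r) powr (\<beta> - 1) else 0) \<partial>lborel)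
     \<le> ennreal (1 / (1 - \<beta>) + 1 / \<beta>) * indicator {0..pi} t" for t
  proof (cases "0 < t \<and> t \<le> pi")
    case False
    then have "(\<integral>\<^sup>+r. ennreal (if 0 < r \<and> r < t \<and> t \<le> pi then r powr (- \<beta>) * (t - r) powr (\<beta> - 1) else 0) \<partial>lborel) = (\<integral>\<^sup>+r. 0 \<partial>(lborel :: real measure))"
      by (intro nn_integral_cong) auto
    then show ?thesis by simp
  next
    case True
    \<comment> \<open>The two singularities, at r = 0 and r = t, are separated at the midpoint: on
      each half one of the two powers is bounded by its value at l.\<close>
    define l where "l = t / 2"
    have l: "l > 0" using True by (simp add: l_def)
    let ?a = "\<lambda>r. ennreal (l powr (\<beta> - 1)) * (ennreal (r powr ((1 - \<beta>) - 1)) * indicator {0..l} r)"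
    let ?b = "\<lambda>r. ennreal (l powr (- \<beta>)) * (ennreal (r powr (\<beta> - 1)) * indicator {0..l} r)"
    have pw: "ennreal (if 0 < r \<and> r < t \<and> t \<le> pi then r powr (- \<beta>) * (t - r) powr (\<beta> - 1) else 0) \<le> ?a r + ?b (t - r)" for r
    proof (cases "0 < r \<and> r < t")
      case True
      show ?thesis
      proof (cases "r \<le> l")
        case r: True
        have "(t - r) powr (\<beta> - 1) \<le> l powr (\<beta> - 1)" using r l \<beta>01 by (intro powr_mono2') (auto simp: l_def)
        then have "r powr (- \<beta>) * (t - r) powr (\<beta> - 1) \<le> l powr (\<beta> - 1) * r powr (- \<beta>)" by (simp add: mult.commute mult_left_mono)
        then have "ennreal (r powr (- \<beta>) * (t - r) powr (\<beta> - 1)) \<le> ?a r" using True r by (simp add: ennreal_mult'[symmetric] ennreal_leI)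
        then show ?thesis using True by (auto intro: add_increasing2)
      next
        case r: False
        have "r powr (- \<beta>) \<le> l powr (- \<beta>)" using r l \<beta>01 by (intro powr_mono2') auto
        then have "r powr (- \<beta>) * (t - r) powr (\<beta> - 1) \<le> l powr (- \<beta>) * (t - r) powr (\<beta> - 1)" by (simp add: mult_right_mono)
        then have "ennreal (r powr (- \<beta>) * (t - r) powr (\<beta> - 1)) \<le> ?b (t - r)" using True r by (simp add: ennreal_mult'[symmetric] ennreal_leI l_def)
        then show ?thesis using True by (auto intro: add_increasing)
      qed
    qed auto
    have "(\<integral>\<^sup>+r. ennreal (if 0 < r \<and> r < t \<and> t \<le> pi then r powr (- \<beta>) * (t - r) powr (\<beta> - 1) else 0) \<partial>lborel) \<le> (\<integral>\<^sup>+r. ?a r + ?b (t - r) \<partial>lborel)"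
      by (intro nn_integral_mono pw)
    also have "\<dots> = (\<integral>\<^sup>+r. ?a r \<partial>lborel) + (\<integral>\<^sup>+r. ?b (t - r) \<partial>lborel)" by (rule nn_integral_add) measurable
    also have "(\<integral>\<^sup>+r. ?b (t - r) \<partial>lborel) = (\<integral>\<^sup>+r. ?b r \<partial>lborel)" by (rule nn_integral_reflect) measurable
    also have "(\<integral>\<^sup>+r. ?b r \<partial>lborel) = ennreal (l powr (- \<beta>)) * ennreal (l powr \<beta> / \<beta>)"
      using l \<beta>01 by (subst nn_integral_cmult) (simp_all add: nn_integral_powr_0)
    also have "(\<integral>\<^sup>+r. ?a r \<partial>lborel) = ennreal (l powr (\<beta> - 1)) * (\<integral>\<^sup>+r. ennreal (r powr ((1 - \<beta>) - 1)) * indicator {0..l} r \<partial>lborel)"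
      by (rule nn_integral_cmult) measurable
    also have "(\<integral>\<^sup>+r. ennreal (r powr ((1 - \<beta>) - 1)) * indicator {0..l} r \<partial>lborel) = ennreal (l powr (1 - \<beta>) / (1 - \<beta>))"
      using l \<beta>01 by (intro nn_integral_powr_0) auto
    also have "ennreal (l powr (\<beta> - 1)) * ennreal (l powr (1 - \<beta>) / (1 - \<beta>)) + ennreal (l powr (- \<beta>)) * ennreal (l powr \<beta> / \<beta>) = ennreal (1 / (1 - \<beta>) + 1 / \<beta>)"
    proof -
      have "l powr (\<beta> - 1) * l powr (1 - \<beta>) = 1" "l powr (- \<beta>) * l powr \<beta> = 1" using l by (simp_all add: powr_add[symmetric])
      then show ?thesis using \<beta>01 by (simp add: ennreal_mult'[symmetric])
    qed
    finally show ?thesis using True by simp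
  qed
  have "(\<integral>\<^sup>+r. \<integral>\<^sup>+s. ennreal (if 0 < r \<and> r < s \<and> s \<le> pi then (\<alpha> r - \<alpha> s) powr p / (s - r)\<^sup>2 else 0) \<partial>lborel \<partial>lborel)
     \<le> (\<integral>\<^sup>+r. \<integral>\<^sup>+s. ennreal K * (\<integral>\<^sup>+t. H r s t \<partial>lborel) \<partial>lborel \<partial>lborel)"
    by (intro nn_integral_mono pw)
  also have "\<dots> = ennreal K * (\<integral>\<^sup>+r. \<integral>\<^sup>+s. \<integral>\<^sup>+t. H r s t \<partial>lborel \<partial>lborel \<partial>lborel)"
  proof -
    have "(\<lambda>r. \<integral>\<^sup>+s. \<integral>\<^sup>+t. H r s t \<partial>lborel \<partial>lborel) \<in> borel_measurable lborel"
      unfolding H_def by measurable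
    then show ?thesis by (simp add: nn_integral_cmult)
  qed
  also have "(\<integral>\<^sup>+r. \<integral>\<^sup>+s. \<integral>\<^sup>+t. H r s t \<partial>lborel \<partial>lborel \<partial>lborel) = (\<integral>\<^sup>+r. \<integral>\<^sup>+t. \<integral>\<^sup>+s. H r s t \<partial>lborel \<partial>lborel \<partial>lborel)"
    by (intro nn_integral_cong lborel_pair.Fubini') measurable
  also have "\<dots> = (\<integral>\<^sup>+t. \<integral>\<^sup>+r. \<integral>\<^sup>+s. H r s t \<partial>lborel \<partial>lborel \<partial>lborel)"
    unfolding H_def by (rule lborel_pair.Fubini') measurable
  also have "\<dots> \<le> (\<integral>\<^sup>+t. \<integral>\<^sup>+r. ennreal (m t / (1 - \<beta>)) * ennreal (if 0 < r \<and> r < t \<and> t \<le> pi then r powr (- \<beta>) * (t - r) powr (\<beta> - 1) else 0) \<partial>lborel \<partial>lborel)"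
  proof (rule nn_integral_mono, rule nn_integral_mono_AE)
    fix t :: real
    have "AE r in lborel. r \<noteq> t" by (rule AE_lborel_singleton)
    then show "AE r in lborel. (\<integral>\<^sup>+s. H r s t \<partial>lborel) \<le> ennreal (m t / (1 - \<beta>)) * ennreal (if 0 < r \<and> r < t \<and> t \<le> pi then r powr (- \<beta>) * (t - r) powr (\<beta> - 1) else 0)"
      by eventually_elim (rule inner_s)
  qed
  also have "\<dots> = (\<integral>\<^sup>+t. ennreal (m t / (1 - \<beta>)) * (\<integral>\<^sup>+r. ennreal (if 0 < r \<and> r < t \<and> t \<le> pi then r powr (- \<beta>) * (t - r) powr (\<beta> - 1) else 0) \<partial>lborel) \<partial>lborel)"
    by (intro nn_integral_cong nn_integral_cmult) measurable
  also have "\<dots> \<le> (\<integral>\<^sup>+t. ennreal (m t / (1 - \<beta>)) * (ennreal (1 / (1 - \<beta>) + 1 / \<beta>) * indicator {0..pi} t) \<partial>lborel)"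
    by (intro nn_integral_mono mult_left_mono inner_r) auto
  also have "\<dots> = (\<integral>\<^sup>+t. ennreal ((1 / (1 - \<beta>) + 1 / \<beta>) / (1 - \<beta>)) * (ennreal (m t) * indicator {0..pi} t) \<partial>lborel)"
    using \<beta>01 m(2) by (intro nn_integral_cong) (auto simp: indicator_def ennreal_mult'[symmetric] ennreal_mult''[symmetric] mult.commute simp del: ennreal_plus)
  also have "\<dots> = ennreal ((1 / (1 - \<beta>) + 1 / \<beta>) / (1 - \<beta>)) * (\<integral>\<^sup>+t. ennreal (m t) * indicator {0..pi} t \<partial>lborel)"
    by (rule nn_integral_cmult) measurable
  also have "\<dots> = ennreal ((1 / (1 - \<beta>) + 1 / \<beta>) / (1 - \<beta>)) * ennreal (\<alpha> 0 - \<alpha> pi)"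
    by (subst FTC) auto
  also have "\<dots> \<le> ennreal ((1 / (1 - \<beta>) + 1 / \<beta>) / (1 - \<beta>)) * ennreal B"
    using tot by (intro mult_left_mono ennreal_leI) auto
  also have "\<dots> = ennreal ((1 / (1 - \<beta>) + 1 / \<beta>) / (1 - \<beta>) * B)"
    using \<beta>01 by (intro ennreal_mult'[symmetric] divide_nonneg_nonneg add_nonneg_nonneg) auto
  finally have "(\<integral>\<^sup>+r. \<integral>\<^sup>+s. ennreal (if 0 < r \<and> r < s \<and> s \<le> pi then (\<alpha> r - \<alpha> s) powr p / (s - r)\<^sup>2 else 0) \<partial>lborel \<partial>lborel)
     \<le> ennreal K * ennreal ((1 / (1 - \<beta>) + 1 / \<beta>) / (1 - \<beta>) * B)" by (simp add: mult_left_mono)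
  then show ?thesis using K by (simp add: ennreal_mult'[symmetric] K_def)
qed

section \<open>Folding the circle about pi\<close>

lemma nn_integral_fold:
  assumes [measurable]: "F \<in> borel_measurable borel"
  shows "(\<integral>\<^sup>+x. F \<bar>x - pi\<bar> * indicator {0..2*pi} x \<partial>lborel) \<le> 2 * (\<integral>\<^sup>+r. F r * indicator {0..pi} r \<partial>lborel)"
proof -
  let ?F = "\<lambda>r. F r * indicator {0..pi} r"
  have "(\<integral>\<^sup>+x. F \<bar>x - pi\<bar> * indicator {0..2*pi} x \<partial>lborel) \<le> (\<integral>\<^sup>+x. ?F (- pi + 1 * x) + ?F (pi - x) \<partial>lborel)"
  proof (intro nn_integral_mono)
    fix x :: real
    show "F \<bar>x - pi\<bar> * indicator {0..2*pi} x \<le> ?F (- pi + 1 * x) + ?F (pi - x)"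
    proof (cases "x \<ge> pi")
      case True
      then have "F \<bar>x - pi\<bar> * indicator {0..2*pi} x \<le> ?F (- pi + 1 * x)" by (simp add: indicator_def)
      then show ?thesis by (rule order_trans) simp
    next
      case False
      then have "F \<bar>x - pi\<bar> * indicator {0..2*pi} x \<le> ?F (pi - x)" by (simp add: indicator_def abs_if)
      then show ?thesis by (rule order_trans) simp
    qed
  qed
  also have "\<dots> = (\<integral>\<^sup>+x. ?F (- pi + 1 * x) \<partial>lborel) + (\<integral>\<^sup>+x. ?F (pi - x) \<partial>lborel)" by (rule nn_integral_add) measurable
  also have "(\<integral>\<^sup>+x. ?F (pi - x) \<partial>lborel) = (\<integral>\<^sup>+r. ?F r \<partial>lborel)" by (rule nn_integral_reflect) measurable
  also have "(\<integral>\<^sup>+x. ?F (- pi + 1 * x) \<partial>lborel) = (\<integral>\<^sup>+r. ?F r \<partial>lborel)"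
    using nn_integral_real_affine[of ?F 1 "- pi"] by simp
  finally show ?thesis unfolding mult_2 .
qed

text \<open>The fold x -> |x - pi| does not increase arc distance, also across the seam at 0, and a
  chord is at least half its arc.\<close>

lemma circle_fold_distance:
  assumes "x \<in> {0..2*pi}" "y \<in> {0..2*pi}"
  shows "\<bar>\<bar>x - pi\<bar> - \<bar>y - pi\<bar>\<bar> / 2 \<le> cmod (cis x - cis y)"
proof (cases "\<bar>x - y\<bar> \<le> pi")
  case True
  then show ?thesis using abs_triangle_ineq3[of "x - pi" "y - pi"] norm_cis_diff_ge[of x y] by simp
next
  case False
  show ?thesis
  proof (cases "x > y")
    case True
    have "cis (x - 2*pi) = cis x" using cis_shift_int[of x "-1"] by simp
    moreover have "\<bar>(x - 2*pi) - y\<bar> \<le> pi" using False True assms by auto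
    ultimately have 1: "\<bar>(x - 2*pi) - y\<bar> / 2 \<le> cmod (cis x - cis y)" using norm_cis_diff_ge by metis
    have 2: "\<bar>\<bar>x - pi\<bar> - \<bar>y - pi\<bar>\<bar> \<le> \<bar>(x - 2*pi) - y\<bar>" using False True assms by (auto simp: abs_if split: if_splits)
    show ?thesis using order_trans[OF divide_right_mono[OF 2, of 2] 1] by simp
  next
    case xy: False
    have "cis (y - 2*pi) = cis y" using cis_shift_int[of y "-1"] by simp
    moreover have "\<bar>x - (y - 2*pi)\<bar> \<le> pi" using False xy assms by auto
    ultimately have 1: "\<bar>x - (y - 2*pi)\<bar> / 2 \<le> cmod (cis x - cis y)" using norm_cis_diff_ge by metis
    have 2: "\<bar>\<bar>x - pi\<bar> - \<bar>y - pi\<bar>\<bar> \<le> \<bar>x - (y - 2*pi)\<bar>" using False xy assms by (auto simp: abs_if split: if_splits)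
    show ?thesis using order_trans[OF divide_right_mono[OF 2, of 2] 1] by simp
  qed
qed

text \<open>For s p = 1 the kernel exponent is 2. Folding both variables gives a factor 4 and the
  two orderings of r and s another 2. The factor \<open>4 * 2 powr p\<close> stems from the halved
  distance and from |u x - u y| <= 2 |\<alpha> r - \<alpha> s|. The sine depends only on the fold,
  so no singularity arises from points on opposite sides of pi.\<close>

lemma Gag_pow_fold:
  fixes \<alpha> :: "real \<Rightarrow> real"
  assumes p: "1 < p" and \<alpha>: "continuous_on UNIV \<alpha>" and anti: "\<And>r s. 0 < r \<Longrightarrow> r < s \<Longrightarrow> s \<le> pi \<Longrightarrow> \<alpha> s \<le> \<alpha> r"
    and u: "\<And>x. x \<in> {0..2*pi} \<Longrightarrow> u x = 2 * \<i> * of_real (sin (\<alpha> \<bar>x - pi\<bar>))"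
    and E: "(\<integral>\<^sup>+r. \<integral>\<^sup>+s. ennreal (if 0 < r \<and> r < s \<and> s \<le> pi then (\<alpha> r - \<alpha> s) powr p / (s - r)\<^sup>2 else 0) \<partial>lborel \<partial>lborel) \<le> ennreal E" "0 \<le> E"
  shows "Gag_pow (1/p) p u \<le> ennreal (8 * (4 * 2 powr p) * E)"
proof -
  have [measurable]: "\<alpha> \<in> borel_measurable borel" using \<alpha> by (simp add: borel_measurable_continuous_onI)
  define G where "G = (\<lambda>r s. ennreal (if 0 < r \<and> r < s \<and> s \<le> pi then (\<alpha> r - \<alpha> s) powr p / (s - r)\<^sup>2 else 0))"
  have Gm [measurable]: "(\<lambda>(r, s). G r s) \<in> borel_measurable (lborel \<Otimes>\<^sub>M lborel)" unfolding G_def by measurable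
  define Q where "Q = (\<lambda>r s. G r s + G s r)"
  have Qm [measurable]: "(\<lambda>(r, s). Q r s) \<in> borel_measurable (lborel \<Otimes>\<^sub>M lborel)" unfolding Q_def by measurable
  define C where "C = 4 * 2 powr p"
  have half: "(2 * (\<alpha> r - \<alpha> s)) powr p / ((s - r) / 2)\<^sup>2 = C * ((\<alpha> r - \<alpha> s) powr p / (s - r)\<^sup>2)" if "\<alpha> s \<le> \<alpha> r" for r s
    unfolding powr_mult power_divide by (simp add: C_def)
  have pw: "ennreal (cmod (u x - u y) powr p / cmod (cis x - cis y) powr (1 + 1/p * p)) \<le> ennreal C * Q \<bar>x - pi\<bar> \<bar>y - pi\<bar>"
    if xy: "x \<in> {0..2*pi}" "y \<in> {0..2*pi}" "x \<noteq> pi" "y \<noteq> pi" for x y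
  proof -
    define r where "r = \<bar>x - pi\<bar>"
    define s where "s = \<bar>y - pi\<bar>"
    have rs: "0 < r" "r \<le> pi" "0 < s" "s \<le> pi" using xy by (auto simp: r_def s_def)
    have up: "cmod (u x - u y) \<le> 2 * \<bar>\<alpha> r - \<alpha> s\<bar>"
    proof -
      have "u x - u y = 2 * \<i> * of_real (sin (\<alpha> r) - sin (\<alpha> s))" using u xy by (simp add: r_def s_def algebra_simps)
      then have "cmod (u x - u y) = 2 * \<bar>sin (\<alpha> r) - sin (\<alpha> s)\<bar>" by (simp add: norm_mult del: of_real_diff)
      also have "\<bar>sin (\<alpha> r) - sin (\<alpha> s)\<bar> \<le> \<bar>\<alpha> r - \<alpha> s\<bar>"
      proof -
        have "\<bar>sin (\<alpha> r) - sin (\<alpha> s)\<bar> = \<bar>Im (cis (\<alpha> r) - cis (\<alpha> s))\<bar>" by simp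
        also have "\<dots> \<le> cmod (cis (\<alpha> r) - cis (\<alpha> s))" by (rule abs_Im_le_cmod)
        also have "\<dots> \<le> \<bar>\<alpha> r - \<alpha> s\<bar>" by (rule norm_cis_diff_le)
        finally show ?thesis .
      qed
      finally show ?thesis by simp
    qed
    have low: "\<bar>r - s\<bar> / 2 \<le> cmod (cis x - cis y)" using circle_fold_distance xy by (simp add: r_def s_def)
    have e: "cmod (cis x - cis y) powr (1 + 1/p * p) = (cmod (cis x - cis y))\<^sup>2" using p by simp
    consider "r = s" | "r < s" | "s < r" by linarith
    then have "ennreal (cmod (u x - u y) powr p / cmod (cis x - cis y) powr (1 + 1/p * p)) \<le> ennreal C * Q r s"
    proof cases
      case 1
      then have "u x - u y = 0" using u xy by (simp add: r_def s_def)
      then show ?thesis by simp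
    next
      case 2
      have a: "\<alpha> s \<le> \<alpha> r" using anti 2 rs by simp
      have "cmod (u x - u y) powr p / (cmod (cis x - cis y))\<^sup>2 \<le> (2 * (\<alpha> r - \<alpha> s)) powr p / ((s - r) / 2)\<^sup>2"
        using up low a p 2 by (intro frac_le powr_mono2 power_mono) auto
      then have "ennreal (cmod (u x - u y) powr p / (cmod (cis x - cis y))\<^sup>2) \<le> ennreal C * G r s"
        unfolding half[OF a] using 2 rs by (simp add: G_def ennreal_mult'[symmetric] ennreal_leI C_def)
      also have "\<dots> \<le> ennreal C * Q r s" unfolding Q_def by (intro mult_left_mono) auto
      finally show ?thesis unfolding e .
    next
      case 3
      have a: "\<alpha> r \<le> \<alpha> s" using anti 3 rs by simp
      have "cmod (u x - u y) powr p / (cmod (cis x - cis y))\<^sup>2 \<le> (2 * (\<alpha> s - \<alpha> r)) powr p / ((r - s) / 2)\<^sup>2"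
        using up low a p 3 by (intro frac_le powr_mono2 power_mono) auto
      then have "ennreal (cmod (u x - u y) powr p / (cmod (cis x - cis y))\<^sup>2) \<le> ennreal C * G s r"
        unfolding half[OF a] using 3 rs by (simp add: G_def ennreal_mult'[symmetric] ennreal_leI C_def)
      also have "\<dots> \<le> ennreal C * Q r s" unfolding Q_def by (intro mult_left_mono) auto
      finally show ?thesis unfolding e .
    qed
    then show ?thesis by (simp add: r_def s_def)
  qed
  have inner: "(\<integral>\<^sup>+y. ennreal (cmod (u x - u y) powr p / cmod (cis x - cis y) powr (1 + 1/p * p)) * indicator {0..2*pi} y \<partial>lborel)
     \<le> 2 * (ennreal C * (\<integral>\<^sup>+s. Q \<bar>x - pi\<bar> s \<partial>lborel))" if x: "x \<in> {0..2*pi}" "x \<noteq> pi" for x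
  proof -
    have "(\<integral>\<^sup>+y. ennreal (cmod (u x - u y) powr p / cmod (cis x - cis y) powr (1 + 1/p * p)) * indicator {0..2*pi} y \<partial>lborel)
       \<le> (\<integral>\<^sup>+y. ennreal C * Q \<bar>x - pi\<bar> \<bar>y - pi\<bar> * indicator {0..2*pi} y \<partial>lborel)"
    proof (rule nn_integral_mono_AE)
      have "AE y in lborel. y \<noteq> pi" by (rule AE_lborel_singleton)
      then show "AE y in lborel. ennreal (cmod (u x - u y) powr p / cmod (cis x - cis y) powr (1 + 1/p * p)) * indicator {0..2*pi} y
         \<le> ennreal C * Q \<bar>x - pi\<bar> \<bar>y - pi\<bar> * indicator {0..2*pi} y"
        by eventually_elim (use pw[OF x(1) _ x(2)] p in \<open>auto simp: indicator_def\<close>)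
    qed
    also have "\<dots> \<le> 2 * (\<integral>\<^sup>+s. ennreal C * Q \<bar>x - pi\<bar> s * indicator {0..pi} s \<partial>lborel)"
      by (rule nn_integral_fold[of "\<lambda>s. ennreal C * Q \<bar>x - pi\<bar> s"]) measurable
    also have "\<dots> \<le> 2 * (\<integral>\<^sup>+s. ennreal C * Q \<bar>x - pi\<bar> s \<partial>lborel)"
      by (intro mult_left_mono nn_integral_mono) (auto simp: indicator_def)
    also have "(\<integral>\<^sup>+s. ennreal C * Q \<bar>x - pi\<bar> s \<partial>lborel) = ennreal C * (\<integral>\<^sup>+s. Q \<bar>x - pi\<bar> s \<partial>lborel)"
      by (rule nn_integral_cmult) measurable
    finally show ?thesis .
  qed
  define F where "F = (\<lambda>r. 2 * (ennreal C * (\<integral>\<^sup>+s. Q r s \<partial>lborel)))"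
  have Fm [measurable]: "F \<in> borel_measurable borel" unfolding F_def by measurable
  have "Gag_pow (1/p) p u \<le> (\<integral>\<^sup>+x. F \<bar>x - pi\<bar> * indicator {0..2*pi} x \<partial>lborel)"
    unfolding Gag_pow_def nn_integral_completion
  proof (rule nn_integral_mono_AE)
    have "AE x in lborel. x \<noteq> pi" by (rule AE_lborel_singleton)
    then show "AE x in lborel. (\<integral>\<^sup>+y. ennreal (cmod (u x - u y) powr p / cmod (cis x - cis y) powr (1 + 1/p * p)) * indicator {0..2*pi} y \<partial>lborel) * indicator {0..2*pi} x
       \<le> F \<bar>x - pi\<bar> * indicator {0..2*pi} x"
      by eventually_elim (use inner p in \<open>auto simp: indicator_def F_def\<close>)
  qed
  also have "\<dots> \<le> 2 * (\<integral>\<^sup>+r. F r * indicator {0..pi} r \<partial>lborel)" by (rule nn_integral_fold) measurable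
  also have "\<dots> \<le> 2 * (\<integral>\<^sup>+r. F r \<partial>lborel)" by (intro mult_left_mono nn_integral_mono) (auto simp: indicator_def)
  also have "(\<integral>\<^sup>+r. F r \<partial>lborel) = 2 * (ennreal C * (\<integral>\<^sup>+r. \<integral>\<^sup>+s. Q r s \<partial>lborel \<partial>lborel))"
    unfolding F_def by (simp add: nn_integral_cmult)
  also have "(\<integral>\<^sup>+r. \<integral>\<^sup>+s. Q r s \<partial>lborel \<partial>lborel) = (\<integral>\<^sup>+r. \<integral>\<^sup>+s. G r s \<partial>lborel \<partial>lborel) + (\<integral>\<^sup>+r. \<integral>\<^sup>+s. G s r \<partial>lborel \<partial>lborel)"
    unfolding Q_def by (simp add: nn_integral_add)
  also have "(\<integral>\<^sup>+r. \<integral>\<^sup>+s. G s r \<partial>lborel \<partial>lborel) = (\<integral>\<^sup>+s. \<integral>\<^sup>+r. G s r \<partial>lborel \<partial>lborel)"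
    by (rule lborel_pair.Fubini') measurable
  also have "2 * (2 * (ennreal C * ((\<integral>\<^sup>+r. \<integral>\<^sup>+s. G r s \<partial>lborel \<partial>lborel) + (\<integral>\<^sup>+s. \<integral>\<^sup>+r. G s r \<partial>lborel \<partial>lborel)))) \<le> 2 * (2 * (ennreal C * (ennreal E + ennreal E)))"
    using E(1) unfolding G_def by (intro mult_left_mono add_mono) auto
  also have "\<dots> = ennreal (8 * C * E)"
  proof -
    have "ennreal C * (ennreal E + ennreal E) = ennreal (2 * C * E)" using E(2) by (simp add: C_def ennreal_plus[symmetric] ennreal_mult'[symmetric] algebra_simps del: ennreal_plus)
    then have "2 * (2 * (ennreal C * (ennreal E + ennreal E))) = ennreal 2 * (ennreal 2 * ennreal (2 * C * E))" by simp
    also have "\<dots> = ennreal (2 * (2 * (2 * C * E)))" by (simp only: ennreal_mult'[symmetric] zero_le_numeral)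
    finally show ?thesis by (simp add: mult.assoc)
  qed
  finally show ?thesis by (simp add: C_def)
qed

lemma powr_minus_half_square: "0 < y \<Longrightarrow> (y\<^sup>2) powr (- 1/2) = 1 / (y::real)"
proof -
  assume y: "0 < y"
  then have "(y\<^sup>2) powr (- 1/2) = (y powr 2) powr (- 1/2)" by simp
  also have "\<dots> = y powr (- 1)" by (simp only: powr_powr) simp
  finally show ?thesis using y by (simp add: powr_minus_divide)
qed

lemma one_minus_cos: "1 - cos r = 2 * (sin (r/2))\<^sup>2" for r :: real
  using cos_double_sin[of "r/2"] by simp

text \<open>A density comparable to \<open>1 / (e + |x - pi|)\<close> near \<open>pi\<close>: its mass grows like \<open>ln (1 / e)\<close>, so after
  normalisation the constant in the bound \<open>3 c / |x - pi|\<close> is as small as we wish.\<close>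
lemma log_phase:
  fixes \<eta> :: real
  assumes \<eta>: "0 < \<eta>"
  obtains P c \<rho> where "smooth P" "0 < c" "c \<le> \<eta>" "\<And>t. (P has_real_derivative c * \<rho> t) (at t)"
    "\<And>x. P (x + 2*pi) = P x + 2*pi" "P 0 = 0" "smooth \<rho>" "\<And>x. 0 \<le> \<rho> x" "\<And>x. \<rho> (2*pi - x) = \<rho> x"
    "\<And>x. 0 \<le> cos x \<Longrightarrow> \<rho> x = 0" "\<And>x. x \<in> {0..2*pi} \<Longrightarrow> x \<noteq> pi \<Longrightarrow> \<rho> x \<le> 3 / \<bar>x - pi\<bar>"
proof -
  \<comment> \<open>Chosen so that ln (1 / e) = 2 pi exp 2 / \<eta>; a total phase increase of 2 pi
    then forces c <= \<eta>.\<close>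
  define e where "e = exp (- (2*pi * exp 2 / \<eta>))"
  have e: "0 < e" by (simp add: e_def)
  \<comment> \<open>Near pi, 1 + cos x behaves like (x - pi)^2 / 2, so the square root of z is a
    smooth, positive and periodic substitute for e + |x - pi|.\<close>
  define z where "z = (\<lambda>x. e\<^sup>2 + 1 + cos x)"
  have zpos: "0 < z x" for x
  proof -
    have "- 1 \<le> cos x" by (rule cos_ge_minus_one)
    moreover have "0 < e\<^sup>2" using e by simp
    ultimately show ?thesis unfolding z_def by linarith
  qed
  define \<rho> where "\<rho> = (\<lambda>x. flat_exp 0 (- cos x) * z x powr (- 1/2))"
  have smz: "smooth z" unfolding z_def by (intro smooth_intros)
  have sm: "smooth \<rho>" unfolding \<rho>_def by (intro smooth_mult smooth_flat_exp smooth_minus smooth_cos smooth_id smooth_powr zpos smz)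
  have per: "\<rho> (x + 2*pi) = \<rho> x" and nn: "0 \<le> \<rho> x" for x
    by (simp_all add: \<rho>_def z_def flat_exp_nonneg)
  have pos: "0 < \<rho> pi" using zpos[of pi] by (simp add: \<rho>_def flat_exp_pos_iff)
  obtain P c where P: "smooth P" "c > 0" "\<And>t. (P has_real_derivative c * \<rho> t) (at t)"
    "\<And>x. P (x + 2*pi) = P x + 2*pi" "P 0 = 0"
    by (rule phase_exists[OF sm per nn pos]) (rule that; assumption)
  have mono: "x \<le> y \<Longrightarrow> P x \<le> P y" for x y
    using P(2,3) nn by (intro DERIV_nonneg_imp_nondecreasing[of x y P]) (auto intro!: exI mult_nonneg_nonneg)
  have low: "exp (- 2) / (e + (pi - x)) \<le> \<rho> x" if x: "pi - 1 \<le> x" "x \<le> pi" for x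
  proof -
    define r where "r = pi - x"
    have r: "0 \<le> r" "r \<le> 1" using x by (auto simp: r_def)
    have cx: "cos x = - cos r" by (simp add: r_def cos_diff)
    \<comment> \<open>Within distance 1 < pi / 3 of pi the cutoff is exp (-1 / cos r) with cos r >=
      1/2, hence at least exp (-2).\<close>
    have "cos (pi/3) \<le> cos r" using r pi_gt3 by (intro cos_monotone_0_pi_le) auto
    then have cr: "1/2 \<le> cos r" by (simp add: cos_60)
    then have "- 2 \<le> - 1 / cos r" by (simp add: field_simps)
    then have f: "exp (- 2) \<le> flat_exp 0 (- cos x)" using cr by (simp add: flat_exp_def cx)
    have "\<bar>sin (r/2)\<bar> \<le> r/2" using abs_sin_x_le_abs_x[of "r/2"] r by simp
    then have "(sin (r/2))\<^sup>2 \<le> (r/2)\<^sup>2" by (metis abs_ge_zero power2_abs power_mono)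
    then have "1 - cos r \<le> 2 * (r/2)\<^sup>2" unfolding one_minus_cos by simp
    also have "2 * (r/2)\<^sup>2 = r\<^sup>2 / 2" by (simp add: power2_eq_square)
    also have "\<dots> \<le> r\<^sup>2" by simp
    finally have "1 - cos r \<le> r\<^sup>2" .
    moreover have "(e + r)\<^sup>2 = e\<^sup>2 + r\<^sup>2 + 2 * e * r" by (simp add: power2_sum)
    moreover have "0 \<le> 2 * e * r" using e r by simp
    ultimately have "z x \<le> (e + r)\<^sup>2" unfolding z_def cx by linarith
    then have "((e + r)\<^sup>2) powr (- 1/2) \<le> z x powr (- 1/2)" using zpos[of x] by (intro powr_mono2') auto
    then have "1 / (e + r) \<le> z x powr (- 1/2)" using e r powr_minus_half_square[of "e + r"] by simp
    then have "exp (- 2) * (1 / (e + r)) \<le> \<rho> x" unfolding \<rho>_def using f e r by (intro mult_mono) (auto simp: flat_exp_nonneg)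
    then show ?thesis by (simp add: r_def)
  qed
  have "c \<le> \<eta>"
  proof -
    \<comment> \<open>By \<open>low\<close> the derivative of P exceeds that of -c exp (-2) ln (e +
      (pi - x)) on [pi - 1, pi]. So Q increases, and P gains at least c exp (-2) ln ((1 + e) / e)
      there, out of 2 pi in all.\<close>
    define Q where "Q = (\<lambda>x. P x + c * exp (- 2) * ln (e + (pi - x)))"
    have "Q (pi - 1) \<le> Q pi"
    proof (rule DERIV_nonneg_imp_nondecreasing[of "pi - 1" pi Q])
      fix x assume x: "pi - 1 \<le> x" "x \<le> pi"
      have "(Q has_real_derivative c * \<rho> x - c * (exp (- 2) / (e + (pi - x)))) (at x)"
        unfolding Q_def using P(3)[of x] x e by (auto intro!: derivative_eq_intros simp: divide_simps)
      moreover have "0 \<le> c * \<rho> x - c * (exp (- 2) / (e + (pi - x)))"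
        using mult_left_mono[OF low[OF x], of c] P(2) by simp
      ultimately show "\<exists>y. (Q has_real_derivative y) (at x) \<and> 0 \<le> y" by blast
    qed simp
    then have "c * exp (- 2) * (ln (e + 1) - ln e) \<le> P pi - P (pi - 1)" by (simp add: Q_def algebra_simps)
    also have "\<dots> \<le> 2*pi" using mono[of 0 "pi - 1"] mono[of pi "2*pi"] P(4)[of 0] P(5) pi_gt3 by simp
    finally have 1: "c * exp (- 2) * (ln (e + 1) - ln e) \<le> 2*pi" .
    have "2*pi * exp 2 / \<eta> \<le> ln (e + 1) - ln e" using e by (simp add: e_def)
    then have "c * exp (- 2) * (2*pi * exp 2 / \<eta>) \<le> c * exp (- 2) * (ln (e + 1) - ln e)" using P(2) by (intro mult_left_mono) auto
    also have "c * exp (- 2) * (2*pi * exp 2 / \<eta>) = 2*pi * (c / \<eta>)" by (simp add: exp_minus)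
    finally have "2*pi * (c / \<eta>) \<le> 2*pi * 1" using 1 by simp
    then have "c / \<eta> \<le> 1" by (subst (asm) mult_le_cancel_left_pos) auto
    then show ?thesis using \<eta> by simp
  qed
  moreover have "\<rho> (2*pi - x) = \<rho> x" for x by (simp add: \<rho>_def z_def cos_2pi_minus)
  moreover have "\<rho> x = 0" if "0 \<le> cos x" for x using that by (simp add: \<rho>_def flat_exp_eq_0)
  moreover have "\<rho> x \<le> 3 / \<bar>x - pi\<bar>" if x: "x \<in> {0..2*pi}" "x \<noteq> pi" for x
  proof -
    define r where "r = \<bar>x - pi\<bar>"
    have r: "0 < r" "r \<le> pi" using x by (auto simp: r_def)
    have "cos r = cos (x - pi)" by (simp add: r_def)
    also have "\<dots> = - cos x" by (simp add: cos_diff)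
    finally have cx: "cos x = - cos r" by simp
    \<comment> \<open>The constant 3: 1 - cos r = 2 sin^2 (r/2) >= r^2 / 8 >= (r/3)^2.\<close>
    have "r/4 \<le> sin (r/2)" using sin_ge_half[of "r/2"] r by simp
    then have "(r/4)\<^sup>2 \<le> (sin (r/2))\<^sup>2" using r by (intro power_mono) auto
    then have "r\<^sup>2 / 8 \<le> 1 - cos r" unfolding one_minus_cos by (simp add: power2_eq_square)
    moreover have "(r/3)\<^sup>2 \<le> r\<^sup>2 / 8" using r by (simp add: power2_eq_square)
    moreover have "0 \<le> e\<^sup>2" by simp
    ultimately have "(r/3)\<^sup>2 \<le> z x" unfolding z_def cx by linarith
    then have "z x powr (- 1/2) \<le> ((r/3)\<^sup>2) powr (- 1/2)" using r by (intro powr_mono2') auto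
    also have "\<dots> = 3 / r" using powr_minus_half_square[of "r/3"] r by simp
    finally have "\<rho> x \<le> 1 * (3 / r)" unfolding \<rho>_def using flat_exp_0_le_1 r by (intro mult_mono) (auto simp: flat_exp_nonneg)
    then show ?thesis by (simp add: r_def)
  qed
  ultimately show ?thesis using that[of P c \<rho>] P sm nn by blast
qed

text \<open>With phases (Pb + P) / 2 and (Pb - P) / 2 the difference is 2 i sin (P / 2) cis (Pb /
  2). On [0, 2 pi], P moves only where Pb = 0, and sin (P / 2) = 0 where Pb moves; what remains is 2
  i sin (P / 2), an even function of x - pi with logarithmic slope.\<close>

lemma critical_pair:
  assumes p: "1 < p" and \<epsilon>: "0 < \<epsilon>"
  obtains f0 g0 where "smooth f0" "periodic2pi f0" "\<And>x. cmod (f0 x) = 1" "top_deg f0 = 1"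
    "smooth g0" "periodic2pi g0" "\<And>x. cmod (g0 x) = 1" "top_deg g0 = 0" "\<And>x. 0 \<le> cos x \<Longrightarrow> f0 x = g0 x"
    "Lp_pow 1 (\<lambda>x. f0 x - g0 x) \<le> ennreal \<epsilon>" "Gag_pow (1/p) p (\<lambda>x. f0 x - g0 x) \<le> ennreal \<epsilon>"
proof -
  define \<beta> where "\<beta> = (p - 1) / p"
  have \<beta>01: "0 < \<beta>" "\<beta> < 1" using p by (auto simp: \<beta>_def field_simps)
  \<comment> \<open>The Gagliardo energy will be at most K \<kappa>^(p - 1) and the L^1 norm at most
    16 pi \<kappa>; the two entries of \<open>\<kappa>0\<close> make both at most
    \<epsilon>.\<close>
  define K where "K = 8 * (4 * 2 powr p) * (p powr (p - 1) * ((1 / (1 - \<beta>) + 1 / \<beta>) / (1 - \<beta>) * pi))"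
  have K: "K > 0" unfolding K_def using p \<beta>01 by (intro mult_pos_pos divide_pos_pos add_pos_pos) auto
  define \<kappa>0 where "\<kappa>0 = min (\<epsilon> / (16 * pi)) ((\<epsilon> / K) powr (1 / (p - 1)))"
  have \<kappa>0: "\<kappa>0 > 0" using \<epsilon> K by (simp add: \<kappa>0_def)
  obtain P c \<rho> where P: "smooth P" "0 < c" "c \<le> 2/3 * \<kappa>0" "\<And>t. (P has_real_derivative c * \<rho> t) (at t)"
    "\<And>x. P (x + 2*pi) = P x + 2*pi" "P 0 = 0" "smooth \<rho>" "\<And>x. 0 \<le> \<rho> x" "\<And>x. \<rho> (2*pi - x) = \<rho> x"
    "\<And>x. 0 \<le> cos x \<Longrightarrow> \<rho> x = 0" "\<And>x. x \<in> {0..2*pi} \<Longrightarrow> x \<noteq> pi \<Longrightarrow> \<rho> x \<le> 3 / \<bar>x - pi\<bar>"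
    by (rule log_phase[of "2/3 * \<kappa>0"]) (use \<kappa>0 in simp, rule that, (assumption | blast)+)
  \<comment> \<open>The 3 is the constant of the density bound in \<open>log_phase\<close>, and the
    1/2 comes from \<alpha> being half of P.\<close>
  define \<kappa> where "\<kappa> = 3/2 * c"
  have \<kappa>: "0 < \<kappa>" "\<kappa> \<le> \<kappa>0" using P(2,3) by (auto simp: \<kappa>_def)
  have r0: "0 < pi/2" "pi/2 < pi" by auto
  obtain Pb where Pb: "smooth Pb" "\<And>x. Pb (x + 2*pi) = Pb x + 2*pi" "\<And>x. pi/2 \<le> x \<Longrightarrow> x \<le> 2*pi - pi/2 \<Longrightarrow> Pb x = 0"
    using bump_phase[OF r0] by metis
  \<comment> \<open>P / 2 alone would gain pi in a period, and cis (P / 2) would not close up;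
    adding Pb / 2 turns the gains into 2 pi and 0.\<close>
  define \<phi> where "\<phi> = (\<lambda>x. 1/2 * P x + 1/2 * Pb x)"
  define \<psi> where "\<psi> = (\<lambda>x. 1/2 * Pb x - 1/2 * P x)"
  have s\<phi>: "smooth \<phi>" and s\<psi>: "smooth \<psi>" unfolding \<phi>_def \<psi>_def by (intro smooth_add smooth_diff smooth_cmult P Pb)+
  define f0 where "f0 = (\<lambda>x. cis (\<phi> x))"
  define g0 where "g0 = (\<lambda>x. cis (\<psi> x))"
  have inc: "\<phi> (x + 2*pi) = \<phi> x + 2*pi" "\<psi> (x + 2*pi) = \<psi> x" for x
    unfolding \<phi>_def \<psi>_def P(5) Pb(2) by (simp_all add: add_divide_distrib)
  have diff: "f0 x - g0 x = 2 * \<i> * of_real (sin (1/2 * P x)) * cis (1/2 * Pb x)" for x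
    by (simp add: f0_def g0_def \<phi>_def \<psi>_def complex_eq_iff cos_add sin_add cos_diff sin_diff)
  have Pint: "\<exists>j::int. P x = 2*pi * of_int j" if c: "0 \<le> cos x" for x
  proof -
    have z: "\<rho> y = 0" if "\<bar>y - 0\<bar> \<le> pi/2" for y
      using that by (intro P(10) cos_ge_zero) auto
    obtain j :: int where j: "\<bar>x - 0 - 2*pi * of_int j\<bar> \<le> pi" by (rule reduce_mod_2pi)
    have "cos (x - 0 - 2*pi * of_int j) = cos x" using cos_shift_int[of x "- j"] by simp
    then have "cos (pi/2) \<le> cos (x - 0 - 2*pi * of_int j)" unfolding cos_pi_half using c by linarith
    then have "\<bar>x - 0 - 2*pi * of_int j\<bar> \<le> pi/2" using abs_le_of_cos_le[OF j, of "pi/2"] pi_ge_zero by simp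
    from phase_const[OF P(4,5,6) z this] show ?thesis by blast
  qed
  have sin0: "sin (1/2 * P x) = 0" if cx: "0 \<le> cos x" for x
  proof -
    obtain j :: int where "P x = 2*pi * of_int j" using Pint[OF cx] by blast
    then have "1/2 * P x = of_int j * pi" by simp
    then show ?thesis unfolding sin_zero_iff_int2 by blast
  qed
  define \<alpha> where "\<alpha> = (\<lambda>r. 1/2 * P (pi - r))"
  define m where "m = (\<lambda>r. 1/2 * (c * \<rho> (pi - r)))"
  have d\<alpha>: "(\<alpha> has_real_derivative - m r) (at r)" for r
  proof -
    have "((\<lambda>r. P (pi - r)) has_real_derivative c * \<rho> (pi - r) * (- 1)) (at r)"
      by (rule DERIV_chain2[OF P(4)]) (auto intro!: derivative_eq_intros)
    from DERIV_cmult[OF this, of "1/2"] show ?thesis by (simp add: \<alpha>_def m_def)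
  qed
  have monoP: "x \<le> y \<Longrightarrow> P x \<le> P y" for x y
    using P(2,4,8) by (intro DERIV_nonneg_imp_nondecreasing[of x y P]) (auto intro!: exI mult_nonneg_nonneg)
  have anti: "\<alpha> s \<le> \<alpha> r" if "r \<le> s" for r s using monoP[of "pi - s" "pi - r"] that by (simp add: \<alpha>_def)
  have \<alpha>pi: "\<alpha> pi = 0" by (simp add: \<alpha>_def P(6))
  have c\<alpha>: "continuous_on UNIV \<alpha>" using d\<alpha> by (meson DERIV_isCont continuous_at_imp_continuous_on)
  have cm: "continuous_on UNIV m" unfolding m_def
    using smooth_affine[OF P(7), of "-1" pi] by (intro continuous_on_mult_left smooth_continuous_on) (simp add: add.commute)
  have osc: "\<alpha> r - \<alpha> s \<le> \<kappa> * ln (s / r)" if rs: "0 < r" "r < s" "s \<le> pi" for r s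
  proof -
    define Q where "Q = (\<lambda>t. \<alpha> t + \<kappa> * ln t)"
    have "Q r \<le> Q s"
    proof (rule DERIV_nonneg_imp_nondecreasing[of r s Q])
      fix t assume t: "r \<le> t" "t \<le> s"
      have "(Q has_real_derivative - m t + \<kappa> * (1 / t)) (at t)"
        unfolding Q_def using d\<alpha>[of t] t rs by (auto intro!: derivative_eq_intros)
      moreover have "m t \<le> \<kappa> * (1 / t)"
      proof -
        have "\<rho> (pi - t) \<le> 3 / \<bar>pi - t - pi\<bar>" using t rs by (intro P(11)) auto
        then have "\<rho> (pi - t) \<le> 3 / t" using t rs by simp
        then have "1/2 * (c * \<rho> (pi - t)) \<le> 1/2 * (c * (3 / t))" using P(2) by (intro mult_left_mono) auto
        then show ?thesis by (simp add: m_def \<kappa>_def)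
      qed
      ultimately show "\<exists>y. (Q has_real_derivative y) (at t) \<and> 0 \<le> y" by (intro exI[of _ "- m t + \<kappa> * (1 / t)"]) auto
    qed (use rs in simp)
    then show ?thesis using rs by (simp add: Q_def ln_div algebra_simps)
  qed
  have m0: "0 \<le> m t" for t using P(2,8) by (simp add: m_def)
  have tot: "\<alpha> 0 - \<alpha> pi \<le> pi"
    using monoP[of pi "2*pi"] P(5)[of 0] P(6) by (simp add: \<alpha>_def)
  have u: "f0 x - g0 x = 2 * \<i> * of_real (sin (\<alpha> \<bar>x - pi\<bar>))" if x: "x \<in> {0..2*pi}" for x
  proof -
    \<comment> \<open>The density is symmetric about pi, hence so is sin (P / 2), because sin (pi -
      t) = sin t.\<close>
    have sym: "P (2*pi - x) = 2*pi - P x"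
    proof -
      have "((\<lambda>x. P (2*pi - x) + P x) has_real_derivative 0) (at t)" for t
      proof -
        have "((\<lambda>r. P (2*pi - r)) has_real_derivative c * \<rho> (2*pi - t) * (- 1)) (at t)"
          by (rule DERIV_chain2[OF P(4)]) (auto intro!: derivative_eq_intros)
        from DERIV_add[OF this P(4)[of t]] show ?thesis by (simp add: P(9))
      qed
      then have "P (2*pi - x) + P x = P (2*pi - 0) + P 0" using DERIV_isconst_all[of "\<lambda>x. P (2*pi - x) + P x"] by blast
      then show ?thesis using P(5)[of 0] P(6) by simp
    qed
    have sa: "sin (\<alpha> \<bar>x - pi\<bar>) = sin (1/2 * P x)"
    proof (cases "x \<le> pi")
      case True then show ?thesis by (simp add: \<alpha>_def)
    next
      case False
      have "\<alpha> \<bar>x - pi\<bar> = 1/2 * P (2*pi - x)" using False by (simp add: \<alpha>_def)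
      also have "\<dots> = pi - 1/2 * P x" using sym by (simp add: field_simps)
      finally show ?thesis by simp
    qed
    show ?thesis
    proof (cases "0 \<le> cos x")
      case True then show ?thesis by (simp add: diff sa sin0[OF True, simplified])
    next
      case False
      have "pi/2 \<le> x" "x \<le> 2*pi - pi/2"
      proof -
        show "pi/2 \<le> x" using False cos_ge_zero[of x] x by force
        show "x \<le> 2*pi - pi/2"
        proof (rule ccontr)
          assume "\<not> x \<le> 2*pi - pi/2"
          then have "0 \<le> cos (2*pi - x)" using x by (intro cos_ge_zero) auto
          then show False using False by (simp only: cos_2pi_minus)
        qed
      qed
      then have "Pb x = 0" by (rule Pb(3))
      then show ?thesis by (simp add: diff sa)
    qed
  qed
  have G: "Gag_pow (1/p) p (\<lambda>x. f0 x - g0 x) \<le> ennreal \<epsilon>"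
  proof -
    define E where "E = (\<kappa> * p) powr (p - 1) * ((1 / (1 - \<beta>) + 1 / \<beta>) / (1 - \<beta>) * pi)"
    have E0: "0 \<le> E" unfolding E_def using \<beta>01 by (intro mult_nonneg_nonneg divide_nonneg_nonneg add_nonneg_nonneg) auto
    have "Gag_pow (1/p) p (\<lambda>x. f0 x - g0 x) \<le> ennreal (8 * (4 * 2 powr p) * E)"
    proof (rule Gag_pow_fold[where \<alpha>=\<alpha>])
      show "(\<integral>\<^sup>+r. \<integral>\<^sup>+s. ennreal (if 0 < r \<and> r < s \<and> s \<le> pi then (\<alpha> r - \<alpha> s) powr p / (s - r)\<^sup>2 else 0) \<partial>lborel \<partial>lborel) \<le> ennreal E"
        unfolding E_def by (rule log_energy[OF p \<kappa>(1) cm m0 d\<alpha> osc tot \<beta>_def])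
    qed (use p c\<alpha> anti u E0 in auto)
    also have "8 * (4 * 2 powr p) * E = K * \<kappa> powr (p - 1)" by (simp add: E_def K_def powr_mult)
    also have "K * \<kappa> powr (p - 1) \<le> K * ((\<epsilon> / K) powr (1 / (p - 1))) powr (p - 1)"
      using \<kappa> p K by (intro mult_left_mono powr_mono2) (auto simp: \<kappa>0_def)
    also have "\<dots> = \<epsilon>" using p K \<epsilon> by (simp add: powr_powr)
    finally show ?thesis by (simp add: ennreal_leI)
  qed
  have L: "Lp_pow 1 (\<lambda>x. f0 x - g0 x) \<le> ennreal \<epsilon>"
  proof -
    have [measurable]: "\<alpha> \<in> borel_measurable borel" using c\<alpha> by (simp add: borel_measurable_continuous_onI)
    define F where "F = (\<lambda>r. ennreal (2 * \<bar>sin (\<alpha> r)\<bar>))"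
    have [measurable]: "F \<in> borel_measurable borel" unfolding F_def by measurable
    have "Lp_pow 1 (\<lambda>x. f0 x - g0 x) = (\<integral>\<^sup>+x. F \<bar>x - pi\<bar> * indicator {0..2*pi} x \<partial>lborel)"
      unfolding Lp_pow_def nn_integral_completion
      by (intro nn_integral_cong) (use u in \<open>auto simp: F_def indicator_def norm_mult\<close>)
    also have "\<dots> \<le> 2 * (\<integral>\<^sup>+r. F r * indicator {0..pi} r \<partial>lborel)" by (rule nn_integral_fold) measurable
    also have "(\<integral>\<^sup>+r. F r * indicator {0..pi} r \<partial>lborel) \<le> (\<integral>\<^sup>+r. ennreal (4 * \<kappa> * pi powr (1/2)) * (ennreal (r powr (1/2 - 1)) * indicator {0..pi} r) \<partial>lborel)"
    proof (rule nn_integral_mono_AE)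
      have 1: "F r \<le> ennreal (4 * \<kappa> * pi powr (1/2)) * ennreal (r powr (1/2 - 1))" if r: "0 < r" "r < pi" for r
      proof -
        have "\<bar>sin (\<alpha> r)\<bar> \<le> \<bar>\<alpha> r\<bar>" by (rule abs_sin_x_le_abs_x)
        also have "\<bar>\<alpha> r\<bar> = \<alpha> r - \<alpha> pi" using anti[of r pi] r \<alpha>pi by simp
        also have "\<dots> \<le> \<kappa> * ln (pi / r)" using osc r by simp
        also have "ln (pi / r) = ln (1 + (pi - r) / r)" using r by (simp add: field_simps)
        \<comment> \<open>Any exponent below 1 would make the logarithm integrable at 0; here the
          inequality is used with 2 in place of p.\<close>
        also have "\<dots> \<le> 2 * ((pi - r) / r) powr (1/2)" using r by (intro ln_one_plus_le_powr) auto
        also have "((pi - r) / r) powr (1/2) \<le> (pi / r) powr (1/2)" using r by (intro powr_mono2 divide_right_mono) auto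
        also have "(pi / r) powr (1/2) = pi powr (1/2) * r powr (1/2 - 1)"
          using r powr_divide[of pi r "1/2"] powr_minus_divide[of r "1/2"] by simp
        finally have "2 * \<bar>sin (\<alpha> r)\<bar> \<le> 4 * \<kappa> * pi powr (1/2) * r powr (1/2 - 1)" using \<kappa> by (simp add: mult_left_mono mult.assoc)
        then show ?thesis using \<kappa> by (simp add: F_def ennreal_mult'[symmetric] ennreal_leI)
      qed
      have "AE r in lborel. r \<noteq> (0::real)" "AE r in lborel. r \<noteq> pi" by (rule AE_lborel_singleton)+
      then show "AE r in lborel. F r * indicator {0..pi} r \<le> ennreal (4 * \<kappa> * pi powr (1/2)) * (ennreal (r powr (1/2 - 1)) * indicator {0..pi} r)"
        by eventually_elim (use 1 in \<open>auto simp: indicator_def\<close>)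
    qed
    also have "\<dots> = ennreal (4 * \<kappa> * pi powr (1/2)) * (\<integral>\<^sup>+r. ennreal (r powr (1/2 - 1)) * indicator {0..pi} r \<partial>lborel)"
      by (rule nn_integral_cmult) measurable
    also have "(\<integral>\<^sup>+r. ennreal (r powr (1/2 - 1)) * indicator {0..pi} r \<partial>lborel) = ennreal (pi powr (1/2) / (1/2))"
      by (rule nn_integral_powr_0) auto
    also have "ennreal (4 * \<kappa> * pi powr (1/2)) * ennreal (pi powr (1/2) / (1/2)) = ennreal (8 * \<kappa> * pi)"
    proof -
      have "4 * \<kappa> * pi powr (1/2) * (pi powr (1/2) / (1/2)) = 8 * \<kappa> * (pi powr (1/2) * pi powr (1/2))" by simp
      also have "pi powr (1/2) * pi powr (1/2) = pi" by (simp add: powr_add[symmetric])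
      finally have *: "4 * \<kappa> * pi powr (1/2) * (pi powr (1/2) / (1/2)) = 8 * \<kappa> * pi" .
      have "0 \<le> 4 * \<kappa> * pi powr (1/2)" using \<kappa> by simp
      from ennreal_mult'[OF this, of "pi powr (1/2) / (1/2)"] show ?thesis unfolding * ..
    qed
    finally have "Lp_pow 1 (\<lambda>x. f0 x - g0 x) \<le> 2 * ennreal (8 * \<kappa> * pi)" by (simp add: mult_left_mono)
    also have "2 * ennreal (8 * \<kappa> * pi) = ennreal (16 * pi * \<kappa>)"
      using \<kappa> ennreal_mult'[of 2 "8 * \<kappa> * pi"] by (simp add: mult_ac)
    also have "\<dots> \<le> ennreal \<epsilon>"
    proof (rule ennreal_leI)
      have "\<kappa> \<le> \<epsilon> / (16 * pi)" using \<kappa> by (simp add: \<kappa>0_def)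
      then show "16 * pi * \<kappa> \<le> \<epsilon>" by (simp add: field_simps)
    qed
    finally show ?thesis .
  qed
  show ?thesis
  proof (rule that[of f0 g0])
    show "smooth f0" "smooth g0" unfolding f0_def g0_def by (intro smooth_cis s\<phi> s\<psi>)+
    show "periodic2pi f0" "periodic2pi g0" by (simp_all add: periodic2pi_def f0_def g0_def inc cis.ctr)
    show "cmod (f0 x) = 1" "cmod (g0 x) = 1" for x by (simp_all add: f0_def g0_def)
    show "top_deg f0 = 1" using top_deg_cis[OF s\<phi>] inc(1)[of 0] by (simp add: f0_def)
    show "top_deg g0 = 0" using top_deg_cis[OF s\<psi>] inc(2)[of 0] by (simp add: g0_def)
    show "f0 x = g0 x" if "0 \<le> cos x" for x using diff[of x] sin0[OF that] by simp
  qed (rule L, rule G)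
qed

section \<open>Vanishing of the distance when s p = 1\<close>

lemma Gag_pow_shift: "Gag_pow \<sigma> p (\<lambda>x. v x - m) = Gag_pow \<sigma> p v"
  unfolding Gag_pow_def by simp

lemma S1_mean_le_Lp:
  assumes h: "continuous_on UNIV h"
  shows "ennreal (2*pi * cmod (S1_mean h)) \<le> Lp_pow 1 h"
proof -
  have c: "continuous_on {0..2*pi} h" using h continuous_on_subset by blast
  have "(LINT x:{0..2*pi}|lebesgue. h x) = integral {0..2*pi} h"
    by (intro set_lebesgue_integral_eq_integral set_integrable_continuous h)
  then have "2*pi * cmod (S1_mean h) = cmod (integral {0..2*pi} h)"
    by (simp add: S1_mean_def norm_divide norm_mult)
  also have "\<dots> \<le> integral {0..2*pi} (\<lambda>x. cmod (h x))"
    using c by (intro integral_norm_bound_integral integrable_continuous_interval continuous_on_norm) auto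
  finally have "ennreal (2*pi * cmod (S1_mean h)) \<le> ennreal (integral {0..2*pi} (\<lambda>x. cmod (h x)))" by (rule ennreal_leI)
  also have "\<dots> = (\<integral>\<^sup>+x. ennreal (cmod (h x)) * indicator {0..2*pi} x \<partial>lborel)"
    using c by (intro nn_integral_continuous_Icc[symmetric] continuous_on_norm) auto
  also have "\<dots> = Lp_pow 1 h" unfolding Lp_pow_def nn_integral_completion by simp
  finally show ?thesis .
qed

text \<open>Since |h - m| <= 4 for the mean m, its p-th power is at most 4^(p - 1) times its first
  power, and the mean costs no more than h in L^1. This is why \<open>critical_pair\<close> controls
  only the L^1 norm.\<close>

lemma Lp_pow_mean_le:
  assumes p: "1 \<le> p" and h: "continuous_on UNIV h" and b: "\<And>x. cmod (h x) \<le> 2"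
  shows "Lp_pow p (\<lambda>x. h x - S1_mean h) \<le> ennreal (4 powr (p - 1)) * (Lp_pow 1 h + Lp_pow 1 h)"
proof -
  have [measurable]: "h \<in> borel_measurable borel" using h by (simp add: borel_measurable_continuous_onI)
  define m where "m = S1_mean h"
  have m: "cmod m \<le> 2" unfolding m_def by (rule S1_mean_bound[OF h b])
  have pw: "cmod (h x - m) powr p \<le> 4 powr (p - 1) * (cmod (h x) + cmod m)" for x
  proof -
    have t: "cmod (h x - m) \<le> cmod (h x) + cmod m" by (rule norm_triangle_ineq4)
    have "cmod (h x - m) powr p = cmod (h x - m) * cmod (h x - m) powr (p - 1)" using p by (cases "h x = m") (auto simp: powr_mult_base)
    also have "\<dots> \<le> (cmod (h x) + cmod m) * 4 powr (p - 1)"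
      using t b[of x] m p by (intro mult_mono powr_mono2) auto
    finally show ?thesis by (simp add: mult.commute)
  qed
  have "Lp_pow p (\<lambda>x. h x - m) \<le> (\<integral>\<^sup>+x. ennreal (4 powr (p - 1)) * (ennreal (cmod (h x) powr 1) * indicator {0..2*pi} x + ennreal (cmod m) * indicator {0..2*pi} x) \<partial>lborel)"
    unfolding Lp_pow_def nn_integral_completion
    by (intro nn_integral_mono)
      (use pw in \<open>auto simp: indicator_def ennreal_mult'[symmetric] ennreal_plus[symmetric] simp del: ennreal_plus intro!: ennreal_leI\<close>)
  also have "\<dots> = ennreal (4 powr (p - 1)) * ((\<integral>\<^sup>+x. ennreal (cmod (h x) powr 1) * indicator {0..2*pi} x \<partial>lborel) + (\<integral>\<^sup>+x. ennreal (cmod m) * indicator {0..2*pi} x \<partial>lborel))"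
    by (rule nn_integral_cmult_add) measurable
  also have "(\<integral>\<^sup>+x. ennreal (cmod m) * indicator {0..2*pi} x \<partial>lborel) = ennreal (2*pi * cmod m)"
    by (simp add: nn_integral_cmult_indicator ennreal_mult' mult.commute)
  also have "(\<integral>\<^sup>+x. ennreal (cmod (h x) powr 1) * indicator {0..2*pi} x \<partial>lborel) = Lp_pow 1 h"
    unfolding Lp_pow_def nn_integral_completion ..
  also have "ennreal (4 powr (p - 1)) * (Lp_pow 1 h + ennreal (2*pi * cmod m)) \<le> ennreal (4 powr (p - 1)) * (Lp_pow 1 h + Lp_pow 1 h)"
    unfolding m_def by (intro mult_left_mono add_left_mono S1_mean_le_Lp h) auto
  finally show ?thesis by (simp add: m_def)
qed

text \<open>n depends only on d1 and d2 and stays fixed while \<epsilon> tends to 0. The factor n^2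
  lost in scaling the Gagliardo energy is part of the constant C.\<close>

lemma dist_E_critical:
  assumes p: "1 < p" shows "dist_E (1/p) p d1 d2 = 0"
proof (cases "d1 = d2")
  case True then show ?thesis using dist_E_same[of "1/p" p] p by simp
next
  case False
  have s: "0 < 1/p" and p1: "1 \<le> p" using p by auto
  define n where "n = nat \<bar>d1 - d2\<bar>"
  have n: "0 < n" using False by (simp add: n_def)
  define C where "C = 4 powr (p - 1) * 2 + real n powr 2"
  have C: "C > 0" unfolding C_def using n by (intro add_pos_pos) auto
  have le: "dist_E (1/p) p d1 d2 \<le> (C * \<epsilon>) powr (1/p)" if \<epsilon>: "0 < \<epsilon>" for \<epsilon>
  proof -
    obtain f0 g0 where f0: "smooth f0" "periodic2pi f0" "\<And>x. cmod (f0 x) = 1" "top_deg f0 = 1"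
      and g0: "smooth g0" "periodic2pi g0" "\<And>x. cmod (g0 x) = 1" "top_deg g0 = 0"
      and eq: "\<And>x. 0 \<le> cos x \<Longrightarrow> f0 x = g0 x"
      and LG: "Lp_pow 1 (\<lambda>x. f0 x - g0 x) \<le> ennreal \<epsilon>" "Gag_pow (1/p) p (\<lambda>x. f0 x - g0 x) \<le> ennreal \<epsilon>"
      by (rule critical_pair[OF p \<epsilon>]) (rule that, (assumption | blast)+)
    obtain f g e where fg: "smooth f" "periodic2pi f" "\<And>x. cmod (f x) = 1" "top_deg f = of_int d1"
      "smooth g" "periodic2pi g" "\<And>x. cmod (g x) = 1" "top_deg g = of_int d2"
      and e: "\<bar>e\<bar> = (1::real)" and h: "\<And>x. f x - g x = of_real e * (f0 (real n * x) - g0 (real n * x))"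
      by (rule realize_pair[OF f0 g0 _ False n_def]) (erule eq, rule that, assumption+)
    define w where "w = (\<lambda>x. f0 x - g0 x)"
    have w: "smooth w" unfolding w_def by (intro smooth_diff f0 g0)
    have pw: "periodic2pi w" using f0(2) g0(2) by (simp add: w_def periodic2pi_def)
    have wm: "w \<in> borel_measurable borel" by (rule smooth_measurable[OF w])
    have wm': "(\<lambda>x. w (real n * x)) \<in> borel_measurable borel" using wm by measurable
    obtain D where D: "D 0 = w" "\<And>k t. (D k has_vector_derivative D (Suc k) t) (at t)" using smooth_derivs[OF w] by metis
    define H where "H = (\<lambda>x. f x - g x)"
    have Hw: "H x = of_real e * w (real n * x)" for x by (simp add: H_def h w_def)
    then have Hw': "H = (\<lambda>x. of_real e * w (real n * x))" by auto
    have HD: "H x = of_real e * D 0 (real n * x)" for x by (simp add: Hw D(1))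
    have Hc: "continuous_on UNIV H" unfolding H_def by (intro smooth_continuous_on smooth_diff fg)
    have Hb: "cmod (H x) \<le> 2" for x
      using norm_triangle_ineq4[of "f x" "g x"] fg(3,7) by (simp add: H_def)
    have L1: "Lp_pow 1 H \<le> ennreal \<epsilon>"
      using LG(1) e unfolding Hw' Lp_pow_cmult[OF wm'] Lp_pow_scale[OF wm pw n] by (simp add: w_def)
    have Lp: "Lp_pow p (\<lambda>x. H x - S1_mean H) \<le> ennreal (4 powr (p - 1) * 2 * \<epsilon>)"
    proof -
      have "Lp_pow p (\<lambda>x. H x - S1_mean H) \<le> ennreal (4 powr (p - 1)) * (Lp_pow 1 H + Lp_pow 1 H)" by (rule Lp_pow_mean_le[OF p1 Hc Hb])
      also have "\<dots> \<le> ennreal (4 powr (p - 1)) * (ennreal \<epsilon> + ennreal \<epsilon>)" by (intro mult_left_mono add_mono L1) auto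
      also have "\<dots> = ennreal (4 powr (p - 1) * 2 * \<epsilon>)"
        using \<epsilon> by (simp add: ennreal_plus[symmetric] ennreal_mult'[symmetric] mult.assoc del: ennreal_plus)
      finally show ?thesis .
    qed
    have Gg: "Gag_pow (1/p) p (\<lambda>x. H x - S1_mean H) \<le> ennreal (real n powr 2 * \<epsilon>)"
    proof -
      have "Gag_pow (1/p) p (\<lambda>x. H x - S1_mean H) = Gag_pow (1/p) p (\<lambda>x. w (real n * x))"
        unfolding Gag_pow_shift Hw' Gag_pow_cmult[OF wm'] using e by simp
      also have "\<dots> \<le> ennreal (real n powr (1 + 1/p * p)) * Gag_pow (1/p) p w" by (rule Gag_pow_scale_le[OF wm pw n]) (use p in simp)
      also have "\<dots> \<le> ennreal (real n powr (1 + 1/p * p)) * ennreal \<epsilon>" unfolding w_def by (intro mult_left_mono LG) auto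
      also have "1 + 1/p * p = 2" using p by simp
      finally show ?thesis using \<epsilon> by (simp add: ennreal_mult'[symmetric])
    qed
    define E where "E = (\<lambda>j x. of_real e * of_real (real n ^ j) * D j (real n * x) - (if j = 0 then S1_mean H else 0))"
    have E0: "E 0 = (\<lambda>x. H x - S1_mean H)" by (auto simp: E_def HD)
    have fl: "\<lfloor>1/p\<rfloor> = 0" using p by (simp add: floor_eq_iff)
    have "Wsp_pow (1/p) p E = Lp_pow p (E 0) + Gag_pow (1/p) p (E 0)" using p by (simp add: Wsp_pow_def fl)
    also have "\<dots> \<le> ennreal (4 powr (p - 1) * 2 * \<epsilon>) + ennreal (real n powr 2 * \<epsilon>)" unfolding E0 by (intro add_mono Lp Gg)
    also have "\<dots> = ennreal (C * \<epsilon>)" using \<epsilon> by (simp add: C_def ennreal_plus[symmetric] distrib_right del: ennreal_plus)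
    finally have "enn2real (Wsp_pow (1/p) p E) \<le> C * \<epsilon>" using C \<epsilon> by (intro enn2real_leI) auto
    moreover have "Wsp_seminorm (1/p) p H = enn2real (Wsp_pow (1/p) p E) powr (1/p)"
      unfolding E_def by (rule Wsp_seminorm_scaled[where D=D, OF s p1 D(2) pw[folded D(1)] HD])
    ultimately have "Wsp_seminorm (1/p) p H \<le> (C * \<epsilon>) powr (1/p)" using p by (auto intro!: powr_mono2)
    then show ?thesis
      using dist_E_le[OF smooth_in_Edeg[OF s p1 fg(1-4)] smooth_in_Edeg[OF s p1 fg(5-8)]] unfolding H_def by simp
  qed
  have "dist_E (1/p) p d1 d2 \<le> 0"
  proof (rule field_le_epsilon)
    fix \<delta> :: real assume \<delta>: "0 < \<delta>"
    \<comment> \<open>The value of \<epsilon> is obtained by solving (C \<epsilon>)^(1/p) =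
      \<delta>.\<close>
    have "dist_E (1/p) p d1 d2 \<le> (C * (\<delta> powr p / C)) powr (1/p)" using C \<delta> by (intro le) auto
    also have "\<dots> = \<delta>" using C \<delta> p by (simp add: powr_powr)
    finally show "dist_E (1/p) p d1 d2 \<le> 0 + \<delta>" by simp
  qed
  then show ?thesis using dist_E_nonneg[OF s p1, of d1 d2] by simp
qed

subsection \<open>The lower bound\<close>

lemma top_energy_diff_le:
  assumes "u \<in> borel_measurable lebesgue" "v \<in> borel_measurable lebesgue" "0 \<le> p"
  shows "top_energy \<sigma> p (\<lambda>x. u x - v x) \<le> ennreal (2 powr p) * (top_energy \<sigma> p u + top_energy \<sigma> p v)"
  unfolding top_energy_def using Gag_pow_diff_le[OF assms] Lp_pow_diff_le[OF assms] by simp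

lemma top_energy_le_Wsp_pow: "top_energy (s - of_int \<lfloor>s\<rfloor>) p (D (nat \<lfloor>s\<rfloor>)) \<le> Wsp_pow s p D"
proof (cases "s - of_int \<lfloor>s\<rfloor> > 0")
  case True then show ?thesis by (simp add: top_energy_def Wsp_pow_def)
next
  case False
  have "Lp_pow p (D (nat \<lfloor>s\<rfloor>)) \<le> (\<Sum>j\<le>nat \<lfloor>s\<rfloor>. Lp_pow p (D j))" by (intro member_le_sum) auto
  then show ?thesis using False by (simp add: top_energy_def Wsp_pow_def)
qed

lemma Wsp_pow_diff_le:
  assumes D: "weak_derivs (nat \<lfloor>s\<rfloor>) f D" and D': "weak_derivs (nat \<lfloor>s\<rfloor>) f' D'" and p: "0 \<le> p"
  shows "Wsp_pow s p (\<lambda>j x. D j x - D' j x) \<le> ennreal (2 powr p) * (Wsp_pow s p D + Wsp_pow s p D')"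
proof -
  define k where "k = nat \<lfloor>s\<rfloor>"
  have m: "D j \<in> borel_measurable lebesgue" "D' j \<in> borel_measurable lebesgue" if "j \<le> k" for j
    using D D' that by (auto simp: weak_derivs_def k_def)
  have "(\<Sum>j\<le>k. Lp_pow p (\<lambda>x. D j x - D' j x)) \<le> (\<Sum>j\<le>k. ennreal (2 powr p) * (Lp_pow p (D j) + Lp_pow p (D' j)))"
    using p by (intro sum_mono Lp_pow_diff_le m) auto
  also have "\<dots> = ennreal (2 powr p) * ((\<Sum>j\<le>k. Lp_pow p (D j)) + (\<Sum>j\<le>k. Lp_pow p (D' j)))"
    by (simp add: sum_distrib_left[symmetric] sum.distrib)
  finally have 1: "(\<Sum>j\<le>k. Lp_pow p (\<lambda>x. D j x - D' j x)) \<le> ennreal (2 powr p) * ((\<Sum>j\<le>k. Lp_pow p (D j)) + (\<Sum>j\<le>k. Lp_pow p (D' j)))" .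
  have 2: "Gag_pow \<sigma> p (\<lambda>x. D k x - D' k x) \<le> ennreal (2 powr p) * (Gag_pow \<sigma> p (D k) + Gag_pow \<sigma> p (D' k))" for \<sigma>
    using p by (intro Gag_pow_diff_le m) auto
  show ?thesis unfolding Wsp_pow_def k_def[symmetric]
    using add_mono[OF 1 2[of "s - of_int \<lfloor>s\<rfloor>"]] 1 by (auto simp: distrib_left add_ac)
qed

lemma Wsp_norm_tendsto_0:
  assumes p: "1 \<le> p" and W: "\<And>n. weak_derivs (nat \<lfloor>s\<rfloor>) (h n) (D n)" "\<And>n. Wsp_pow s p (D n) < \<infinity>"
    and lim: "(\<lambda>n. Wsp_norm s p (h n)) \<longlonglongrightarrow> 0"
  shows "(\<lambda>n. enn2real (Wsp_pow s p (D n))) \<longlonglongrightarrow> 0"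
proof -
  have eq: "Wsp_norm s p (h n) powr p = enn2real (Wsp_pow s p (D n))" for n
    using Wsp_norm_eq[OF W] p by (simp add: powr_powr)
  have "(\<lambda>n. Wsp_norm s p (h n) powr p) \<longlonglongrightarrow> 0"
    by (rule tendsto_zero_powrI[OF lim tendsto_const]) (use p in \<open>auto simp: Wsp_norm_def\<close>)
  then show ?thesis unfolding eq .
qed

text \<open>The smooth lower bound is applied to the approximants of f and g and carried to the
  limit by two quasi-triangle inequalities for the top order energy, whence the factor 4^p.
  Continuity of the degree never enters: it is built into the definition of
  \<open>Edeg\<close>.\<close>

lemma dist_E_lower:
  assumes s: "0 < s" and p: "1 \<le> p" and sp: "1 < s * p"
  obtains C' where "0 < C'" "\<And>d1 d2 :: int. C' * \<bar>real_of_int (d1 - d2)\<bar> powr s \<le> dist_E s p d1 d2"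
proof -
  define k where "k = nat \<lfloor>s\<rfloor>"
  define \<sigma> where "\<sigma> = s - of_int \<lfloor>s\<rfloor>"
  have ks: "real k + \<sigma> = s" "0 \<le> \<sigma>" using s by (auto simp: k_def \<sigma>_def)
  have k1: "k > 0" if "\<not> \<sigma> > 0" using that ks s by (cases k) auto
  have "1 < (real k + \<sigma>) * p" using sp ks(1) by simp
  from top_energy_ge_smooth[OF ks(2) p this]
  obtain c where c: "0 < c" "\<forall>f g D (d1::int) (d2::int). smooth f \<longrightarrow> smooth g \<longrightarrow> periodic2pi f \<longrightarrow> periodic2pi g
    \<longrightarrow> (\<forall>x. cmod (f x) = 1) \<longrightarrow> (\<forall>x. cmod (g x) = 1) \<longrightarrow> top_deg f = of_int d1 \<longrightarrow> top_deg g = of_int d2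
    \<longrightarrow> D 0 = (\<lambda>x. f x - g x) \<longrightarrow> (\<forall>k t. (D k has_vector_derivative D (Suc k) t) (at t))
    \<longrightarrow> ennreal (c * \<bar>real_of_int (d1 - d2)\<bar> powr ((real k + \<sigma>) * p)) \<le> top_energy \<sigma> p (D k)"
    by blast
  have "(c / 4 powr p) powr (1/p) * \<bar>real_of_int (d1 - d2)\<bar> powr s \<le> dist_E s p d1 d2" for d1 d2 :: int
  proof (rule dist_E_ge[OF s p])
    fix f g assume f: "f \<in> Edeg s p d1" and g: "g \<in> Edeg s p d2"
    obtain fn where fn: "\<And>n::nat. smooth (fn n)" "\<And>n. periodic2pi (fn n)" "\<And>n x. cmod (fn n x) = 1" "\<And>n. top_deg (fn n) = of_int d1"
      "(\<lambda>n. Wsp_norm s p (\<lambda>x. fn n x - f x)) \<longlonglongrightarrow> 0"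
      using f by (auto simp: Edeg_def smooth_periodic_iff)
    obtain gn where gn: "\<And>n::nat. smooth (gn n)" "\<And>n. periodic2pi (gn n)" "\<And>n x. cmod (gn n x) = 1" "\<And>n. top_deg (gn n) = of_int d2"
      "(\<lambda>n. Wsp_norm s p (\<lambda>x. gn n x - g x)) \<longlonglongrightarrow> 0"
      using g by (auto simp: Edeg_def smooth_periodic_iff)
    obtain F where F: "weak_derivs k f F" "Wsp_pow s p F < \<infinity>"
      using f by (auto simp: Edeg_def WspS1_def Wsp_def k_def)
    obtain G where G: "weak_derivs k g G" "Wsp_pow s p G < \<infinity>"
      using g by (auto simp: Edeg_def WspS1_def Wsp_def k_def)
    have "\<exists>D. D 0 = fn n \<and> (\<forall>k t. (D k has_vector_derivative D (Suc k) t) (at t))" for n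
      using smooth_derivs[OF fn(1)[of n]] by metis
    then obtain A where A: "\<And>n. A n 0 = fn n" "\<And>n k t. (A n k has_vector_derivative A n (Suc k) t) (at t)" by metis
    have "\<exists>D. D 0 = gn n \<and> (\<forall>k t. (D k has_vector_derivative D (Suc k) t) (at t))" for n
      using smooth_derivs[OF gn(1)[of n]] by metis
    then obtain B where B: "\<And>n. B n 0 = gn n" "\<And>n k t. (B n k has_vector_derivative B n (Suc k) t) (at t)" by metis
    have wA: "weak_derivs k (fn n) (A n)" "Wsp_pow s p (A n) < \<infinity>" for n
      using weak_derivs_classical[of "A n" k] smooth_Wsp_pow_finite[OF s p, of "A n"] A[of n] fn(2)[of n] by auto
    have wB: "weak_derivs k (gn n) (B n)" "Wsp_pow s p (B n) < \<infinity>" for n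
      using weak_derivs_classical[of "B n" k] smooth_Wsp_pow_finite[OF s p, of "B n"] B[of n] gn(2)[of n] by auto
    have fin: "Wsp_pow s p (\<lambda>j x. D j x - D' j x) < \<infinity>"
      if "weak_derivs k h D" "weak_derivs k h' D'" "Wsp_pow s p D < \<infinity>" "Wsp_pow s p D' < \<infinity>" for h h' D D'
    proof -
      have "Wsp_pow s p (\<lambda>j x. D j x - D' j x) \<le> ennreal (2 powr p) * (Wsp_pow s p D + Wsp_pow s p D')"
        using that p by (intro Wsp_pow_diff_le) (auto simp: k_def)
      also have "\<dots> < \<infinity>" using that by (simp add: ennreal_mult_less_top)
      finally show ?thesis .
    qed
    define AF where "AF = (\<lambda>n j x. A n j x - F j x)"
    define BG where "BG = (\<lambda>n j x. B n j x - G j x)"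
    have AF: "weak_derivs k (\<lambda>x. fn n x - f x) (AF n)" "Wsp_pow s p (AF n) < \<infinity>" for n
      unfolding AF_def by (rule weak_derivs_diff[OF wA(1) F(1)], rule fin[OF wA(1) F(1) wA(2) F(2)])
    have BG: "weak_derivs k (\<lambda>x. gn n x - g x) (BG n)" "Wsp_pow s p (BG n) < \<infinity>" for n
      unfolding BG_def by (rule weak_derivs_diff[OF wB(1) G(1)], rule fin[OF wB(1) G(1) wB(2) G(2)])
    define a where "a = (\<lambda>n. enn2real (Wsp_pow s p (AF n)))"
    define b where "b = (\<lambda>n. enn2real (Wsp_pow s p (BG n)))"
    have a0: "a \<longlonglongrightarrow> 0" unfolding a_def by (rule Wsp_norm_tendsto_0[OF p AF[unfolded k_def] fn(5)])
    have b0: "b \<longlonglongrightarrow> 0" unfolding b_def by (rule Wsp_norm_tendsto_0[OF p BG[unfolded k_def] gn(5)])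
    have ea: "Wsp_pow s p (AF n) = ennreal (a n)" and eb: "Wsp_pow s p (BG n) = ennreal (b n)" for n
      using AF(2)[of n] BG(2)[of n] by (auto simp: a_def b_def)
    define m where "m = S1_mean (\<lambda>x. f x - g x)"
    define Y where "Y = (\<lambda>j x. F j x - G j x - (if j = 0 then m else 0))"
    have wFG: "weak_derivs k (\<lambda>x. f x - g x) (\<lambda>j x. F j x - G j x)" by (rule weak_derivs_diff[OF F(1) G(1)])
    have wY: "weak_derivs k (\<lambda>x. f x - g x - m) Y"
      using weak_derivs_diff[OF wFG weak_derivs_const[of k m]] by (simp add: Y_def)
    have "Wsp_pow s p (\<lambda>j x. if j = 0 then m else 0) < \<infinity>"
      using smooth_Wsp_pow_finite[OF s p, of "\<lambda>j x. if j = 0 then m else 0"] by (auto simp: periodic2pi_def)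
    from fin[OF wFG weak_derivs_const[of k m] fin[OF F(1) G(1) F(2) G(2)] this]
    have Yf: "Wsp_pow s p Y < \<infinity>" by (simp add: Y_def)
    define X where "X = enn2real (Wsp_pow s p Y)"
    have eX: "Wsp_pow s p Y = ennreal X" using Yf by (simp add: X_def)
    have X0: "0 \<le> X" by (simp add: X_def)
    have norm: "Wsp_seminorm s p (\<lambda>x. f x - g x) = X powr (1/p)"
      unfolding Wsp_seminorm_def m_def[symmetric] X_def by (rule Wsp_norm_eq[OF wY[unfolded k_def] Yf])
    have step: "c * \<bar>real_of_int (d1 - d2)\<bar> powr (s * p) \<le> 2 powr p * (a n + 2 powr p * (b n + X))" for n
    proof -
      define V where "V = (\<lambda>j x. A n j x - B n j x)"
      have V: "(V j has_vector_derivative V (Suc j) t) (at t)" for j t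
        unfolding V_def by (intro has_vector_derivative_diff A B)
      have "V 0 = (\<lambda>x. fn n x - gn n x)" by (auto simp: V_def A B)
      from c(2)[rule_format, of "fn n" "gn n" d1 d2 V, OF fn(1) gn(1) fn(2) gn(2) fn(3) gn(3) fn(4) gn(4) this V]
      have "ennreal (c * \<bar>real_of_int (d1 - d2)\<bar> powr (s * p)) \<le> top_energy \<sigma> p (V k)" by (simp add: ks(1))
      \<comment> \<open>Subtracting the mean of f - g leaves the top order energy unchanged: for k =
        0 one has \<sigma> > 0 and the double integral ignores constants, and for k > 0 nothing is
        subtracted at order k.\<close>
      also have "\<dots> = top_energy \<sigma> p (\<lambda>x. V k x - (if k = 0 then m else 0))"
        using k1 by (auto simp: top_energy_def Gag_pow_shift)
      \<comment> \<open>The approximation errors are split off, A - B = (A - F) - (B - G) + (F - G),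
        so that only \<open>Y\<close>, the derivatives of f - g minus its mean, survives in the
        limit.\<close>
      also have "(\<lambda>x. V k x - (if k = 0 then m else 0)) = (\<lambda>x. AF n k x - (BG n k x - Y k x))"
        by (auto simp: V_def AF_def BG_def Y_def)
      also have "top_energy \<sigma> p (\<lambda>x. AF n k x - (BG n k x - Y k x)) \<le> ennreal (2 powr p) * (top_energy \<sigma> p (AF n k) + top_energy \<sigma> p (\<lambda>x. BG n k x - Y k x))"
        using AF(1)[of n] BG(1)[of n] wY p by (intro top_energy_diff_le borel_measurable_diff) (auto simp: weak_derivs_def)
      also have "\<dots> \<le> ennreal (2 powr p) * (top_energy \<sigma> p (AF n k) + ennreal (2 powr p) * (top_energy \<sigma> p (BG n k) + top_energy \<sigma> p (Y k)))"
        using BG(1)[of n] wY p by (intro mult_left_mono add_left_mono top_energy_diff_le) (auto simp: weak_derivs_def)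
      also have "\<dots> \<le> ennreal (2 powr p) * (ennreal (a n) + ennreal (2 powr p) * (ennreal (b n) + ennreal X))"
        unfolding ea[symmetric] eb[symmetric] eX[symmetric] \<sigma>_def k_def
        by (intro mult_left_mono add_mono top_energy_le_Wsp_pow) auto
      also have "\<dots> = ennreal (2 powr p * (a n + 2 powr p * (b n + X)))"
        using X0 by (simp add: a_def b_def ennreal_plus[symmetric] ennreal_mult'[symmetric] del: ennreal_plus)
      finally show ?thesis using X0 by (subst (asm) ennreal_le_iff) (auto simp: a_def b_def)
    qed
    have "(\<lambda>n. 2 powr p * (a n + 2 powr p * (b n + X))) \<longlonglongrightarrow> 2 powr p * (0 + 2 powr p * (0 + X))"
      by (intro tendsto_intros a0 b0)
    then have "c * \<bar>real_of_int (d1 - d2)\<bar> powr (s * p) \<le> 2 powr p * (0 + 2 powr p * (0 + X))"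
      by (rule LIMSEQ_le_const) (use step in auto)
    also have "\<dots> = 4 powr p * X"
      using powr_mult[of 2 2 p] by simp
    finally have "c / 4 powr p * \<bar>real_of_int (d1 - d2)\<bar> powr (s * p) \<le> X" by (simp add: field_simps)
    then have "(c / 4 powr p * \<bar>real_of_int (d1 - d2)\<bar> powr (s * p)) powr (1/p) \<le> X powr (1/p)"
      using c(1) p by (intro powr_mono2) auto
    also have "(c / 4 powr p * \<bar>real_of_int (d1 - d2)\<bar> powr (s * p)) powr (1/p) = (c / 4 powr p) powr (1/p) * \<bar>real_of_int (d1 - d2)\<bar> powr s"
      using p by (simp only: powr_mult powr_powr) simp
    finally show "(c / 4 powr p) powr (1/p) * \<bar>real_of_int (d1 - d2)\<bar> powr s \<le> Wsp_seminorm s p (\<lambda>x. f x - g x)"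
      unfolding norm .
  qed
  then show ?thesis using c(1) by (intro that[of "(c / 4 powr p) powr (1/p)"]) auto
qed

theorem theorem1p3:
  shows "(\<forall>p::real. 1 < p \<longrightarrow> (\<forall>d1 d2 :: int. dist_E (1/p) p d1 d2 = 0)) \<and>
    (\<forall>s p :: real. 0 < s \<longrightarrow> 1 \<le> p \<longrightarrow> 1 < s * p \<longrightarrow>
       (\<exists>C C' :: real. C > 0 \<and> C' > 0 \<and> (\<forall>d1 d2 :: int.
          C' * \<bar>real_of_int (d1 - d2)\<bar> powr s \<le> dist_E s p d1 d2 \<and>
          dist_E s p d1 d2 \<le> C * \<bar>real_of_int (d1 - d2)\<bar> powr s)))"
proof (intro conjI allI impI)
  fix p :: real and d1 d2 :: int assume "1 < p"
  then show "dist_E (1/p) p d1 d2 = 0" by (rule dist_E_critical)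
next
  fix s p :: real assume sp: "0 < s" "1 \<le> p" "1 < s * p"
  obtain C where "0 < C" "\<And>d1 d2 :: int. dist_E s p d1 d2 \<le> C * \<bar>real_of_int (d1 - d2)\<bar> powr s"
    using dist_E_upper[OF sp(1,2)] by blast
  moreover obtain C' where "0 < C'" "\<And>d1 d2 :: int. C' * \<bar>real_of_int (d1 - d2)\<bar> powr s \<le> dist_E s p d1 d2"
    using dist_E_lower[OF sp] by blast
  ultimately show "\<exists>C C' :: real. C > 0 \<and> C' > 0 \<and> (\<forall>d1 d2 :: int.
          C' * \<bar>real_of_int (d1 - d2)\<bar> powr s \<le> dist_E s p d1 d2 \<and>
          dist_E s p d1 d2 \<le> C * \<bar>real_of_int (d1 - d2)\<bar> powr s)"
    by blast
qed

end
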